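(* There is a constant $C_J>0$, depending on the kernel $J$ but independent of $h$, such that if the time step $\tau>0$ satisfies $\tau\le\frac{2\gamma_0}{C_J\varepsilon^4}$, then every sequence $(u_h^n,\omega_h^n)_{n}$ in $\mathcal{C}^{per}_{N\times N}\times\mathcal{C}^{per}_{N\times N}$ satisfying, for all $n\ge0$, the first-order backward Euler scheme $$\frac{u_h^{n+1}-u_h^n}{\tau}=\Delta_h\omega_h^{n+1},\qquad \omega_h^{n+1}=F'(u_h^{n+1})+\varepsilon^2[J\circledast\mathbf 1]u_h^{n+1}-\varepsilon^2[J\circledast u_h^{n+1}],$$ converges as $n\to\infty$ to a steady state $(u_h^\infty,\omega_h^\infty)$, i.e. a solution of $$(u_h^\infty\|\mathbf 1)=(u_h^0\|\mathbf 1),\qquad \omega_h^\infty=F'(u_h^\infty)+\varepsilon^2[J\circledast\mathbf 1]u_h^\infty-\varepsilon^2[J\circledast u_h^\infty].$$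
   Context: Setting (two-dimensional case). $\Omega=(0,L)\times(0,L)$, $h=L/N$ with $N\in\mathbb{Z}^+$, and $\varepsilon>0$. The kernel $J$ is integrable, sufficiently smooth, $\Omega$-periodic ($L$-periodic in each variable) and even ($J(\mathbf x)=J(-\mathbf x)$), with $J*1=\int_\Omega J\,d\mathbf x>0$. $\mathcal{C}^{per}_{N\times N}$ is the finite-dimensional space of real periodic cell-centered grid functions $\phi=(\phi_{i,j})$ (values at $((i-\tfrac12)h,(j-\tfrac12)h)$), extended $N$-periodically in both indices $i,j\in\mathbb{Z}$. $\mathbf 1$ is the constant grid function $1$; products, powers and $F'(u_h)$ are taken componentwise. $(\phi\|\psi)=\sum_{i,j=1}^N\phi_{i,j}\psi_{i,j}$. Convergence is in this finite-dimensional space. Discrete Laplacian: $(\Delta_h\phi)_{i,j}=h^{-2}(\phi_{i+1,j}+\phi_{i-1,j}+\phi_{i,j+1}+\phi_{i,j-1}-4\phi_{i,j})$. Discrete convolution: with $J_{k+\frac12,l+\frac12}:=J(kh,lh)$, $[J\circledast\phi]_{i,j}=h^2\sum_{k=1}^N\sum_{l=1}^N J_{k+\frac12,l+\frac12}\,\phi_{i-k,j-l}$. $[J\circledast\mathbf 1]$ is a constant grid function, identified with the number $h^2\sum_{k,l=1}^N J(kh,lh)$. Standing assumption: $\gamma:=\varepsilon^2(J*1)-1>0$ and its discrete analogue $\gamma_0:=\varepsilon^2[J\circledast\mathbf 1]-1>0$. Potential: $F(r)=\frac14(r^2-1)^2$, so $F'(r)=r^3-r$. *)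

theory Defs
  imports "HOL-Analysis.Analysis"
begin

text \<open>A grid function assigns a real number to every index pair in \<open>\<int> \<times> \<int>\<close>; the value at
  \<open>(i, j)\<close> belongs to the cell centre \<open>((i - 1/2) h, (j - 1/2) h)\<close>. The space of periodic grid
  functions is a finite-dimensional subspace of \<open>int \<Rightarrow> int \<Rightarrow> real\<close>, and the library's (product)
  topology on this type restricts to its unique Hausdorff vector space topology.\<close>

type_synonym grid_fun = "int \<Rightarrow> int \<Rightarrow> real"

definition periodic_grid :: "nat \<Rightarrow> grid_fun set" where
  "periodic_grid N =
     {\<phi>. \<forall>i j. \<phi> (i + int N) j = \<phi> i j \<and> \<phi> i (j + int N) = \<phi> i j}"

definition grid_inner :: "nat \<Rightarrow> grid_fun \<Rightarrow> grid_fun \<Rightarrow> real" where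
  "grid_inner N \<phi> \<psi> = (\<Sum>i = 1..int N. \<Sum>j = 1..int N. \<phi> i j * \<psi> i j)"

definition grid_one :: grid_fun where
  "grid_one = (\<lambda>i j. 1)"

definition discrete_laplacian :: "real \<Rightarrow> grid_fun \<Rightarrow> grid_fun" where
  "discrete_laplacian h \<phi> = (\<lambda>i j.
     (\<phi> (i + 1) j + \<phi> (i - 1) j + \<phi> i (j + 1) + \<phi> i (j - 1) - 4 * \<phi> i j) / h\<^sup>2)"

definition discrete_conv ::
    "(real \<times> real \<Rightarrow> real) \<Rightarrow> nat \<Rightarrow> real \<Rightarrow> grid_fun \<Rightarrow> grid_fun" where
  "discrete_conv J N h \<phi> = (\<lambda>i j. h\<^sup>2 *
     (\<Sum>k = 1..int N. \<Sum>l = 1..int N.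
        J (of_int k * h, of_int l * h) * \<phi> (i - k) (j - l)))"

text \<open>The number with which the constant grid function \<open>discrete_conv J N h grid_one\<close> is
  identified.\<close>

definition discrete_conv_one :: "(real \<times> real \<Rightarrow> real) \<Rightarrow> nat \<Rightarrow> real \<Rightarrow> real" where
  "discrete_conv_one J N h =
     h\<^sup>2 * (\<Sum>k = 1..int N. \<Sum>l = 1..int N. J (of_int k * h, of_int l * h))"

lemma discrete_conv_grid_one:
  "discrete_conv J N h grid_one = (\<lambda>i j. discrete_conv_one J N h)"
  by (simp add: discrete_conv_def discrete_conv_one_def grid_one_def)

definition periodic_domain :: "real \<Rightarrow> (real \<times> real) set" where
  "periodic_domain L = {0<..<L} \<times> {0<..<L}"

text \<open>The constant function \<open>J * 1\<close>, as a number.\<close>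

definition conv_one :: "(real \<times> real \<Rightarrow> real) \<Rightarrow> real \<Rightarrow> real" where
  "conv_one J L = integral (periodic_domain L) J"

text \<open>``Sufficiently smooth'' is read as continuously differentiable on the plane.\<close>

definition admissible_kernel :: "real \<Rightarrow> (real \<times> real \<Rightarrow> real) \<Rightarrow> bool" where
  "admissible_kernel L J \<longleftrightarrow>
     J absolutely_integrable_on periodic_domain L \<and>
     (\<exists>J' :: real \<times> real \<Rightarrow> (real \<times> real) \<Rightarrow>\<^sub>L real.
        (\<forall>x. (J has_derivative blinfun_apply (J' x)) (at x)) \<and> continuous_on UNIV J') \<and>
     (\<forall>x y. J (x + L, y) = J (x, y) \<and> J (x, y + L) = J (x, y)) \<and>
     (\<forall>x. J (- x) = J x) \<and>
     conv_one J L > 0"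

definition gamma_cont :: "real \<Rightarrow> (real \<times> real \<Rightarrow> real) \<Rightarrow> real \<Rightarrow> real" where
  "gamma_cont \<epsilon> J L = \<epsilon>\<^sup>2 * conv_one J L - 1"

definition gamma_disc :: "real \<Rightarrow> (real \<times> real \<Rightarrow> real) \<Rightarrow> nat \<Rightarrow> real \<Rightarrow> real" where
  "gamma_disc \<epsilon> J N h = \<epsilon>\<^sup>2 * discrete_conv_one J N h - 1"

definition double_well :: "real \<Rightarrow> real" where
  "double_well r = (r\<^sup>2 - 1)\<^sup>2 / 4"

lemma deriv_double_well: "deriv double_well r = r ^ 3 - r"
proof -
  have "(double_well has_real_derivative r ^ 3 - r) (at r)"
    unfolding double_well_def
    by (auto intro!: derivative_eq_intros simp: power2_eq_square power3_eq_cube field_simps)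
  then show ?thesis
    by (rule DERIV_imp_deriv)
qed

definition chemical_potential ::
    "real \<Rightarrow> (real \<times> real \<Rightarrow> real) \<Rightarrow> nat \<Rightarrow> real \<Rightarrow> grid_fun \<Rightarrow> grid_fun" where
  "chemical_potential \<epsilon> J N h u = (\<lambda>i j.
     deriv double_well (u i j) + \<epsilon>\<^sup>2 * discrete_conv_one J N h * u i j
       - \<epsilon>\<^sup>2 * discrete_conv J N h u i j)"

definition backward_euler_solution ::
    "real \<Rightarrow> (real \<times> real \<Rightarrow> real) \<Rightarrow> nat \<Rightarrow> real \<Rightarrow> real \<Rightarrow>
     (nat \<Rightarrow> grid_fun) \<Rightarrow> (nat \<Rightarrow> grid_fun) \<Rightarrow> bool" where
  "backward_euler_solution \<epsilon> J N h \<tau> u \<omega> \<longleftrightarrow>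
     (\<forall>n. u n \<in> periodic_grid N \<and> \<omega> n \<in> periodic_grid N) \<and>
     (\<forall>n i j. (u (Suc n) i j - u n i j) / \<tau> = discrete_laplacian h (\<omega> (Suc n)) i j) \<and>
     (\<forall>n. \<omega> (Suc n) = chemical_potential \<epsilon> J N h (u (Suc n)))"

text \<open>A steady state is a time-independent solution of the scheme with the mass of \<open>u0\<close>; for a
  time-independent solution the evolution equation becomes \<open>discrete_laplacian h \<omega> = 0\<close>, i.e.
  \<open>\<omega>\<close> is constant.\<close>

definition steady_state ::
    "real \<Rightarrow> (real \<times> real \<Rightarrow> real) \<Rightarrow> nat \<Rightarrow> real \<Rightarrow> grid_fun \<Rightarrow> grid_fun \<Rightarrow> grid_fun \<Rightarrow> bool" where
  "steady_state \<epsilon> J N h u0 u \<omega> \<longleftrightarrow>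
     u \<in> periodic_grid N \<and> \<omega> \<in> periodic_grid N \<and>
     grid_inner N u grid_one = grid_inner N u0 grid_one \<and>
     (\<forall>i j. discrete_laplacian h \<omega> i j = 0) \<and>
     \<omega> = chemical_potential \<epsilon> J N h u"

end

theory Submission
  imports Defs
begin

text \<open>The scheme is a gradient descent for a polynomial energy \<open>E\<close> on the finite-dimensional
  space of grid functions of fixed mass: for small time steps one step of increment \<open>v\<close>
  decreases \<open>E\<close> by at least a multiple of \<open>\<parallel>v\<parallel>\<^sup>2\<close>, and \<open>\<parallel>v\<parallel>\<close> dominates the slope
  of \<open>E\<close> at the new point.  A Kurdyka--Lojasiewicz inequality
  \<open>E x - a \<le> C * slope x * (l (E x) - l a)\<close>, with \<open>l\<close> bounded and monotone, then makes the
  increments summable.  To obtain it, choose on every level \<open>E = t\<close> (within a compact set) a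
  point \<open>c t\<close> of least slope, lexicographically smallest among these.  By quantifier elimination
  over the reals \<open>c\<close> is semialgebraic, so near a critical level the coordinates of \<open>c\<close> and the
  slope along it are monotone, and the length of \<open>c\<close> serves as \<open>l\<close>.  Quantifier elimination
  follows the Cohen--Hoermander method: up to an increasing bijection of the line, the sign pattern
  of a family of polynomials is determined by that of the family in which a polynomial of maximal
  degree is replaced by its derivative and its remainders.\<close>

section \<open>Semialgebraic sets\<close>

text \<open>The obstacle is convergence of the whole sequence: dissipation alone only makes the
  increments tend to zero, and steady states of a given mass are not known to be isolated. The well
  is quartic, so energy, squared slope and mass are polynomials in the grid values and semialgebraic
  geometry suffices. Since the desingularizing function need only be bounded and monotone, the curve
  may jump; from the theory of definable functions only one-sided germs and monotonicity near an
  endpoint are required. Increments have zero sum, so only the oscillation of the chemical potential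
  counts. Its Laplacian controls that oscillation and is the increment divided by
  \<open>\<tau>\<close>, taken at the new point because the scheme is implicit. The constant is
  \<open>C\<^sub>J = C\<^sup>2 * L ^ 4 + 1\<close> with \<open>C\<close> a Lipschitz constant of
  \<open>J\<close>. Differences of the scaled kernel are at most
  \<open>\<epsilon>\<^sup>2 * h\<^sup>2 * (C * h)\<close>; squared and combined with the four powers
  of \<open>N\<close> from summing over the grid this gives
  \<open>C\<^sup>2 * L ^ 4 * \<epsilon> ^ 4 * h\<^sup>2\<close>, whose \<open>h\<^sup>2\<close> is
  cancelled by that of the Laplacian. The summand 1 keeps the constant positive for constant
  kernels.\<close>

inductive_set polyfun :: "((nat \<Rightarrow> real) \<Rightarrow> real) set" where
  const: "(\<lambda>_. c) \<in> polyfun"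
| var: "(\<lambda>x. x i) \<in> polyfun"
| add: "f \<in> polyfun \<Longrightarrow> g \<in> polyfun \<Longrightarrow> (\<lambda>x. f x + g x) \<in> polyfun"
| mult: "f \<in> polyfun \<Longrightarrow> g \<in> polyfun \<Longrightarrow> (\<lambda>x. f x * g x) \<in> polyfun"

lemma polyfun_uminus: "f \<in> polyfun \<Longrightarrow> (\<lambda>x. - f x) \<in> polyfun"
  using polyfun.mult[OF polyfun.const[of "-1"], of f] by simp

lemma polyfun_diff: "f \<in> polyfun \<Longrightarrow> g \<in> polyfun \<Longrightarrow> (\<lambda>x. f x - g x) \<in> polyfun"
  using polyfun.add[OF _ polyfun_uminus, of f g] by simp

lemma polyfun_power: "f \<in> polyfun \<Longrightarrow> (\<lambda>x. f x ^ n) \<in> polyfun"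
  by (induction n) (auto intro: polyfun.intros)

lemma polyfun_sum: "(\<And>i. i \<in> A \<Longrightarrow> f i \<in> polyfun) \<Longrightarrow> (\<lambda>x. \<Sum>i\<in>A. f i x) \<in> polyfun"
  by (induction A rule: infinite_finite_induct) (auto intro: polyfun.intros)

lemma polyfun_divide: "f \<in> polyfun \<Longrightarrow> (\<lambda>x. f x / c) \<in> polyfun"
  using polyfun.mult[OF _ polyfun.const[of "inverse c"], of f] by (simp add: divide_inverse)

lemmas polyfun_intros = polyfun.intros polyfun_uminus polyfun_diff polyfun_power polyfun_sum
  polyfun_divide

lemma polyfun_subst:
  assumes "f \<in> polyfun" "\<And>i. g i \<in> polyfun"
  shows "(\<lambda>x. f (\<lambda>i. g i x)) \<in> polyfun"
  using assms by (induction) (auto intro: polyfun.intros)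

lemma polyfun_continuous: "f \<in> polyfun \<Longrightarrow> continuous_on S f"
  by (induction rule: polyfun.induct)
    (auto intro!: continuous_intros 
       intro: continuous_on_subset[OF continuous_on_product_coordinates])

text \<open>Here \<open>d\<close> is a formal degree: the coefficient of index \<open>d\<close> may
  vanish at some parameters, which is why elimination has to split on it.\<close>

definition param_poly :: "nat \<Rightarrow> ((nat \<Rightarrow> real) \<Rightarrow> real poly) \<Rightarrow> bool" where
  "param_poly d q \<longleftrightarrow> (\<forall>x. degree (q x) \<le> d) \<and> (\<forall>i. (\<lambda>x. coeff (q x) i) \<in> polyfun)"

lemma polyfun_section:
  assumes "f \<in> polyfun"
  shows "\<exists>d q. param_poly d q \<and> (\<forall>x t. f (x(k := t)) = poly (q x) t)"
  using assms
proof induction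
  case (const c)
  show ?case
    by (rule exI[of _ 0], rule exI[of _ "\<lambda>_. [:c:]"])
      (auto simp: param_poly_def coeff_pCons polyfun_intros split: nat.split)
next
  case (var i)
  show ?case
  proof (cases "i = k")
    case True
    then show ?thesis
      by (intro exI[of _ 1] exI[of _ "\<lambda>_. [:0, 1:]"]) (auto simp: param_poly_def intro: polyfun_intros)
  next
    case False
    have "(\<lambda>x. coeff [:x i:] j) \<in> polyfun" for j
      by (cases j) (auto intro: polyfun_intros)
    with False show ?thesis
      by (intro exI[of _ 0] exI[of _ "\<lambda>x. [:x i:]"]) (auto simp: param_poly_def)
  qed
next
  case (add f g)
  then obtain d q e r where "param_poly d q" "\<forall>x t. f (x(k := t)) = poly (q x) t"
    "param_poly e r" "\<forall>x t. g (x(k := t)) = poly (r x) t"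
    by metis
  then show ?case
    by (intro exI[of _ "max d e"] exI[of _ "\<lambda>x. q x + r x"])
      (auto simp: param_poly_def simp del: fun_upd_apply
        intro!: degree_add_le polyfun_intros intro: le_max_iff_disj[THEN iffD2])
next
  case (mult f g)
  then obtain d q e r where *: "param_poly d q" "\<forall>x t. f (x(k := t)) = poly (q x) t"
    "param_poly e r" "\<forall>x t. g (x(k := t)) = poly (r x) t"
    by metis
  have "degree (q x * r x) \<le> d + e" for x
    using * by (meson add_mono degree_mult_le order_trans param_poly_def)
  with * show ?case
    by (intro exI[of _ "d + e"] exI[of _ "\<lambda>x. q x * r x"])
      (auto simp: param_poly_def coeff_mult simp del: fun_upd_apply intro!: polyfun_intros)
qed

inductive_set semialgebraic :: "(nat \<Rightarrow> real) set set" where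
  pos: "f \<in> polyfun \<Longrightarrow> {x. 0 < f x} \<in> semialgebraic"
| compl: "S \<in> semialgebraic \<Longrightarrow> - S \<in> semialgebraic"
| union: "S \<in> semialgebraic \<Longrightarrow> T \<in> semialgebraic \<Longrightarrow> S \<union> T \<in> semialgebraic"

lemma semialgebraic_inter: 
  "S \<in> semialgebraic \<Longrightarrow> T \<in> semialgebraic \<Longrightarrow> S \<inter> T \<in> semialgebraic"
  using semialgebraic.compl[OF semialgebraic.union[OF semialgebraic.compl semialgebraic.compl], of S T]
  by simp

lemma semialgebraic_empty: "{} \<in> semialgebraic"
  using semialgebraic.pos[OF polyfun.const[of 0]] by simp

lemma semialgebraic_UNIV: "UNIV \<in> semialgebraic"
  using semialgebraic.compl[OF semialgebraic_empty] by simp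

lemma semialgebraic_Union:
  "finite \<C> \<Longrightarrow> \<C> \<subseteq> semialgebraic \<Longrightarrow> \<Union>\<C> \<in> semialgebraic"
  by (induction \<C> rule: finite_induct) (auto intro: semialgebraic.union semialgebraic_empty)

lemma semialgebraic_zero:
  assumes "f \<in> polyfun" shows "{x. f x = 0} \<in> semialgebraic"
proof -
  have "{x. f x = 0} = - ({x. 0 < f x} \<union> {x. 0 < - f x})" by auto
  then show ?thesis
    using assms by (metis polyfun_uminus semialgebraic.intros)
qed

section \<open>Matching sign patterns by increasing bijections of the line\<close>

lemma strict_mono_on_extend:
  fixes h :: "real \<Rightarrow> real"
  assumes "finite A" "strict_mono_on A h"
  shows "\<exists>\<eta>. strict_mono \<eta> \<and> surj \<eta> \<and> (\<forall>a\<in>A. \<eta> a = h a)"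
  using assms
proof (induction A rule: finite_linorder_max_induct)
  case empty
  show ?case by (rule exI[of _ id]) (auto simp: strict_mono_def)
next
  case (insert m A)
  have "strict_mono_on A h"
    using insert.prems by (auto simp: strict_mono_on_def)
  then obtain \<eta> where \<eta>: "strict_mono \<eta>" "surj \<eta>" "\<And>a. a \<in> A \<Longrightarrow> \<eta> a = h a"
    using insert.IH by blast
  show ?case
  proof (cases "A = {}")
    case True
    show ?thesis
      using True by (intro exI[of _ "\<lambda>t. t + (h m - m)"])
        (auto simp: strict_mono_def intro!: surjI[where f = "\<lambda>t. t - (h m - m)"])
  next
    case False
    define c where "c = Max A"
    have c: "c \<in> A" "\<And>a. a \<in> A \<Longrightarrow> a \<le> c" and cm: "c < m"
      using False insert.hyps by (auto simp: c_def)
    define r where "r = (h m - \<eta> c) / (\<eta> m - \<eta> c)"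
    have "\<eta> c < h m"
      using insert.prems c cm \<eta>(3) by (auto simp: strict_mono_on_def)
    moreover have cm': "\<eta> c < \<eta> m"
      using \<eta>(1) cm by (auto simp: strict_mono_def)
    ultimately have r: "r > 0" by (auto simp: r_def)
    \<comment> \<open>\<open>\<eta>\<close> already has the right values except at the new maximum
      \<open>m\<close>. Composing it with a map that is the identity up to \<open>\<eta> c\<close>
      and linear of slope \<open>r\<close> beyond leaves these values alone and sends
      \<open>\<eta> m\<close> to \<open>h m\<close>.\<close>
    define \<kappa> where "\<kappa> y = (if y \<le> \<eta> c then y else \<eta> c + (y - \<eta> c) * r)" for y
    have "strict_mono \<kappa>"
    proof (rule strict_monoI)
      fix x y :: real assume "x < y"
      moreover have "0 < (y - \<eta> c) * r" if "y > \<eta> c" using that r by simp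
      moreover have "(x - \<eta> c) * r < (y - \<eta> c) * r" using \<open>x < y\<close> r by simp
      ultimately show "\<kappa> x < \<kappa> y" by (auto simp: \<kappa>_def)
    qed
    moreover have "surj \<kappa>"
    proof (rule surjI[where f = "\<lambda>z. if z \<le> \<eta> c then z else \<eta> c + (z - \<eta> c) / r"])
      fix z show "\<kappa> (if z \<le> \<eta> c then z else \<eta> c + (z - \<eta> c) / r) = z"
        using r by (auto simp: \<kappa>_def field_simps)
    qed
    moreover have "\<kappa> (\<eta> m) = h m" using cm' by (auto simp: \<kappa>_def r_def)
    moreover have "\<kappa> (\<eta> a) = h a" if "a \<in> A" for a
    proof -
      have "\<eta> a \<le> \<eta> c" using \<eta>(1) c(2)[OF that] by (simp add: strict_mono_less_eq)
      then show ?thesis using \<eta>(3)[OF that] by (simp add: \<kappa>_def)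
    qed
    moreover have "surj (\<kappa> \<circ> \<eta>)"
      using \<eta>(2) \<open>surj \<kappa>\<close> by (rule comp_surj)
    ultimately show ?thesis
      using \<eta> by (intro exI[of _ "\<kappa> \<circ> \<eta>"]) (auto simp: strict_mono_def)
  qed
qed

text \<open>Only the signs of \<open>f\<close> and \<open>g\<close> at the points of \<open>Z\<close> and at infinity matter, because
  both are monotone in the same direction in between; so moving each zero of \<open>f\<close> to the zero of
  \<open>g\<close> in the same gap of \<open>Z\<close> makes the signs agree everywhere.\<close>

lemma sign_match:
  fixes f g :: "real \<Rightarrow> real"
  assumes Z: "finite Z"
    and mono: "\<And>a b. a < b \<Longrightarrow> {a<..<b} \<inter> Z = {} \<Longrightarrow>
      (\<exists>s\<in>{1,-1}. strict_mono_on {a..b} (\<lambda>t. s * f t) \<and> strict_mono_on {a..b} (\<lambda>t. s * g t))"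
    and ivt_f: "\<And>a b. a < b \<Longrightarrow> f a * f b < 0 \<Longrightarrow> \<exists>c. a < c \<and> c < b \<and> f c = 0"
    and ivt_g: "\<And>a b. a < b \<Longrightarrow> g a * g b < 0 \<Longrightarrow> \<exists>c. a < c \<and> c < b \<and> g c = 0"
    and agree: "\<And>z. z \<in> Z \<Longrightarrow> sgn (f z) = sgn (g z)"
    and top: "\<And>t. t \<ge> M \<Longrightarrow> sgn (f t) = s\<^sub>1" "\<And>t. t \<ge> M \<Longrightarrow> sgn (g t) = s\<^sub>1"
    and bot: "\<And>t. t \<le> - M \<Longrightarrow> sgn (f t) = s\<^sub>0" "\<And>t. t \<le> - M \<Longrightarrow> sgn (g t) = s\<^sub>0"
    and s: "s\<^sub>0 \<noteq> 0" "s\<^sub>1 \<noteq> 0"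
    and M: "M > 0"
  shows "\<exists>\<eta>. strict_mono \<eta> \<and> surj \<eta> \<and> (\<forall>z\<in>Z. \<eta> z = z) \<and> (\<forall>t. sgn (f t) = sgn (g (\<eta> t)))"
proof -
  \<comment> \<open>Beyond \<open>M\<close> and below \<open>- M\<close> both signs are constant and
    nonzero, so adding these two points to \<open>Z\<close> confines every zero outside
    \<open>W\<close> to a bounded gap between neighbouring points of \<open>W\<close>.\<close>
  define W where "W = insert M (insert (- M) Z)"
  have W: "finite W" "M \<in> W" "- M \<in> W" using Z by (auto simp: W_def)
  have Wagree: "sgn (f z) = sgn (g z)" if "z \<in> W" for z
    using that agree top bot by (auto simp: W_def)
  have gap: "\<exists>a b. a \<in> W \<and> b \<in> W \<and> a < t \<and> t < b \<and> {a<..<b} \<inter> W = {}"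
    if t: "t \<notin> W" "- M < t" "t < M" for t
  proof -
    let ?a = "Max {z\<in>W. z < t}" and ?b = "Min {z\<in>W. t < z}"
    have fa: "finite {z\<in>W. z < t}" "{z\<in>W. z < t} \<noteq> {}"
      and fb: "finite {z\<in>W. t < z}" "{z\<in>W. t < z} \<noteq> {}"
      using W t by auto
    have a: "?a \<in> W" "?a < t" using Max_in[OF fa] by auto
    have b: "?b \<in> W" "t < ?b" using Min_in[OF fb] by auto
    have "z \<notin> W" if "z \<in> {?a<..<?b}" for z
    proof
      assume z: "z \<in> W"
      consider "z < t" | "z = t" | "z > t" by linarith
      then show False
      proof cases
        case 1
        then have "z \<le> ?a" using fa z by auto
        with that show False by auto
      next
        case 2 with z t show False by auto
      next
        case 3
        then have "?b \<le> z" using fb z by auto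
        with that show False by auto
      qed
    qed
    with a b show ?thesis by blast
  qed
  have mono_gap: "\<exists>s\<in>{1,-1}. strict_mono_on {a..b} (\<lambda>t. s * f t) \<and> strict_mono_on {a..b} (\<lambda>t. s * g t)"
    if "a < b" "{a<..<b} \<inter> W = {}" for a b
    by (rule mono) (use that in \<open>auto simp: W_def\<close>)
  define A where "A = {t. t \<notin> W \<and> f t = 0}"
  have Arange: "- M < t \<and> t < M" if "t \<in> A" for t
    using that top(1)[of t] bot(1)[of t] s by (force simp: A_def)
  have uniq: "t = t'" if as: "t \<in> A" "t' \<in> A" "a < t" "t < b" "a < t'" "t' < b" "{a<..<b} \<inter> W = {}"
    for a b t t'
  proof -
    have "a < b" using that by linarith
    then obtain s where "s \<in> {1,-1}" "strict_mono_on {a..b} (\<lambda>t. s * f t)"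
      using mono_gap[OF \<open>a < b\<close> as(7)] by blast
    moreover have "s * f t = s * f t'" using as by (simp add: A_def)
    ultimately show ?thesis
      using as strict_mono_on_eqD[of "{a..b}" "\<lambda>t. s * f t" t' t] by fastforce
  qed
  \<comment> \<open>In its gap \<open>f\<close> is strictly monotone and vanishes at
    \<open>t\<close>, so it has opposite nonzero signs at the two ends; \<open>g\<close> has the
    same signs there and hence a zero in the same gap.\<close>
  have partner: "\<exists>c. g c = 0 \<and> (\<forall>z\<in>W. (z < t \<longleftrightarrow> z < c) \<and> (t < z \<longleftrightarrow> c < z))" if t: "t \<in> A" for t
  proof -
    obtain a b where ab: "a \<in> W" "b \<in> W" "a < t" "t < b" "{a<..<b} \<inter> W = {}"
      using gap[of t] Arange[OF t] t by (auto simp: A_def)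
    then have "a < b" by linarith
    then obtain s where s: "s \<in> {1,-1}" "strict_mono_on {a..b} (\<lambda>t. s * f t)"
      using mono_gap[OF \<open>a < b\<close> ab(5)] by blast
    have "s * f a < s * f t" "s * f t < s * f b"
      using s ab by (auto simp: strict_mono_on_def)
    then have "s * f a < 0" "0 < s * f b" using t by (auto simp: A_def)
    then have "f a * f b < 0" using s by (auto simp: mult_less_0_iff)
    then have "sgn (f a * f b) = -1" by simp
    then have "sgn (g a * g b) = -1" using Wagree ab by (simp add: sgn_mult)
    then have "g a * g b < 0" by (simp only: sgn_1_neg)
    then obtain c where c: "a < c" "c < b" "g c = 0" using ivt_g[OF \<open>a < b\<close>] by blast
    have "(z < t \<longleftrightarrow> z < c) \<and> (t < z \<longleftrightarrow> c < z)" if "z \<in> W" for z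
    proof -
      have "\<not> (a < z \<and> z < b)" using that ab(5) by auto
      then show ?thesis using c ab by auto
    qed
    with c show ?thesis by blast
  qed
  then obtain p where p: "\<And>t. t \<in> A \<Longrightarrow> g (p t) = 0"
    "\<And>t z. t \<in> A \<Longrightarrow> z \<in> W \<Longrightarrow> z < t \<longleftrightarrow> z < p t" "\<And>t z. t \<in> A \<Longrightarrow> z \<in> W \<Longrightarrow> t < z \<longleftrightarrow> p t < z"
    by metis
  have AW: "A \<inter> W = {}" by (auto simp: A_def)
  have sep: "\<exists>z\<in>W. t < z \<and> z < t'" if as: "t \<in> A" "t' \<in> A" "t < t'" for t t'
  proof -
    obtain a b where ab: "a \<in> W" "b \<in> W" "a < t" "t < b" "{a<..<b} \<inter> W = {}"
      using gap[of t] Arange[OF as(1)] as(1) by (auto simp: A_def)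
    have "\<not> t' < b" using uniq[OF as(1,2) ab(3,4) _ _ ab(5)] ab as by fastforce
    moreover have "t' \<noteq> b" using ab as AW by auto
    ultimately show ?thesis using ab by (intro bexI[of _ b]) auto
  qed
  \<comment> \<open>Distinct points of \<open>A\<close> are separated by a point of
    \<open>W\<close>, so counting the points of \<open>W\<close> below them is injective, with
    values at most \<open>card W\<close>.\<close>
  have finA: "finite A"
  proof -
    obtain z where z: "\<And>t t'. t \<in> A \<Longrightarrow> t' \<in> A \<Longrightarrow> t < t' \<Longrightarrow> z t t' \<in> W \<and> t < z t t' \<and> z t t' < t'"
      using sep by metis
    define n where "n t = card {w\<in>W. w < t}" for t
    have "n t < n t'" if as: "t \<in> A" "t' \<in> A" "t < t'" for t t'
      unfolding n_def
    proof (rule psubset_card_mono)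
      obtain w where "w \<in> W" "t < w" "w < t'" using z[OF as] by blast
      then have "w \<in> {w \<in> W. w < t'} - {w \<in> W. w < t}" by simp
      moreover have "{w \<in> W. w < t} \<subseteq> {w \<in> W. w < t'}" using as by auto
      ultimately show "{w \<in> W. w < t} \<subset> {w \<in> W. w < t'}" by blast
    qed (use W in auto)
    then have "inj_on n A" by (metis inj_onI linorder_neqE_linordered_idom order_less_irrefl)
    moreover have "n ` A \<subseteq> {..card W}" using W by (auto simp: n_def intro: card_mono)
    ultimately show ?thesis by (meson finite_atMost inj_on_finite)
  qed
  define h where "h t = (if t \<in> W then t else p t)" for t
  have "strict_mono_on (W \<union> A) h"
  proof (rule strict_mono_onI)
    fix x y assume xy: "x \<in> W \<union> A" "y \<in> W \<union> A" "x < y"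
    consider "x \<in> W" "y \<in> W" | "x \<in> W" "y \<in> A" "y \<notin> W" | "x \<in> A" "x \<notin> W" "y \<in> W"
      | "x \<in> A" "y \<in> A" "x \<notin> W" "y \<notin> W"
      using xy by blast
    then show "h x < h y"
    proof cases
      case 4
      then obtain z where "z \<in> W" "x < z" "z < y" using sep xy by blast
      then have "p x < z" "z < p y" using p 4 by blast+
      then show ?thesis using 4 by (simp add: h_def)
    qed (use xy p in \<open>auto simp: h_def\<close>)
  qed
  then obtain \<eta> where \<eta>: "strict_mono \<eta>" "surj \<eta>" "\<And>a. a \<in> W \<union> A \<Longrightarrow> \<eta> a = h a"
    using strict_mono_on_extend[of "W \<union> A" h] finA W by blast
  have less: "\<eta> x < \<eta> y \<longleftrightarrow> x < y" for x y
    using \<eta>(1) by (simp add: strict_mono_less)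
  have fixW: "\<eta> z = z" if "z \<in> W" for z
    using that \<eta>(3) by (simp add: h_def)
  have zeroA: "g (\<eta> t) = 0" if "t \<in> A" for t
    using that \<eta>(3)[of t] AW p(1) by (auto simp: h_def)
  \<comment> \<open>Multiplied by \<open>s\<close>, both functions increase on the gap. A positive
    value at \<open>t\<close> either follows a nonnegative value at \<open>a\<close>, where
    \<open>g\<close> has the same sign, or follows a zero of \<open>f\<close>, which
    \<open>\<eta>\<close> carries to a zero of \<open>g\<close>. Negative values are compared with
    \<open>b\<close> in the same way.\<close>
  have inside: "sgn (f t) = sgn (g (\<eta> t))" if t: "t \<notin> W" "- M < t" "t < M" for t
  proof (cases "f t = 0")
    case True
    then show ?thesis using zeroA[of t] t by (simp add: A_def)
  next
    case False
    obtain a b where ab: "a \<in> W" "b \<in> W" "a < t" "t < b" "{a<..<b} \<inter> W = {}"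
      using gap[OF t] by blast
    then have "a < b" by linarith
    then obtain s where s: "s \<in> {1,-1}" "strict_mono_on {a..b} (\<lambda>t. s * f t)"
        "strict_mono_on {a..b} (\<lambda>t. s * g t)"
      using mono_gap[OF \<open>a < b\<close> ab(5)] by blast
    have im: "a < \<eta> x \<and> \<eta> x < b" if "a < x" "x < b" for x
      using that less[of a x] less[of x b] fixW ab by simp
    have g_less: "s * g x < s * g y" if "a \<le> x" "x < y" "y \<le> b" for x y
      using s that by (auto simp: strict_mono_on_def)
    have f_less: "s * f x < s * f y" if "a \<le> x" "x < y" "y \<le> b" for x y
      using s that by (auto simp: strict_mono_on_def)
    have notW: "c \<notin> W" if "a < c" "c < b" for c
      using ab(5) that by (auto simp: disjoint_iff)
    have sW: "sgn (s * f z) = sgn (s * g z)" if "z \<in> W" for z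
      using Wagree[OF that] by (simp add: sgn_mult)
    have prod: "f x * f y < 0" if "s * f x < 0" "0 < s * f y" for x y
      using that s by (auto simp: mult_less_0_iff)
    have "sgn (s * f t) = sgn (s * g (\<eta> t))"
    proof (cases "s * f t > 0")
      case True
      have "s * g (\<eta> t) > 0"
      proof (cases "s * f a < 0")
        case False
        then have "s * g a \<ge> 0" using sW[OF ab(1)] by (auto simp: sgn_if split: if_splits)
        then show ?thesis using g_less[of a "\<eta> t"] im[of t] ab by auto
      next
        case neg: True
        obtain c where c: "a < c" "c < t" "f c = 0"
          using ivt_f[OF ab(3) prod[OF neg True]] by blast
        then have "c \<in> A" using ab notW[of c] by (auto simp: A_def)
        then have "g (\<eta> c) = 0" by (rule zeroA)
        moreover have "s * g (\<eta> c) < s * g (\<eta> t)"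
          using g_less[of "\<eta> c" "\<eta> t"] im[of t] im[of c] c less ab by auto
        ultimately show ?thesis by simp
      qed
      with True show ?thesis by simp
    next
      case neg: False
      then have neg: "s * f t < 0" using False s by auto
      have "s * g (\<eta> t) < 0"
      proof (cases "s * f b > 0")
        case False
        then have "s * g b \<le> 0" using sW[OF ab(2)] by (auto simp: sgn_if split: if_splits)
        then show ?thesis using g_less[of "\<eta> t" b] im[of t] ab by auto
      next
        case True
        obtain c where c: "t < c" "c < b" "f c = 0"
          using ivt_f[OF ab(4) prod[OF neg True]] by blast
        then have "c \<in> A" using ab notW[of c] by (auto simp: A_def)
        then have "g (\<eta> c) = 0" by (rule zeroA)
        moreover have "s * g (\<eta> t) < s * g (\<eta> c)"
          using g_less[of "\<eta> t" "\<eta> c"] im[of t] im[of c] c less ab by auto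
        ultimately show ?thesis by simp
      qed
      with neg show ?thesis by simp
    qed
    then show ?thesis using s by (auto simp: sgn_mult)
  qed
  have "sgn (f t) = sgn (g (\<eta> t))" for t
  proof -
    consider "t \<in> W" | "t \<notin> W" "- M < t" "t < M" | "t \<ge> M" | "t \<le> - M" by linarith
    then show ?thesis
    proof cases
      case 1 then show ?thesis using fixW Wagree by simp
    next
      case 2 then show ?thesis by (rule inside)
    next
      case 3
      then have "\<eta> t \<ge> M" using less[of t M] fixW[of M] W by simp
      then show ?thesis using top 3 by simp
    next
      case 4
      then have "\<eta> t \<le> - M" using less[of "- M" t] fixW[of "- M"] W by simp
      then show ?thesis using bot 4 by simp
    qed
  qed
  moreover have "\<eta> z = z" if "z \<in> Z" for z using fixW[of z] that by (simp add: W_def)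
  ultimately show ?thesis using \<eta>(1,2) by blast
qed

lemma poly_eventually_sgn_top:
  fixes p :: "real poly"
  shows "\<exists>M. \<forall>t\<ge>M. sgn (poly p t) = sgn (lead_coeff p)"
proof -
  have pos: "\<exists>M. \<forall>t\<ge>M. poly r t > 0" if "lead_coeff r > 0" for r :: "real poly"
    using poly_pinfty_gt_lc[OF that] that by (meson less_le_trans)
  consider "lead_coeff p > 0" | "lead_coeff p < 0" | "p = 0"
    by (metis leading_coeff_0_iff linorder_neqE_linordered_idom)
  then show ?thesis
  proof cases
    case 1
    then obtain M where "\<forall>t\<ge>M. poly p t > 0" using pos by blast
    with 1 show ?thesis by (intro exI[of _ M]) auto
  next
    case 2
    then obtain M where "\<forall>t\<ge>M. poly (- p) t > 0" using pos[of "- p"] by auto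
    with 2 show ?thesis by (intro exI[of _ M]) auto
  qed auto
qed

lemma poly_eventually_sgn_bot:
  fixes p :: "real poly"
  shows "\<exists>M. \<forall>t\<le>M. sgn (poly p t) = sgn (lead_coeff p) * (-1) ^ degree p"
proof -
  define r where "r = pcompose p [:0, -1:]"
  have d: "degree r = degree p" by (simp add: r_def degree_pcompose)
  have l: "lead_coeff r = lead_coeff p * (-1) ^ degree p"
    unfolding r_def by (subst lead_coeff_comp) auto
  obtain M where M: "\<And>t. t \<ge> M \<Longrightarrow> sgn (poly r t) = sgn (lead_coeff r)"
    using poly_eventually_sgn_top[of r] by blast
  have "sgn (poly p t) = sgn (lead_coeff p) * (-1) ^ degree p" if "t \<le> - M" for t
    using M[of "- t"] that l by (simp add: r_def poly_pcompose sgn_mult)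
  then show ?thesis by blast
qed

lemma poly_strict_mono_gap:
  fixes p :: "real poly"
  assumes s: "s \<in> {1, -1}" and sg: "\<And>t. a < t \<Longrightarrow> t < b \<Longrightarrow> sgn (poly (pderiv p) t) = s"
  shows "strict_mono_on {a..b} (\<lambda>t. s * poly p t)"
proof (rule strict_mono_onI)
  fix x y assume xy: "x \<in> {a..b}" "y \<in> {a..b}" "x < y"
  show "s * poly p x < s * poly p y"
  proof (rule DERIV_pos_imp_increasing_open[OF xy(3)])
    fix t assume t: "x < t" "t < y"
    have "((\<lambda>t. s * poly p t) has_real_derivative s * poly (pderiv p) t) (at t)"
      by (intro derivative_eq_intros poly_DERIV) auto
    moreover have "s * poly (pderiv p) t > 0"
      using sg[of t] t xy s by (auto simp: sgn_if split: if_splits)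
    ultimately show "\<exists>z. ((\<lambda>t. s * poly p t) has_real_derivative z) (at t) \<and> z > 0" by blast
  qed (intro continuous_intros)
qed

lemma poly_same_sign:
  fixes p :: "real poly"
  assumes "a \<le> b" "\<And>t. a \<le> t \<Longrightarrow> t \<le> b \<Longrightarrow> poly p t \<noteq> 0"
  shows "sgn (poly p a) = sgn (poly p b)"
proof (rule ccontr)
  assume ne: "sgn (poly p a) \<noteq> sgn (poly p b)"
  then have "a < b" using assms(1) by (cases "a = b") auto
  have "poly p a * poly p b < 0"
    using ne assms(2)[of a] assms(2)[of b] assms(1) by (auto simp: sgn_if mult_less_0_iff split: if_splits)
  then consider "poly p a < 0" "0 < poly p b" | "0 < poly p a" "poly p b < 0"
    by (auto simp: mult_less_0_iff)
  then show False
    using poly_IVT_pos[OF \<open>a < b\<close>, of p] poly_IVT_neg[OF \<open>a < b\<close>, of p] assms(2)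
    by cases (metis less_imp_le)+
qed

text \<open>The Cohen--Hoermander step: a polynomial of maximal degree can be added to a family whose
  signs are already matched, provided the family contains its derivative and the signs at the roots
  of the family agree (they do once the remainders belong to the family).\<close>

lemma sign_match_poly:
  fixes p q :: "real poly" and P Q :: "'i \<Rightarrow> real poly"
  assumes \<theta>: "strict_mono \<theta>" "surj \<theta>"
    and I: "finite I" "\<And>i t. i \<in> I \<Longrightarrow> sgn (poly (P i) t) = sgn (poly (Q i) (\<theta> t))"
    and j: "j \<in> I" "P j = pderiv p" "Q j = pderiv q"
    and deg: "degree p > 0" "degree p = degree q" "sgn (lead_coeff p) = sgn (lead_coeff q)"
    and roots: "\<And>i \<xi>. i \<in> I \<Longrightarrow> P i \<noteq> 0 \<Longrightarrow> poly (P i) \<xi> = 0 \<Longrightarrow> sgn (poly p \<xi>) = sgn (poly q (\<theta> \<xi>))"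
  shows "\<exists>\<theta>'. strict_mono \<theta>' \<and> surj \<theta>' \<and> (\<forall>i\<in>I. \<forall>t. sgn (poly (P i) t) = sgn (poly (Q i) (\<theta>' t))) \<and>
    (\<forall>t. sgn (poly p t) = sgn (poly q (\<theta>' t)))"
proof -
  \<comment> \<open>Members that vanish identically are left out, since every point is a root of
    them; their sign is zero everywhere.\<close>
  define Z where "Z = (\<Union>i\<in>{i\<in>I. P i \<noteq> 0}. {t. poly (P i) t = 0})"
  have Z: "finite Z" using I(1) by (auto simp: Z_def poly_roots_finite)
  have less: "\<theta> x < \<theta> y \<longleftrightarrow> x < y" for x y using \<theta>(1) by (simp add: strict_mono_less)
  have le: "\<theta> x \<le> \<theta> y \<longleftrightarrow> x \<le> y" for x y using \<theta>(1) by (simp add: strict_mono_less_eq)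
  obtain M1 where M1: "\<And>t. t \<ge> M1 \<Longrightarrow> sgn (poly p t) = sgn (lead_coeff p)"
    using poly_eventually_sgn_top by blast
  obtain M2 where M2: "\<And>t. t \<ge> M2 \<Longrightarrow> sgn (poly q t) = sgn (lead_coeff q)"
    using poly_eventually_sgn_top by blast
  obtain M3 where M3: "\<And>t. t \<le> M3 \<Longrightarrow> sgn (poly p t) = sgn (lead_coeff p) * (-1) ^ degree p"
    using poly_eventually_sgn_bot by blast
  obtain M4 where M4: "\<And>t. t \<le> M4 \<Longrightarrow> sgn (poly q t) = sgn (lead_coeff q) * (-1) ^ degree q"
    using poly_eventually_sgn_bot by blast
  obtain m2 m4 where m: "\<theta> m2 = M2" "\<theta> m4 = M4" using \<theta>(2) by (metis surjD)
  define M where "M = Max {1, M1, m2, - M3, - m4}"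
  have M: "M > 0" "M \<ge> M1" "M \<ge> m2" "- M \<le> M3" "- M \<le> m4" by (auto simp: M_def max_def)
  have pd: "pderiv p \<noteq> 0" using deg(1) by (simp add: pderiv_eq_0_iff)
  have zd: "poly (pderiv p) t \<noteq> 0" if "t \<notin> Z" for t
    using that j pd by (auto simp: Z_def)
  \<comment> \<open>Composing \<open>q\<close> with \<open>\<theta>\<close> puts both functions on
    the same line: between points of \<open>Z\<close>, \<open>pderiv p\<close> at \<open>t\<close>
    and \<open>pderiv q\<close> at \<open>\<theta> t\<close> have the same constant sign.\<close>
  have "\<exists>\<eta>. strict_mono \<eta> \<and> surj \<eta> \<and> (\<forall>z\<in>Z. \<eta> z = z) \<and>
      (\<forall>t. sgn (poly p t) = sgn ((\<lambda>t. poly q (\<theta> t)) (\<eta> t)))"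
  proof (rule sign_match[where M = M and s\<^sub>1 = "sgn (lead_coeff p)"
        and s\<^sub>0 = "sgn (lead_coeff p) * (-1) ^ degree p"])
    fix a b :: real assume ab: "a < b" "{a<..<b} \<inter> Z = {}"
    define s where "s = sgn (poly (pderiv p) ((a + b) / 2))"
    have nz: "poly (pderiv p) t \<noteq> 0" if "a < t" "t < b" for t
      using that ab by (intro zd) auto
    have s: "s \<in> {1, -1}" using nz[of "(a + b) / 2"] ab by (auto simp: s_def sgn_if)
    have sp: "sgn (poly (pderiv p) t) = s" if "a < t" "t < b" for t
    proof (cases "t \<le> (a + b) / 2")
      case True
      then show ?thesis unfolding s_def using that ab
        by (intro poly_same_sign nz) auto
    next
      case False
      then show ?thesis unfolding s_def using that ab
        by (intro poly_same_sign[symmetric] nz) auto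
    qed
    have "sgn (poly (pderiv q) t) = s" if "\<theta> a < t" "t < \<theta> b" for t
    proof -
      obtain u where "t = \<theta> u" using \<theta>(2) by (metis surjD)
      then show ?thesis using that less sp[of u] I(2)[OF j(1), of u] j by simp
    qed
    then have "strict_mono_on {\<theta> a..\<theta> b} (\<lambda>t. s * poly q t)"
      by (rule poly_strict_mono_gap[OF s])
    then have "strict_mono_on {a..b} (\<lambda>t. s * poly q (\<theta> t))"
      by (auto simp: strict_mono_on_def less le)
    moreover have "strict_mono_on {a..b} (\<lambda>t. s * poly p t)"
      by (rule poly_strict_mono_gap[OF s sp])
    ultimately show "\<exists>s\<in>{1, - 1}. strict_mono_on {a..b} (\<lambda>t. s * poly p t) \<and>
        strict_mono_on {a..b} (\<lambda>t. s * poly q (\<theta> t))"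
      using s by blast
  next
    fix a b :: real assume "a < b" "poly p a * poly p b < 0"
    then show "\<exists>c>a. c < b \<and> poly p c = 0"
      using poly_IVT[of a b p] by blast
  next
    fix a b :: real assume "a < b" "poly q (\<theta> a) * poly q (\<theta> b) < 0"
    then obtain c where c: "\<theta> a < c" "c < \<theta> b" "poly q c = 0"
      using poly_IVT[of "\<theta> a" "\<theta> b" q] less by blast
    obtain u where "c = \<theta> u" using \<theta>(2) by (metis surjD)
    then show "\<exists>c>a. c < b \<and> poly q (\<theta> c) = 0" using c less by auto
  next
    fix z assume "z \<in> Z" then show "sgn (poly p z) = sgn (poly q (\<theta> z))"
      using roots by (auto simp: Z_def)
  next
    fix t assume t: "M \<le> t"
    show "sgn (poly p t) = sgn (lead_coeff p)" using M1 M t by auto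
    have "\<theta> m2 \<le> \<theta> t" using le M t by auto
    then show "sgn (poly q (\<theta> t)) = sgn (lead_coeff p)" using M2 m deg by simp
  next
    fix t assume t: "t \<le> - M"
    show "sgn (poly p t) = sgn (lead_coeff p) * (- 1) ^ degree p" using M3 M t by auto
    have "\<theta> t \<le> \<theta> m4" using le M t by auto
    then show "sgn (poly q (\<theta> t)) = sgn (lead_coeff p) * (- 1) ^ degree p" using M4 m deg by simp
  next
    have "p \<noteq> 0" using deg(1) by auto
    then have "sgn (lead_coeff p) \<noteq> 0" by (simp add: sgn_zero_iff)
    then show "sgn (lead_coeff p) * (- 1) ^ degree p \<noteq> 0" "sgn (lead_coeff p) \<noteq> 0"
      by simp_all
  qed (use Z M in auto)
  then obtain \<eta> where \<eta>: "strict_mono \<eta>" "surj \<eta>" "\<And>z. z \<in> Z \<Longrightarrow> \<eta> z = z"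
      "\<And>t. sgn (poly p t) = sgn (poly q (\<theta> (\<eta> t)))" by auto
  \<comment> \<open>Since \<open>\<eta>\<close> fixes the points of \<open>Z\<close>, it moves no
    point across a root of a nonzero \<open>P i\<close>; the signs already matched survive the
    passage from \<open>\<theta>\<close> to \<open>\<theta> \<circ> \<eta>\<close>.\<close>
  have fam: "sgn (poly (P i) t) = sgn (poly (P i) (\<eta> t))" if i: "i \<in> I" for i t
  proof (cases "P i = 0 \<or> t \<in> Z")
    case True then show ?thesis using \<eta>(3) by auto
  next
    case False
    have nz: "poly (P i) u \<noteq> 0" if u: "min t (\<eta> t) \<le> u" "u \<le> max t (\<eta> t)" for u
    proof
      assume "poly (P i) u = 0"
      then have uZ: "u \<in> Z" using i False by (auto simp: Z_def)
      then have *: "\<eta> u = u" by (rule \<eta>(3))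
      have "t \<noteq> u" using uZ False by auto
      then consider "t < u" | "u < t" by linarith
      then show False
      proof cases
        case 1
        then have "\<eta> t < u" using \<eta>(1) * by (metis strict_mono_less)
        with 1 u show False by auto
      next
        case 2
        then have "u < \<eta> t" using \<eta>(1) * by (metis strict_mono_less)
        with 2 u show False by auto
      qed
    qed
    show ?thesis
    proof (cases "t \<le> \<eta> t")
      case True then show ?thesis by (intro poly_same_sign nz) auto
    next
      case False then show ?thesis by (intro poly_same_sign[symmetric] nz) auto
    qed
  qed
  show ?thesis
  proof (intro exI conjI ballI allI)
    show "strict_mono (\<theta> \<circ> \<eta>)" using \<theta> \<eta> by (auto simp: strict_mono_def)
    show "surj (\<theta> \<circ> \<eta>)" using \<eta>(2) \<theta>(2) by (rule comp_surj)
    show "sgn (poly (P i) t) = sgn (poly (Q i) ((\<theta> \<circ> \<eta>) t))" if "i \<in> I" for i t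
      using fam[OF that, of t] I(2)[OF that, of "\<eta> t"] by simp
    show "sgn (poly p t) = sgn (poly q ((\<theta> \<circ> \<eta>) t))" for t
      using \<eta>(4)[of t] by simp
  qed
qed

section \<open>Elimination of one variable from polynomial families\<close>

definition sign_equiv :: "('a \<Rightarrow> real poly) set \<Rightarrow> 'a \<Rightarrow> 'a \<Rightarrow> bool" where
  "sign_equiv F x y \<longleftrightarrow> (\<exists>\<theta>. strict_mono \<theta> \<and> surj \<theta> \<and>
     (\<forall>q\<in>F. \<forall>t. sgn (poly (q x) t) = sgn (poly (q y) (\<theta> t))))"

text \<open>The domain \<open>D\<close> is arbitrary and cells are compared only inside it. Case
  distinctions can thus shrink \<open>D\<close>, while the cells found for the pieces are recombined
  into semialgebraic ones.\<close>

definition tame :: "(nat \<Rightarrow> real) set \<Rightarrow> ((nat \<Rightarrow> real) \<Rightarrow> real poly) set \<Rightarrow> bool" where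
  "tame D F \<longleftrightarrow> (\<exists>\<C>. finite \<C> \<and> \<C> \<subseteq> semialgebraic \<and> D \<subseteq> \<Union>\<C> \<and>
     (\<forall>C\<in>\<C>. \<forall>x\<in>C \<inter> D. \<forall>y\<in>C \<inter> D. sign_equiv F x y))"

lemma tame_mono:
  assumes "tame D G"
    and "\<And>x y. x \<in> D \<Longrightarrow> y \<in> D \<Longrightarrow> sign_equiv G x y \<Longrightarrow> sign_equiv F x y"
  shows "tame D F"
proof -
  obtain \<C> where C: "finite \<C>" "\<C> \<subseteq> semialgebraic" "D \<subseteq> \<Union>\<C>"
    "\<And>C x y. C \<in> \<C> \<Longrightarrow> x \<in> C \<inter> D \<Longrightarrow> y \<in> C \<inter> D \<Longrightarrow> sign_equiv G x y"
    using assms(1) unfolding tame_def by auto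
  then show ?thesis
    using assms(2) unfolding tame_def by (intro exI[of _ \<C>]) auto
qed

lemma tame_split:
  assumes S: "S \<in> semialgebraic" and "tame (D \<inter> S) F" "tame (D - S) F"
  shows "tame D F"
proof -
  obtain \<A> where \<A>: "finite \<A>" "\<A> \<subseteq> semialgebraic" "D \<inter> S \<subseteq> \<Union>\<A>"
    "\<And>C x y. C \<in> \<A> \<Longrightarrow> x \<in> C \<inter> (D \<inter> S) \<Longrightarrow> y \<in> C \<inter> (D \<inter> S) \<Longrightarrow> sign_equiv F x y"
    using assms(2) unfolding tame_def by auto
  obtain \<B> where \<B>: "finite \<B>" "\<B> \<subseteq> semialgebraic" "D - S \<subseteq> \<Union>\<B>"
    "\<And>C x y. C \<in> \<B> \<Longrightarrow> x \<in> C \<inter> (D - S) \<Longrightarrow> y \<in> C \<inter> (D - S) \<Longrightarrow> sign_equiv F x y"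
    using assms(3) unfolding tame_def by auto
  let ?C = "(\<lambda>C. C \<inter> S) ` \<A> \<union> (\<lambda>C. C \<inter> - S) ` \<B>"
  have "finite ?C" using \<A> \<B> by simp
  moreover have "?C \<subseteq> semialgebraic"
    using \<A>(2) \<B>(2) S by (auto intro!: semialgebraic_inter semialgebraic.compl)
  moreover have "D \<subseteq> \<Union>?C" using \<A>(3) \<B>(3) by auto
  moreover have "sign_equiv F x y" if "C \<in> ?C" "x \<in> C \<inter> D" "y \<in> C \<inter> D" for C x y
    using that \<A>(4)[of _ x y] \<B>(4)[of _ x y] by auto
  ultimately show ?thesis unfolding tame_def by (intro exI[of _ ?C] conjI ballI)
qed

lemma tame_split_finite:
  assumes "finite \<S>" "\<S> \<subseteq> semialgebraic" "\<And>S. S \<in> \<S> \<Longrightarrow> tame (D \<inter> S) F" "tame (D - \<Union>\<S>) F"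
  shows "tame D F"
  using assms
proof (induction \<S> arbitrary: D rule: finite_induct)
  case (insert S \<S>)
  have sub: "tame (E \<inter> D) F" if D: "tame D F" for D E :: "(nat \<Rightarrow> real) set"
  proof -
    obtain \<C> where C: "finite \<C>" "\<C> \<subseteq> semialgebraic" "D \<subseteq> \<Union>\<C>"
      "\<And>C x y. C \<in> \<C> \<Longrightarrow> x \<in> C \<inter> D \<Longrightarrow> y \<in> C \<inter> D \<Longrightarrow> sign_equiv F x y"
      using D unfolding tame_def by auto
    then show ?thesis unfolding tame_def by (intro exI[of _ \<C>]) auto
  qed
  show ?case
  proof (rule tame_split)
    show "tame (D - S) F"
    proof (rule insert.IH)
      show "tame ((D - S) \<inter> T) F" if "T \<in> \<S>" for T
        using sub[OF insert.prems(2)[of T], of "- S"] that by (simp add: Int_ac Diff_eq)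
      show "tame (D - S - \<Union>\<S>) F" using insert.prems(3) by (simp add: Diff_eq Int_ac)
    qed (use insert.prems in auto)
  qed (use insert.prems in auto)
qed simp

text \<open>Used where the formal leading coefficient vanishes: there the cut polynomial is the
  polynomial itself, now with a smaller formal degree.\<close>

lemma param_poly_cut:
  assumes "param_poly (Suc d) q"
  shows "param_poly d (\<lambda>x. q x - monom (coeff (q x) (Suc d)) (Suc d))"
proof -
  have "degree (q x - monom (coeff (q x) (Suc d)) (Suc d)) \<le> d" for x
  proof (rule degree_le, intro allI impI)
    fix i assume "d < i"
    then consider "i = Suc d" | "Suc d < i" by linarith
    then show "coeff (q x - monom (coeff (q x) (Suc d)) (Suc d)) i = 0"
    proof cases
      case 2
      then have "degree (q x) < i" using assms by (auto simp: param_poly_def intro: le_less_trans)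
      with 2 show ?thesis by (simp add: coeff_eq_0)
    qed simp
  qed
  moreover have "(\<lambda>x. coeff (q x - monom (coeff (q x) (Suc d)) (Suc d)) i) \<in> polyfun" for i
    using assms by (cases "i = Suc d") (auto simp: param_poly_def intro: polyfun_intros)
  ultimately show ?thesis by (simp add: param_poly_def)
qed

lemma param_poly_pderiv:
  assumes "param_poly (Suc d) q"
  shows "param_poly d (\<lambda>x. pderiv (q x))"
proof -
  have "degree (q x) \<le> Suc d" for x using assms by (simp add: param_poly_def)
  then have "degree (q x) - Suc 0 \<le> d" for x by (metis Suc_pred diff_le_mono diff_Suc_Suc diff_zero)
  then show ?thesis
    using assms by (auto simp: param_poly_def degree_pderiv coeff_pderiv intro!: polyfun_intros)
qed

text \<open>One step of pseudo-division of \<open>q\<close>, of formal degree \<open>n\<close>, by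
  \<open>p\<close>, of formal degree \<open>d\<close>. Multiplying \<open>q\<close> by a square
  keeps its sign at the roots of \<open>p\<close> and avoids dividing by a coefficient that depends
  on parameters. One step already lowers the formal degree, which is all that the induction asks
  for.\<close>

definition reduce_step :: "real poly \<Rightarrow> nat \<Rightarrow> real poly \<Rightarrow> nat \<Rightarrow> real poly" where
  "reduce_step q n p d = smult ((coeff p d)\<^sup>2) q - smult (coeff p d * coeff q n) (monom 1 (n - d) * p)"

lemma sgn_reduce_step:
  assumes "coeff p d \<noteq> 0" "poly p \<xi> = 0"
  shows "sgn (poly (reduce_step q n p d) \<xi>) = sgn (poly q \<xi>)"
proof -
  have "sgn ((coeff p d)\<^sup>2) = 1" using assms(1) by (simp only: sgn_1_pos zero_less_power2) simp
  then show ?thesis using assms(2) by (simp add: reduce_step_def sgn_mult)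
qed

lemma param_poly_reduce_step:
  assumes q: "param_poly (Suc n) q" and p: "param_poly d p" and d: "d \<le> Suc n"
  shows "param_poly n (\<lambda>x. reduce_step (q x) (Suc n) (p x) d)"
proof -
  have "degree (reduce_step (q x) (Suc n) (p x) d) \<le> n" for x
  proof (rule degree_le, intro allI impI)
    fix i assume "n < i"
    then consider "i = Suc n" | "Suc n < i" by linarith
    then show "coeff (reduce_step (q x) (Suc n) (p x) d) i = 0"
    proof cases
      case 1
      then show ?thesis using d
        by (simp add: reduce_step_def coeff_monom_mult power2_eq_square)
    next
      case 2
      have "degree (q x) \<le> Suc n" "degree (p x) \<le> d" using p q by (auto simp: param_poly_def)
      then have "degree (q x) < i" "degree (p x) < i - (Suc n - d)" using 2 d by auto
      then show ?thesis using 2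
        by (simp add: reduce_step_def coeff_monom_mult coeff_eq_0)
    qed
  qed
  moreover have "(\<lambda>x. coeff (reduce_step (q x) (Suc n) (p x) d) i) \<in> polyfun" for i
    using p q unfolding reduce_step_def coeff_diff coeff_smult coeff_monom_mult
    by (cases "Suc n - d \<le> i") (auto simp: param_poly_def intro!: polyfun_intros)
  ultimately show ?thesis by (simp add: param_poly_def)
qed

text \<open>The multiset of formal degrees decreases when one member is exchanged for any number of
  members of lower formal degree. Three exchanges occur: a member of formal degree 0 is removed and
  its sign is fixed by a split; a member is cut where its formal leading coefficient vanishes; where
  none vanishes, a member of maximal degree gives way to its derivative and its reductions.\<close>

lemma tame_family:
  fixes M :: "(((nat \<Rightarrow> real) \<Rightarrow> real poly) \<times> nat) multiset"
  assumes "\<forall>(q, d)\<in>set_mset M. param_poly d q"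
  shows "tame D (fst ` set_mset M)"
  using assms
proof (induction "image_mset snd M" arbitrary: M D rule: wf_induct_rule[OF wf_mult[OF wf_less_than]])
  case (1 M)
  have IH: "tame D (fst ` set_mset M')"
    if "(image_mset snd M', image_mset snd M) \<in> mult less_than"
       "\<forall>(q, d)\<in>set_mset M'. param_poly d q" for M' D
    using 1(1)[OF that] .
  show ?case
  proof (cases "M = {#}")
    case True
    have "sign_equiv {} x y" for x y :: "nat \<Rightarrow> real"
      unfolding sign_equiv_def by (rule exI[of _ id]) (auto simp: strict_mono_def)
    then show ?thesis
      using True unfolding tame_def by (auto intro!: exI[of _ "{UNIV}"] semialgebraic_UNIV)
  next
    case nonempty: False
    show ?thesis
    proof (cases "\<exists>q. (q, 0) \<in># M")
      case True
      then obtain q N where M: "M = add_mset (q, 0) N" by (meson multi_member_split)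
      have smaller: "(image_mset snd N, image_mset snd M) \<in> mult less_than"
        using one_step_implies_mult[of "{#0#}" "{#}" less_than "image_mset snd N"] M by simp
      have N: "tame D (fst ` set_mset N)" for D
        by (rule IH[OF smaller]) (use M 1(2) in auto)
      have q: "param_poly 0 q" using M 1(2) by auto
      then have qc: "q x = [:coeff (q x) 0:]" for x
        by (metis param_poly_def bot_nat_0.extremum_uniqueI degree_0_id)
      have pq: "poly (q x) t = coeff (q x) 0" for x t
        by (subst qc) simp
      have cp: "(\<lambda>x. coeff (q x) 0) \<in> polyfun" using q by (simp add: param_poly_def)
      have add: "tame E (fst ` set_mset M)" if E: "\<And>x y. x \<in> E \<Longrightarrow> y \<in> E \<Longrightarrow> sgn (coeff (q x) 0) = sgn (coeff (q y) 0)" for E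
      proof (rule tame_mono[OF N])
        fix x y assume "x \<in> E" "y \<in> E" "sign_equiv (fst ` set_mset N) x y"
        with E[of x y] show "sign_equiv (fst ` set_mset M) x y"
          unfolding sign_equiv_def M by (auto simp: pq)
      qed
      show ?thesis
      proof (rule tame_split[OF semialgebraic.pos[OF cp]])
        show "tame (D \<inter> {x. 0 < coeff (q x) 0}) (fst ` set_mset M)" by (rule add) auto
        show "tame (D - {x. 0 < coeff (q x) 0}) (fst ` set_mset M)"
          by (rule tame_split[OF semialgebraic_zero[OF cp]]; rule add) auto
      qed
    next
      case False
      define \<S> where "\<S> = (\<lambda>(q, d). {x. coeff (q x) d = 0}) ` set_mset M"
      have nz: "d > 0" if "(q, d) \<in># M" for q d
        using that False by (cases d) auto
      show ?thesis
      proof (rule tame_split_finite)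
        show "finite \<S>" by (simp add: \<S>_def)
        show "\<S> \<subseteq> semialgebraic"
          using 1(2) by (auto simp: \<S>_def param_poly_def intro!: semialgebraic_zero)
      next
        fix S assume "S \<in> \<S>"
        then obtain q d where qd: "(q, d) \<in># M" "S = {x. coeff (q x) d = 0}" by (auto simp: \<S>_def)
        then obtain e where e: "d = Suc e" using nz by (metis gr0_implies_Suc)
        obtain N where M: "M = add_mset (q, d) N" using qd by (meson multi_member_split)
        define q' where "q' = (\<lambda>x. q x - monom (coeff (q x) d) d)"
        have smaller: "(image_mset snd (add_mset (q', e) N), image_mset snd M) \<in> mult less_than"
          using one_step_implies_mult[of "{#d#}" "{#e#}" less_than "image_mset snd N"] M e by simp
        have "param_poly d q" using M 1(2) by auto
        then have "param_poly e q'" using param_poly_cut by (simp add: q'_def e)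
        then have "tame (D \<inter> S) (fst ` set_mset (add_mset (q', e) N))"
          by (intro IH[OF smaller]) (use M 1(2) in auto)
        then show "tame (D \<inter> S) (fst ` set_mset M)"
        proof (rule tame_mono)
          fix x y assume "x \<in> D \<inter> S" "y \<in> D \<inter> S"
          then have "q' x = q x" "q' y = q y" using qd by (auto simp: q'_def)
          moreover assume "sign_equiv (fst ` set_mset (add_mset (q', e) N)) x y"
          ultimately show "sign_equiv (fst ` set_mset M) x y"
            by (simp add: sign_equiv_def M)
        qed
      next
        define E where "E = D - \<Union>\<S>"
        have lc: "coeff (q x) d \<noteq> 0" if "(q, d) \<in># M" "x \<in> E" for q d x
          using that by (auto simp: E_def \<S>_def)
        define n where "n = Max (snd ` set_mset M)"
        have "n \<in> snd ` set_mset M" using nonempty by (auto simp: n_def)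
        then obtain q where qn: "(q, n) \<in># M" by auto
        have maxn: "d \<le> n" if "(p, d) \<in># M" for p d
          using that by (auto simp: n_def intro!: Max_ge image_eqI[where x = "(p, d)"])
        obtain m where m: "n = Suc m" using nz[OF qn] by (metis gr0_implies_Suc)
        obtain N where M: "M = add_mset (q, n) N" using qn by (meson multi_member_split)
        define q' where "q' = (\<lambda>x. pderiv (q x))"
        define N' where "N' = add_mset (q', m) N"
        \<comment> \<open>\<open>q\<close> is reduced by its derivative as well as by the other
          members, because its sign is needed at the roots of all of them. Every reduction gets
          formal degree \<open>m\<close>, one less than that of \<open>q\<close>.\<close>
        define R where "R = image_mset (\<lambda>(p, d). ((\<lambda>x. reduce_step (q x) n (p x) d), m)) N'"
        define K where "K = N + add_mset (q', m) R"
        have "image_mset snd K = image_mset snd N + (add_mset m (image_mset (\<lambda>_. m) N'))"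
          by (simp add: K_def R_def image_mset.compositionality o_def case_prod_unfold)
        moreover have "image_mset snd M = image_mset snd N + {#n#}" using M by simp
        moreover have "(image_mset snd N + (add_mset m (image_mset (\<lambda>_. m) N')), image_mset snd N + {#n#}) \<in> mult less_than"
          by (rule one_step_implies_mult) (auto simp: m)
        ultimately have smaller: "(image_mset snd K, image_mset snd M) \<in> mult less_than" by simp
        have pq: "param_poly n q" using M 1(2) by auto
        then have pq': "param_poly m q'" using param_poly_pderiv by (simp add: q'_def m)
        have pN': "param_poly d p \<and> d \<le> n" if "(p, d) \<in># N'" for p d
          using that pq' 1(2) maxn M m by (auto simp: N'_def)
        have "\<forall>(q, d)\<in>set_mset K. param_poly d q"
          using pN' pq' param_poly_reduce_step[of m q] pq
          by (auto simp: K_def R_def N'_def m)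
        then have K: "tame E (fst ` set_mset K)" for E by (rule IH[OF smaller])
        have degq: "degree (q x) = n" if "x \<in> E" for x
          using lc[OF qn that] pq by (metis le_antisym le_degree param_poly_def)
        \<comment> \<open>On \<open>E\<close> formal degrees are true degrees; the leading
          coefficient of \<open>q'\<close> is \<open>n\<close> times that of
          \<open>q\<close>.\<close>
        have lcN': "coeff (p x) d \<noteq> 0" if "(p, d) \<in># N'" "x \<in> E" for p d x
          using that lc[OF qn, of x] lc[of p d x] M m
          by (auto simp: N'_def q'_def coeff_pderiv)
        have same: "tame E' (fst ` set_mset M)"
          if E': "E' \<subseteq> E" "\<And>x y. x \<in> E' \<Longrightarrow> y \<in> E' \<Longrightarrow> sgn (coeff (q x) n) = sgn (coeff (q y) n)" for E'
        proof (rule tame_mono[OF K])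
          fix x y assume xy: "x \<in> E'" "y \<in> E'" "sign_equiv (fst ` set_mset K) x y"
          then obtain \<theta> where \<theta>: "strict_mono \<theta>" "surj \<theta>"
            "\<And>p t. p \<in> fst ` set_mset K \<Longrightarrow> sgn (poly (p x) t) = sgn (poly (p y) (\<theta> t))"
            unfolding sign_equiv_def by blast
          have dx: "degree (q x) = Suc m" and dy: "degree (q y) = Suc m"
            using degq[of x] degq[of y] xy(1,2) E'(1) m by auto
          have "\<exists>\<theta>'. strict_mono \<theta>' \<and> surj \<theta>' \<and>
            (\<forall>p\<in>fst ` set_mset N'. \<forall>t. sgn (poly (p x) t) = sgn (poly (p y) (\<theta>' t))) \<and>
            (\<forall>t. sgn (poly (q x) t) = sgn (poly (q y) (\<theta>' t)))"
          proof (rule sign_match_poly[OF \<theta>(1,2), where j = q' and P = "\<lambda>p. p x" and Q = "\<lambda>p. p y"])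
            show "sgn (poly (p x) t) = sgn (poly (p y) (\<theta> t))" if "p \<in> fst ` set_mset N'" for p t
              using that by (intro \<theta>(3)[of p t]) (auto simp: K_def N'_def)
            show "degree (q x) > 0" "degree (q x) = degree (q y)"
              "sgn (lead_coeff (q x)) = sgn (lead_coeff (q y))"
              by (simp_all add: dx dy m E'(2)[OF xy(1,2), unfolded m])
            \<comment> \<open>At a root of \<open>p\<close> the sign of \<open>q\<close> is that of
              its reduction by \<open>p\<close>, which belongs to \<open>K\<close>, and
              \<open>\<theta>\<close> carries roots of \<open>p x\<close> to roots of
              \<open>p y\<close>.\<close>
            show "sgn (poly (q x) \<xi>) = sgn (poly (q y) (\<theta> \<xi>))"
              if p: "p \<in> fst ` set_mset N'" "poly (p x) \<xi> = 0" for p \<xi>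
            proof -
              obtain d where d: "(p, d) \<in># N'" using p by auto
              have "sgn (poly (p y) (\<theta> \<xi>)) = sgn (poly (p x) \<xi>)"
                using p \<theta>(3)[of p \<xi>] by (auto simp: K_def N'_def)
              then have "poly (p y) (\<theta> \<xi>) = 0" using p by (simp add: sgn_zero_iff)
              then have "sgn (poly (reduce_step (q y) n (p y) d) (\<theta> \<xi>)) = sgn (poly (q y) (\<theta> \<xi>))"
                using lcN'[OF d, of y] xy E' by (intro sgn_reduce_step) auto
              moreover have "sgn (poly (reduce_step (q x) n (p x) d) \<xi>) = sgn (poly (q x) \<xi>)"
                using lcN'[OF d, of x] xy E' p by (intro sgn_reduce_step) auto
              moreover have "(\<lambda>x. reduce_step (q x) n (p x) d) \<in> fst ` set_mset K"
                using d by (force simp: K_def R_def)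
              ultimately show ?thesis using \<theta>(3)[of "\<lambda>x. reduce_step (q x) n (p x) d" \<xi>] by simp
            qed
          qed (auto simp: N'_def q'_def)
          then show "sign_equiv (fst ` set_mset M) x y"
            unfolding sign_equiv_def by (auto simp: M N'_def)
        qed
        have "tame E (fst ` set_mset M)"
        proof (rule tame_split[where S = "{x. 0 < coeff (q x) n}"])
          show "{x. 0 < coeff (q x) n} \<in> semialgebraic"
            using pq by (intro semialgebraic.pos) (simp add: param_poly_def)
          show "tame (E - {x. 0 < coeff (q x) n}) (fst ` set_mset M)"
          proof (rule same)
            fix x y assume "x \<in> E - {x. 0 < coeff (q x) n}" "y \<in> E - {x. 0 < coeff (q x) n}"
            then show "sgn (coeff (q x) n) = sgn (coeff (q y) n)"
              using lc[OF qn, of x] lc[OF qn, of y] by (auto simp: sgn_if)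
          qed auto
        qed (rule same; auto)
        then show "tame (D - \<Union>\<S>) (fst ` set_mset M)" by (simp add: E_def)
      qed
    qed
  qed
qed

text \<open>\<open>F\<close> collects the polynomials of the inequalities that build
  \<open>S\<close>, read as polynomials in variable \<open>k\<close>. A Boolean combination depends
  only on their signs, even when both the parameters and the points differ.\<close>

lemma semialgebraic_atoms:
  assumes "S \<in> semialgebraic"
  shows "\<exists>F. finite F \<and> (\<forall>q\<in>F. \<exists>d. param_poly d q) \<and>
    (\<forall>x y s t. (\<forall>q\<in>F. sgn (poly (q x) s) = sgn (poly (q y) t)) \<longrightarrow> (x(k := s) \<in> S \<longleftrightarrow> y(k := t) \<in> S))"
  using assms
proof induction
  case (pos f)
  obtain d q where q: "param_poly d q" "\<And>x t. f (x(k := t)) = poly (q x) t"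
    using polyfun_section[OF pos, of k] by auto
  have sg: "(0 < a) = (0 < b)" if "sgn a = sgn b" for a b :: real
    using that by (auto simp: sgn_if split: if_splits)
  show ?case
  proof (intro exI[of _ "{q}"] conjI allI impI)
    fix x y s t assume "\<forall>q\<in>{q}. sgn (poly (q x) s) = sgn (poly (q y) t)"
    then show "x(k := s) \<in> {x. 0 < f x} \<longleftrightarrow> y(k := t) \<in> {x. 0 < f x}"
      unfolding mem_Collect_eq q(2) by (intro sg) simp
  qed (use q in auto)
next
  case (compl S)
  then show ?case by auto
next
  case (union S T)
  obtain F where F: "finite F" "\<forall>q\<in>F. \<exists>d. param_poly d q"
    "\<forall>x y s t. (\<forall>q\<in>F. sgn (poly (q x) s) = sgn (poly (q y) t)) \<longrightarrow> (x(k := s) \<in> S \<longleftrightarrow> y(k := t) \<in> S)"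
    using union.IH(1) by (elim exE conjE)
  obtain G where G: "finite G" "\<forall>q\<in>G. \<exists>d. param_poly d q"
    "\<forall>x y s t. (\<forall>q\<in>G. sgn (poly (q x) s) = sgn (poly (q y) t)) \<longrightarrow> (x(k := s) \<in> T \<longleftrightarrow> y(k := t) \<in> T)"
    using union.IH(2) by (elim exE conjE)
  show ?case
  proof (intro exI[of _ "F \<union> G"] conjI allI impI)
    fix x y s t assume *: "\<forall>q\<in>F \<union> G. sgn (poly (q x) s) = sgn (poly (q y) t)"
    then have "x(k := s) \<in> S \<longleftrightarrow> y(k := t) \<in> S" by (intro F(3)[rule_format]) simp
    moreover have "x(k := s) \<in> T \<longleftrightarrow> y(k := t) \<in> T" using * by (intro G(3)[rule_format]) simp
    ultimately show "x(k := s) \<in> S \<union> T \<longleftrightarrow> y(k := t) \<in> S \<union> T" by simp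
  qed (use F G in auto)
qed

text \<open>The Tarski-Seidenberg theorem. Within a cell, the bijection of a sign equivalence
  carries a witness \<open>t\<close> over \<open>x\<close> to a witness \<open>\<theta> t\<close>
  over \<open>y\<close>. So a cell lies inside the projection or misses it, and the projection is a
  finite union of cells.\<close>

theorem semialgebraic_projection:
  assumes "S \<in> semialgebraic"
  shows "{x. \<exists>t. x(k := t) \<in> S} \<in> semialgebraic"
proof -
  obtain F where F: "finite F" "\<And>q. q \<in> F \<Longrightarrow> \<exists>d. param_poly d q"
    "\<And>x y s t. (\<forall>q\<in>F. sgn (poly (q x) s) = sgn (poly (q y) t)) \<Longrightarrow> x(k := s) \<in> S \<longleftrightarrow> y(k := t) \<in> S"
    using semialgebraic_atoms[OF assms] by metis
  obtain d where d: "\<And>q. q \<in> F \<Longrightarrow> param_poly (d q) q" using F(2) by metis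
  let ?M = "mset_set ((\<lambda>q. (q, d q)) ` F)"
  have "tame UNIV (fst ` set_mset ?M)"
    by (rule tame_family) (use F(1) d in auto)
  moreover have "fst ` set_mset ?M = F" using F(1) by force
  ultimately obtain \<C> where C: "finite \<C>" "\<C> \<subseteq> semialgebraic" "UNIV \<subseteq> \<Union>\<C>"
    "\<And>C x y. C \<in> \<C> \<Longrightarrow> x \<in> C \<Longrightarrow> y \<in> C \<Longrightarrow> sign_equiv F x y"
    unfolding tame_def by auto
  let ?P = "{x. \<exists>t. x(k := t) \<in> S}"
  have inv: "y \<in> ?P" if as: "x \<in> ?P" "C \<in> \<C>" "x \<in> C" "y \<in> C" for x y C
  proof -
    obtain \<theta> where "\<And>q t. q \<in> F \<Longrightarrow> sgn (poly (q x) t) = sgn (poly (q y) (\<theta> t))"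
      using C(4)[OF as(2-4)] unfolding sign_equiv_def by blast
    then have "x(k := t) \<in> S \<longleftrightarrow> y(k := \<theta> t) \<in> S" for t
      by (intro F(3)) blast
    then show ?thesis using as(1) by blast
  qed
  have "?P = \<Union>{C\<in>\<C>. C \<inter> ?P \<noteq> {}}"
  proof (intro equalityI subsetI)
    fix x assume "x \<in> ?P"
    moreover obtain C where "C \<in> \<C>" "x \<in> C" using C(3) by blast
    ultimately show "x \<in> \<Union>{C\<in>\<C>. C \<inter> ?P \<noteq> {}}" by blast
  next
    fix y assume "y \<in> \<Union>{C\<in>\<C>. C \<inter> ?P \<noteq> {}}"
    then obtain C x where "C \<in> \<C>" "y \<in> C" "x \<in> C" "x \<in> ?P" by blast
    then show "y \<in> ?P" using inv by blast
  qed
  moreover have "\<Union>{C\<in>\<C>. C \<inter> ?P \<noteq> {}} \<in> semialgebraic"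
    using C(1,2) by (intro semialgebraic_Union) auto
  ultimately show ?thesis by simp
qed

section \<open>Definable predicates of one real variable\<close>

definition definable :: "((nat \<Rightarrow> real) \<Rightarrow> bool) \<Rightarrow> bool" where
  "definable P \<longleftrightarrow> {x. P x} \<in> semialgebraic"

lemma definable_not: "definable P \<Longrightarrow> definable (\<lambda>x. \<not> P x)"
  using semialgebraic.compl[of "{x. P x}"] unfolding definable_def Collect_neg_eq .

lemma definable_disj: "definable P \<Longrightarrow> definable Q \<Longrightarrow> definable (\<lambda>x. P x \<or> Q x)"
  using semialgebraic.union[of "{x. P x}" "{x. Q x}"] unfolding definable_def Collect_disj_eq .

lemma definable_conj: "definable P \<Longrightarrow> definable Q \<Longrightarrow> definable (\<lambda>x. P x \<and> Q x)"
  using semialgebraic_inter[of "{x. P x}" "{x. Q x}"] unfolding definable_def Collect_conj_eq .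

lemma definable_imp: "definable P \<Longrightarrow> definable Q \<Longrightarrow> definable (\<lambda>x. P x \<longrightarrow> Q x)"
  using definable_disj[OF definable_not, of P Q] unfolding imp_conv_disj .

lemma definable_less:
  assumes "f \<in> polyfun" "g \<in> polyfun"
  shows "definable (\<lambda>x. f x < g x)"
  using semialgebraic.pos[OF polyfun_diff[OF assms(2,1)]] unfolding definable_def by simp

lemma definable_le: "f \<in> polyfun \<Longrightarrow> g \<in> polyfun \<Longrightarrow> definable (\<lambda>x. f x \<le> g x)"
  using definable_not[OF definable_less, of g f] by (simp add: not_less)

lemma definable_eq: "f \<in> polyfun \<Longrightarrow> g \<in> polyfun \<Longrightarrow> definable (\<lambda>x. f x = g x)"
  using definable_conj[OF definable_le definable_le, of f g g f] by (simp add: eq_iff)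

lemma definable_const: "definable (\<lambda>_. P)"
  using semialgebraic_UNIV semialgebraic_empty by (cases P) (auto simp: definable_def)

lemma definable_ball:
  assumes "finite A" "\<And>i. i \<in> A \<Longrightarrow> definable (P i)"
  shows "definable (\<lambda>x. \<forall>i\<in>A. P i x)"
  using assms
proof (induction A rule: finite_induct)
  case empty
  show ?case using definable_const[of True] by simp
next
  case (insert i A)
  have "definable (\<lambda>x. P i x \<and> (\<forall>i\<in>A. P i x))"
    by (rule definable_conj) (use insert in simp_all)
  then show ?case by simp
qed

lemma definable_ex_upd: "definable P \<Longrightarrow> definable (\<lambda>x. \<exists>t. P (x(k := t)))"
  unfolding definable_def using semialgebraic_projection[of "{x. P x}" k] by simp

text \<open>The first assumption makes variable \<open>k\<close> fresh for \<open>P\<close>, so that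
  it can act as the bound variable; formulas with real quantifiers are then handled by applying
  rules.\<close>

lemma definable_ex:
  assumes "\<And>x s t. P (x(k := s)) t = P x t" "definable (\<lambda>x. P x (x k))"
  shows "definable (\<lambda>x. \<exists>t. P x t)"
  using definable_ex_upd[OF assms(2), of k] by (simp add: assms(1))

lemma definable_all:
  assumes "\<And>x s t. P (x(k := s)) t = P x t" "definable (\<lambda>x. P x (x k))"
  shows "definable (\<lambda>x. \<forall>t. P x t)"
proof -
  have "definable (\<lambda>x. \<not> (\<exists>t. \<not> P x t))"
    by (intro definable_not definable_ex[of _ k]) (simp_all only: assms definable_not)
  then show ?thesis by simp
qed

lemma definable_subst:
  assumes "definable P" "\<And>i. g i \<in> polyfun"
  shows "definable (\<lambda>x. P (\<lambda>i. g i x))"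
proof -
  have "{x. (\<lambda>i. g i x) \<in> S} \<in> semialgebraic" if "S \<in> semialgebraic" for S
    using that
  proof induction
    case (pos f)
    then show ?case using semialgebraic.pos[OF polyfun_subst[OF pos assms(2)]] by simp
  next
    case (compl S)
    then show ?case by (simp add: Collect_neg_eq semialgebraic.compl)
  next
    case (union S T)
    then show ?case by (simp add: Collect_disj_eq semialgebraic.union)
  qed
  from this[OF assms(1)[unfolded definable_def]] show ?thesis by (simp add: definable_def)
qed

lemma definable_binary:
  assumes "definable (\<lambda>x. R (x 0) (x 1))" "f \<in> polyfun" "g \<in> polyfun"
  shows "definable (\<lambda>x. R (f x) (g x))"
  using definable_subst[OF assms(1), of "\<lambda>i. if i = 0 then f else g"] assms(2,3) by simp

lemmas definable_intros = definable_conj definable_disj definable_imp definable_not definable_less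
  definable_le definable_eq definable_const

section \<open>One-sided germs and the monotonicity theorem\<close>

lemma poly_germ_right:
  fixes p :: "real poly"
  shows "\<exists>s. \<forall>\<^sub>F t in at_right a. sgn (poly p t) = s"
proof (cases "p = 0")
  case False
  then obtain d where d: "d > 0" "\<And>x. poly p x = 0 \<Longrightarrow> x \<noteq> a \<Longrightarrow> d \<le> dist a x"
    using finite_set_avoid[OF poly_roots_finite[OF False], of a] by auto
  have nz: "poly p t \<noteq> 0" if "a < t" "t < a + d" for t
    using d(2)[of t] that by (auto simp: dist_real_def)
  have same: "sgn (poly p t) = sgn (poly p (a + d / 2))" if t: "a < t" "t < a + d" for t
  proof (cases "t \<le> a + d / 2")
    case True then show ?thesis using t d(1) by (intro poly_same_sign nz) auto
  next
    case False then show ?thesis using t d(1) by (intro poly_same_sign[symmetric] nz) auto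
  qed
  have "\<forall>\<^sub>F t in at_right a. sgn (poly p t) = sgn (poly p (a + d / 2))"
  proof (rule eventually_at_rightI)
    show "sgn (poly p t) = sgn (poly p (a + d / 2))" if "t \<in> {a<..<a + d}" for t
      using that by (intro same) auto
  qed (use d in simp)
  then show ?thesis by blast
qed auto

lemma poly_germ_left:
  fixes p :: "real poly"
  shows "\<exists>s. \<forall>\<^sub>F t in at_left a. sgn (poly p t) = s"
proof -
  obtain s where "\<forall>\<^sub>F t in at_right (- a). sgn (poly (pcompose p [:0, -1:]) t) = s"
    using poly_germ_right[of "pcompose p [:0, -1:]" "- a"] by auto
  then have "\<forall>\<^sub>F t in at_left a. sgn (poly p t) = s"
    unfolding at_left_minus[of a] eventually_filtermap by (simp add: poly_pcompose)
  then show ?thesis by blast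
qed

text \<open>A polynomial in one variable vanishes identically or has finitely many roots, so its
  sign is constant on each side close to a point; Boolean combinations inherit this
  dichotomy.\<close>

lemma definable_germ:
  assumes "definable P" "F \<in> {at_left a, at_right a}"
  shows "(\<forall>\<^sub>F t in F. P (x(k := t))) \<or> (\<forall>\<^sub>F t in F. \<not> P (x(k := t)))"
proof -
  have "(\<forall>\<^sub>F t in F. x(k := t) \<in> S) \<or> (\<forall>\<^sub>F t in F. x(k := t) \<notin> S)" if "S \<in> semialgebraic" for S
    using that
  proof induction
    case (pos f)
    obtain d q where q: "param_poly d q" "\<And>x t. f (x(k := t)) = poly (q x) t"
      using polyfun_section[OF pos, of k] by auto
    obtain s where "\<forall>\<^sub>F t in F. sgn (poly (q x) t) = s"
      using poly_germ_left[of "q x" a] poly_germ_right[of "q x" a] assms(2) by auto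
    then have "\<forall>\<^sub>F t in F. 0 < poly (q x) t \<longleftrightarrow> s = 1"
      by eventually_elim (auto simp: sgn_if split: if_splits)
    then show ?case unfolding mem_Collect_eq q(2) by (cases "s = 1") simp_all
  next
    case (union S T)
    then consider "\<forall>\<^sub>F t in F. x(k := t) \<in> S" | "\<forall>\<^sub>F t in F. x(k := t) \<in> T"
      | "\<forall>\<^sub>F t in F. x(k := t) \<notin> S" "\<forall>\<^sub>F t in F. x(k := t) \<notin> T" by blast
    then show ?case
    proof cases
      case 1
      then have "\<forall>\<^sub>F t in F. x(k := t) \<in> S \<union> T" by eventually_elim (rule UnI1)
      then show ?thesis ..
    next
      case 2
      then have "\<forall>\<^sub>F t in F. x(k := t) \<in> S \<union> T" by eventually_elim (rule UnI2)
      then show ?thesis ..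
    next
      case 3
      then have "\<forall>\<^sub>F t in F. x(k := t) \<notin> S \<union> T" by eventually_elim simp
      then show ?thesis ..
    qed
  qed auto
  from this[OF assms(1)[unfolded definable_def]] show ?thesis by simp
qed

lemma definable_germ_unary:
  assumes "definable (\<lambda>x. Q (x 0))" "F \<in> {at_left a, at_right a}"
  shows "(\<forall>\<^sub>F t in F. Q t) \<or> (\<forall>\<^sub>F t in F. \<not> Q t)"
  using definable_germ[OF assms, of "\<lambda>_. 0" 0] by simp

text \<open>Otherwise every \<open>t\<close> has a radius \<open>\<eta> t\<close> within which
  \<open>Q t s\<close> holds to the right and \<open>Q s t\<close> fails to the left. Two points
  closer than both of their radii contradict each other, so the points of radius above
  \<open>1 / (n + 1)\<close> are spread out and countable, while the interval is not. With
  \<open>Q\<close> a comparison of values, this excludes a function with a local extremum of the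
  same kind, strict on one side, at every point.\<close>

lemma not_everywhere_conflicting:
  fixes e :: real
  assumes "e > 0"
  shows "\<exists>t\<in>{0<..<e}. \<forall>\<eta>>0. (\<exists>s\<in>{0<..<e}. t < s \<and> s < t + \<eta> \<and> \<not> Q t s) \<or>
    (\<exists>s\<in>{0<..<e}. s < t \<and> t - \<eta> < s \<and> Q s t)"
proof (rule ccontr)
  assume "\<not> ?thesis"
  then have "\<forall>t\<in>{0<..<e}. \<exists>\<eta>>0. (\<forall>s\<in>{0<..<e}. t < s \<and> s < t + \<eta> \<longrightarrow> Q t s) \<and>
    (\<forall>s\<in>{0<..<e}. s < t \<and> t - \<eta> < s \<longrightarrow> \<not> Q s t)" by blast
  then obtain \<eta> where \<eta>: "\<And>t. t \<in> {0<..<e} \<Longrightarrow> \<eta> t > 0"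
    "\<And>t s. t \<in> {0<..<e} \<Longrightarrow> s \<in> {0<..<e} \<Longrightarrow> t < s \<Longrightarrow> s < t + \<eta> t \<Longrightarrow> Q t s"
    "\<And>t s. t \<in> {0<..<e} \<Longrightarrow> s \<in> {0<..<e} \<Longrightarrow> s < t \<Longrightarrow> t - \<eta> t < s \<Longrightarrow> \<not> Q s t"
    by metis
  define T where "T n = {t \<in> {0<..<e}. inverse (real (Suc n)) < \<eta> t}" for n
  have conflict: False if "t \<in> T n" "s \<in> T n" "t < s" "s - t < inverse (real (Suc n))" for s t n
  proof -
    have "Q t s" using that by (intro \<eta>(2)) (auto simp: T_def)
    moreover have "\<not> Q t s" using that by (intro \<eta>(3)) (auto simp: T_def)
    ultimately show False by blast
  qed
  have "countable (T n)" for n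
  proof -
    have "inj_on (\<lambda>t. \<lfloor>t * real (Suc n)\<rfloor>) (T n)"
    proof (rule inj_onI, rule ccontr)
      fix s t assume st: "s \<in> T n" "t \<in> T n" "\<lfloor>s * real (Suc n)\<rfloor> = \<lfloor>t * real (Suc n)\<rfloor>" "s \<noteq> t"
      then have "\<bar>s * real (Suc n) - t * real (Suc n)\<bar> < 1" by linarith
      then have "\<bar>s - t\<bar> * real (Suc n) < 1"
        by (simp add: left_diff_distrib[symmetric] abs_mult del: of_nat_Suc)
      then have "\<bar>s - t\<bar> < inverse (real (Suc n))" by (simp add: field_simps del: of_nat_Suc)
      then show False using conflict[of s n t] conflict[of t n s] st by (cases "s < t") auto
    qed
    then show ?thesis by (rule countableI')
  qed
  then have "countable (\<Union>n. T n)" by blast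
  moreover have "{0<..<e} \<subseteq> (\<Union>n. T n)"
  proof
    fix t assume t: "t \<in> {0<..<e}"
    then show "t \<in> (\<Union>n. T n)" using reals_Archimedean[OF \<eta>(1)[OF t]] by (auto simp: T_def)
  qed
  ultimately have "countable {0<..<e}" by (rule countable_subset[rotated])
  then show False using uncountable_open_interval[of 0 e] assms by simp
qed

text \<open>By Bolzano bisection. The ends of a short interval around \<open>t\<close> are compared
  through the value at \<open>t\<close> itself, so the argument works for discontinuous
  \<open>g\<close>.\<close>

lemma locally_nondecreasing:
  fixes g :: "real \<Rightarrow> real"
  assumes loc: "\<And>t. 0 < t \<Longrightarrow> t < e \<Longrightarrow> \<exists>\<eta>>0. \<forall>s. 0 < s \<and> s < e \<longrightarrow>
      (t < s \<and> s < t + \<eta> \<longrightarrow> g t \<le> g s) \<and> (s < t \<and> t - \<eta> < s \<longrightarrow> g s \<le> g t)"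
    and xy: "0 < x" "x \<le> y" "y < e"
  shows "g x \<le> g y"
proof -
  have "0 < x \<and> y < e \<longrightarrow> g x \<le> g y"
    using xy(2)
  proof (induction rule: Bolzano)
    case (trans a b c)
    show ?case
    proof (intro impI)
      assume ac: "0 < a \<and> c < e"
      then have "g a \<le> g b" using trans by auto
      also have "g b \<le> g c" using trans ac by auto
      finally show "g a \<le> g c" .
    qed
  next
    case (local t)
    then obtain \<eta> where \<eta>: "\<eta> > 0" "\<forall>s. 0 < s \<and> s < e \<longrightarrow>
      (t < s \<and> s < t + \<eta> \<longrightarrow> g t \<le> g s) \<and> (s < t \<and> t - \<eta> < s \<longrightarrow> g s \<le> g t)"
      using loc[of t] xy by auto
    have "g a \<le> g b" if ab: "a \<le> t" "t \<le> b" "b - a < \<eta>" "0 < a" "b < e" for a b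
    proof -
      have "g a \<le> g t" using \<eta>(2)[rule_format, of a] ab by (cases "a = t") auto
      also have "g t \<le> g b" using \<eta>(2)[rule_format, of b] ab by (cases "b = t") auto
      finally show ?thesis .
    qed
    then show ?case using \<eta>(1) by blast
  qed
  then show ?thesis using xy by simp
qed

text \<open>The graph \<open>R\<close> makes comparisons of values of \<open>g\<close> definable, so
  near 0 each of \<open>A\<close> (values just to the right are at least \<open>g t\<close>) and
  \<open>B\<close> (values just to the left are at most \<open>g t\<close>) always holds or always
  fails. If both fail, the germ dichotomy at \<open>t\<close> upgrades this to the reverse
  inequalities on both sides. If exactly one holds, every point is a local extremum that is strict
  on one side, which is impossible.\<close>

lemma definable_mono_germ:
  assumes R: "definable (\<lambda>x. R (x 0) (x 1))"
    and g: "\<And>t s. 0 < t \<Longrightarrow> t < d \<Longrightarrow> R t s \<longleftrightarrow> s = g t" and d: "d > 0"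
  shows "\<exists>e. 0 < e \<and> e \<le> d \<and> ((\<forall>x y. 0 < x \<longrightarrow> x \<le> y \<longrightarrow> y < e \<longrightarrow> g x \<le> g y) \<or>
    (\<forall>x y. 0 < x \<longrightarrow> x \<le> y \<longrightarrow> y < e \<longrightarrow> g y \<le> g x))"
proof -
  define le where "le t s \<longleftrightarrow> (\<forall>y z. R t y \<longrightarrow> R s z \<longrightarrow> y \<le> z)" for t s
  have le: "le t s \<longleftrightarrow> g t \<le> g s" if "0 < t" "t < d" "0 < s" "s < d" for t s
    using g that by (simp add: le_def)
  have le_def': "definable (\<lambda>x. le (f x) (h x))"
    if fh: "f \<in> polyfun" "h \<in> polyfun" for f h
  proof -
    have "definable (\<lambda>x. le (x 0) (x 1))" unfolding le_def
      by (rule definable_all[where k = 2], simp, rule definable_all[where k = 3], simp)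
        (intro definable_imp definable_binary[OF R] definable_le polyfun.var)
    then show ?thesis using fh by (rule definable_binary)
  qed
  define A where "A t \<longleftrightarrow> (\<exists>\<eta>. 0 < \<eta> \<and> (\<forall>s. t < s \<and> s < t + \<eta> \<longrightarrow> le t s))" for t
  define B where "B t \<longleftrightarrow> (\<exists>\<eta>. 0 < \<eta> \<and> (\<forall>s. s < t \<and> t < s + \<eta> \<longrightarrow> le s t))" for t
  have "definable (\<lambda>x. A (x 0))" unfolding A_def
    by (rule definable_ex[where k = 1], simp, rule definable_conj, intro definable_less polyfun_intros,
      rule definable_all[where k = 2], simp) (intro definable_intros le_def' polyfun_intros)
  then have A: "(\<forall>\<^sub>F t in at_right 0. A t) \<or> (\<forall>\<^sub>F t in at_right 0. \<not> A t)"
    by (rule definable_germ_unary[where a = 0]) simp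
  have "definable (\<lambda>x. B (x 0))" unfolding B_def
    by (rule definable_ex[where k = 1], simp, rule definable_conj, intro definable_less polyfun_intros,
      rule definable_all[where k = 2], simp) (intro definable_intros le_def' polyfun_intros)
  then have B: "(\<forall>\<^sub>F t in at_right 0. B t) \<or> (\<forall>\<^sub>F t in at_right 0. \<not> B t)"
    by (rule definable_germ_unary[where a = 0]) simp
  have notA: "\<exists>\<eta>>0. \<forall>s. t < s \<and> s < t + \<eta> \<longrightarrow> \<not> le t s" if "\<not> A t" for t
  proof -
    have "definable (\<lambda>x. le t (x 0))" by (intro le_def' polyfun_intros)
    then consider "\<forall>\<^sub>F s in at_right t. le t s" | "\<forall>\<^sub>F s in at_right t. \<not> le t s"
      using definable_germ_unary[of "le t" "at_right t" t] by blast
    then show ?thesis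
    proof cases
      case 1
      then obtain b where "b > t" "\<And>s. t < s \<Longrightarrow> s < b \<Longrightarrow> le t s"
        by (auto simp: eventually_at_right_field)
      then have "A t" unfolding A_def by (intro exI[of _ "b - t"]) auto
      with that show ?thesis by simp
    next
      case 2
      then obtain b where "b > t" "\<And>s. t < s \<Longrightarrow> s < b \<Longrightarrow> \<not> le t s"
        by (auto simp: eventually_at_right_field)
      then show ?thesis by (intro exI[of _ "b - t"]) auto
    qed
  qed
  have notB: "\<exists>\<eta>>0. \<forall>s. s < t \<and> t < s + \<eta> \<longrightarrow> \<not> le s t" if "\<not> B t" for t
  proof -
    have "definable (\<lambda>x. le (x 0) t)" by (intro le_def' polyfun_intros)
    then consider "\<forall>\<^sub>F s in at_left t. le s t" | "\<forall>\<^sub>F s in at_left t. \<not> le s t"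
      using definable_germ_unary[of "\<lambda>s. le s t" "at_left t" t] by blast
    then show ?thesis
    proof cases
      case 1
      then obtain b where "b < t" "\<And>s. b < s \<Longrightarrow> s < t \<Longrightarrow> le s t"
        by (auto simp: eventually_at_left_field)
      then have "B t" unfolding B_def by (intro exI[of _ "t - b"]) auto
      with that show ?thesis by simp
    next
      case 2
      then obtain b where "b < t" "\<And>s. b < s \<Longrightarrow> s < t \<Longrightarrow> \<not> le s t"
        by (auto simp: eventually_at_left_field)
      then show ?thesis by (intro exI[of _ "t - b"]) auto
    qed
  qed
  have near0: "\<exists>e. 0 < e \<and> e \<le> d \<and> (\<forall>t. 0 < t \<and> t < e \<longrightarrow> P t)" if "\<forall>\<^sub>F t in at_right 0. P t" for P
  proof -
    obtain b where "b > 0" "\<And>t. 0 < t \<Longrightarrow> t < b \<Longrightarrow> P t"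
      using \<open>\<forall>\<^sub>F t in at_right 0. P t\<close> by (auto simp: eventually_at_right_field)
    then show ?thesis using d by (intro exI[of _ "min b d"]) auto
  qed
  consider "\<forall>\<^sub>F t in at_right 0. A t \<and> B t" | "\<forall>\<^sub>F t in at_right 0. \<not> A t \<and> \<not> B t"
    | "\<forall>\<^sub>F t in at_right 0. A t \<and> \<not> B t" | "\<forall>\<^sub>F t in at_right 0. \<not> A t \<and> B t"
    using A B by (auto simp: eventually_conj_iff)
  then show ?thesis
  proof cases
    case 1
    then obtain e where e: "0 < e" "e \<le> d" "\<And>t. 0 < t \<Longrightarrow> t < e \<Longrightarrow> A t \<and> B t" using near0 by blast
    have "g x \<le> g y" if xy: "0 < x" "x \<le> y" "y < e" for x y
    proof (rule locally_nondecreasing[OF _ xy])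
      fix t assume t: "0 < t" "t < e"
      then obtain \<eta>1 \<eta>2 where "\<eta>1 > 0" "\<forall>s. t < s \<and> s < t + \<eta>1 \<longrightarrow> le t s"
        "\<eta>2 > 0" "\<forall>s. s < t \<and> t < s + \<eta>2 \<longrightarrow> le s t"
        using e(3)[OF t] unfolding A_def B_def by blast
      then show "\<exists>\<eta>>0. \<forall>s. 0 < s \<and> s < e \<longrightarrow>
          (t < s \<and> s < t + \<eta> \<longrightarrow> g t \<le> g s) \<and> (s < t \<and> t - \<eta> < s \<longrightarrow> g s \<le> g t)"
        using t e(2) by (intro exI[of _ "min \<eta>1 \<eta>2"]) (auto simp flip: le)
    qed
    with e show ?thesis by blast
  next
    case 2
    then obtain e where e: "0 < e" "e \<le> d" "\<And>t. 0 < t \<Longrightarrow> t < e \<Longrightarrow> \<not> A t \<and> \<not> B t" using near0 by blast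
    have "- g x \<le> - g y" if xy: "0 < x" "x \<le> y" "y < e" for x y
    proof (rule locally_nondecreasing[where g = "\<lambda>t. - g t", OF _ xy])
      fix t assume t: "0 < t" "t < e"
      then obtain \<eta>1 \<eta>2 where "\<eta>1 > 0" "\<forall>s. t < s \<and> s < t + \<eta>1 \<longrightarrow> \<not> le t s"
        "\<eta>2 > 0" "\<forall>s. s < t \<and> t < s + \<eta>2 \<longrightarrow> \<not> le s t"
        using e(3)[OF t] notA notB by blast
      then show "\<exists>\<eta>>0. \<forall>s. 0 < s \<and> s < e \<longrightarrow>
          (t < s \<and> s < t + \<eta> \<longrightarrow> - g t \<le> - g s) \<and> (s < t \<and> t - \<eta> < s \<longrightarrow> - g s \<le> - g t)"
        using t e(2) le by (intro exI[of _ "min \<eta>1 \<eta>2"]) (auto simp: not_le intro: less_imp_le)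
    qed
    with e show ?thesis by auto
  next
    case 3
    then obtain e where e: "0 < e" "e \<le> d" "\<And>t. 0 < t \<Longrightarrow> t < e \<Longrightarrow> A t \<and> \<not> B t" using near0 by blast
    obtain t where t: "t \<in> {0<..<e}" "\<And>\<eta>. \<eta> > 0 \<Longrightarrow> (\<exists>s\<in>{0<..<e}. t < s \<and> s < t + \<eta> \<and> \<not> le t s) \<or>
      (\<exists>s\<in>{0<..<e}. s < t \<and> t - \<eta> < s \<and> le s t)"
      using not_everywhere_conflicting[OF e(1), of le] by blast
    obtain \<eta>1 where 1: "\<eta>1 > 0" "\<And>s. t < s \<Longrightarrow> s < t + \<eta>1 \<Longrightarrow> le t s"
      using e(3)[of t] t unfolding A_def by auto
    obtain \<eta>2 where 2: "\<eta>2 > 0" "\<And>s. s < t \<Longrightarrow> t < s + \<eta>2 \<Longrightarrow> \<not> le s t"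
      using e(3)[of t] t notB[of t] by auto
    have False using t(2)[of "min \<eta>1 \<eta>2"] 1 2 by (auto simp: algebra_simps)
    then show ?thesis ..
  next
    case 4
    then obtain e where e: "0 < e" "e \<le> d" "\<And>t. 0 < t \<Longrightarrow> t < e \<Longrightarrow> \<not> A t \<and> B t" using near0 by blast
    obtain t where t: "t \<in> {0<..<e}" "\<And>\<eta>. \<eta> > 0 \<Longrightarrow> (\<exists>s\<in>{0<..<e}. t < s \<and> s < t + \<eta> \<and> le t s) \<or>
      (\<exists>s\<in>{0<..<e}. s < t \<and> t - \<eta> < s \<and> \<not> le s t)"
      using not_everywhere_conflicting[OF e(1), of "\<lambda>s t. \<not> le s t"] by blast
    obtain \<eta>1 where 1: "\<eta>1 > 0" "\<And>s. t < s \<Longrightarrow> s < t + \<eta>1 \<Longrightarrow> \<not> le t s"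
      using e(3)[of t] t notA[of t] by auto
    obtain \<eta>2 where 2: "\<eta>2 > 0" "\<And>s. s < t \<Longrightarrow> t < s + \<eta>2 \<Longrightarrow> le s t"
      using e(3)[of t] t unfolding B_def by auto
    have False using t(2)[of "min \<eta>1 \<eta>2"] 1 2 by (auto simp: algebra_simps)
    then show ?thesis ..
  qed
qed

section \<open>Selection of monotone curves\<close>

lemma definable_ex_set:
  assumes "finite W" "definable P"
  shows "definable (\<lambda>x. \<exists>y. (\<forall>i. i \<notin> W \<longrightarrow> y i = x i) \<and> P y)"
  using assms(1)
proof (induction W rule: finite_induct)
  case empty
  have "(\<exists>y. (\<forall>i. i \<notin> {} \<longrightarrow> y i = x i) \<and> P y) \<longleftrightarrow> P x" for x
    by (auto simp: fun_eq_iff[symmetric])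
  with assms(2) show ?case by simp
next
  case (insert k W)
  have "(\<exists>y. (\<forall>i. i \<notin> insert k W \<longrightarrow> y i = x i) \<and> P y) \<longleftrightarrow>
    (\<exists>t y. (\<forall>i. i \<notin> W \<longrightarrow> y i = (x(k := t)) i) \<and> P y)" (is "?L x \<longleftrightarrow> ?R x") for x
  proof
    assume "?L x"
    then obtain y where y: "\<And>i. i \<notin> insert k W \<Longrightarrow> y i = x i" "P y" by blast
    have "y i = (x(k := y k)) i" if "i \<notin> W" for i
      using that y(1)[of i] by (cases "i = k") auto
    with y(2) show "?R x" by blast
  next
    assume "?R x"
    then obtain t y where y: "\<And>i. i \<notin> W \<Longrightarrow> y i = (x(k := t)) i" "P y" by blast
    have "y i = x i" if "i \<notin> insert k W" for i
      using that y(1)[of i] by simp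
    with y(2) show "?L x" by blast
  qed
  then show ?case using definable_ex_upd[OF insert.IH, of k] by presburger
qed

lemma compact_box:
  fixes K :: "'a \<Rightarrow> real set"
  assumes "\<And>i. compact (K i)"
  shows "compact {x. \<forall>i. x i \<in> K i}"
proof -
  have "compactin (product_topology (\<lambda>_. euclidean) UNIV) (PiE UNIV K)"
    using assms by (simp add: compactin_PiE)
  moreover have "PiE UNIV K = {x. \<forall>i. x i \<in> K i}" by (auto simp: PiE_def Pi_def)
  ultimately show ?thesis by (simp add: euclidean_product_topology)
qed

text \<open>Convention for environments: variable 0 holds the level \<open>t\<close>, variable 1 is reserved for
  quantified formulas, and the coordinates \<open>W\<close> of the point are variables from 2 on.\<close>

definition fibre :: "nat set \<Rightarrow> (nat \<Rightarrow> real) set \<Rightarrow> real \<Rightarrow> (nat \<Rightarrow> real) set" where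
  "fibre W S t = {x \<in> S. x 0 = t \<and> (\<forall>i. i \<notin> insert 0 W \<longrightarrow> x i = 0)}"

text \<open>\<open>S\<close> constrains only the variables in \<open>insert 0 W\<close> and is a
  cylinder in the others. Compactness is therefore asked of the fibres, where the remaining
  variables are frozen at 0.\<close>

definition compact_family :: "nat set \<Rightarrow> (nat \<Rightarrow> real) set \<Rightarrow> bool" where
  "compact_family W S \<longleftrightarrow> definable (\<lambda>x. x \<in> S) \<and>
     (\<forall>x y. (\<forall>i\<in>insert 0 W. x i = y i) \<longrightarrow> (x \<in> S \<longleftrightarrow> y \<in> S)) \<and> (\<forall>t. compact (fibre W S t))"

definition minimize :: "nat \<Rightarrow> (nat \<Rightarrow> real) set \<Rightarrow> (nat \<Rightarrow> real) set" where
  "minimize k S = {x \<in> S. \<forall>y\<in>S. y 0 = x 0 \<longrightarrow> x k \<le> y k}"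

text \<open>When each level carries a single value of coordinate \<open>k\<close>, this is the graph
  of that coordinate over the level, in the form that \<open>definable_mono_germ\<close>
  expects.\<close>

lemma definable_projection:
  assumes W: "finite W" "W \<subseteq> {2..}" "k \<in> W" and S: "compact_family W S"
  shows "definable (\<lambda>x. \<exists>y\<in>S. y 0 = x 0 \<and> y k = x 1)"
proof -
  have "definable (\<lambda>y. y \<in> S \<and> y k = y 1)"
    using S by (intro definable_conj definable_eq polyfun.var) (simp add: compact_family_def)
  from definable_ex_set[OF W(1) this]
  have "definable (\<lambda>x. \<exists>y. (\<forall>i. i \<notin> W \<longrightarrow> y i = x i) \<and> y \<in> S \<and> y k = y 1)" .
  moreover have "(\<exists>y. (\<forall>i. i \<notin> W \<longrightarrow> y i = x i) \<and> y \<in> S \<and> y k = y 1) \<longleftrightarrow>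
    (\<exists>y\<in>S. y 0 = x 0 \<and> y k = x 1)" (is "?L x \<longleftrightarrow> ?R x") for x
  proof
    assume "?L x"
    then obtain y where y: "\<And>i. i \<notin> W \<Longrightarrow> y i = x i" "y \<in> S" "y k = y 1" by blast
    have "0 \<notin> W" "1 \<notin> W" using W(2) by auto
    then show "?R x" using y by (intro bexI[of _ y]) auto
  next
    assume "?R x"
    then obtain y where y: "y \<in> S" "y 0 = x 0" "y k = x 1" by blast
    define z where "z i = (if i \<in> W then y i else x i)" for i
    have "\<forall>i\<in>insert 0 W. z i = y i" using y(2) by (auto simp: z_def)
    then have "z \<in> S" using S y(1) unfolding compact_family_def by blast
    have "1 \<notin> W" using W(2) by auto
    then have "z k = z 1" using y(3) W(3) by (simp add: z_def)
    moreover have "\<forall>i. i \<notin> W \<longrightarrow> z i = x i" by (simp add: z_def)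
    ultimately show "?L x" using \<open>z \<in> S\<close> by blast
  qed
  ultimately show ?thesis by simp
qed

lemma definable_fibre_nonempty:
  assumes W: "finite W" "W \<subseteq> {2..}" and S: "compact_family W S"
  shows "definable (\<lambda>x. fibre W S (x 0) \<noteq> {})"
proof -
  have "definable (\<lambda>x. \<exists>y. (\<forall>i. i \<notin> W \<longrightarrow> y i = x i) \<and> y \<in> S)"
    using S by (intro definable_ex_set[OF W(1)]) (simp add: compact_family_def)
  moreover have eq: "(\<exists>y. (\<forall>i. i \<notin> W \<longrightarrow> y i = x i) \<and> y \<in> S) \<longleftrightarrow> fibre W S (x 0) \<noteq> {}"
    (is "?L x \<longleftrightarrow> ?R x") for x
  proof
    assume "?L x"
    then obtain y where y: "\<And>i. i \<notin> W \<Longrightarrow> y i = x i" "y \<in> S" by blast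
    define z where "z i = (if i \<in> insert 0 W then y i else 0)" for i
    have "\<forall>i\<in>insert 0 W. z i = y i" by (simp add: z_def)
    then have "z \<in> S" using S y(2) unfolding compact_family_def by blast
    moreover have "0 \<notin> W" using W(2) by auto
    ultimately have "z \<in> fibre W S (x 0)" using y(1)[of 0] by (auto simp: fibre_def z_def)
    then show "?R x" by blast
  next
    assume "?R x"
    then obtain y where y: "y \<in> S" "y 0 = x 0" by (auto simp: fibre_def)
    define z where "z i = (if i \<in> W then y i else x i)" for i
    have "\<forall>i\<in>insert 0 W. z i = y i" using y(2) by (auto simp: z_def)
    then have "z \<in> S" using S y(1) unfolding compact_family_def by blast
    moreover have "\<forall>i. i \<notin> W \<longrightarrow> z i = x i" by (simp add: z_def)
    ultimately show "?L x" by blast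
  qed
  ultimately show ?thesis unfolding eq by blast
qed

text \<open>Minimality is definable because comparison with all points of a level amounts to
  comparison with all values of coordinate \<open>k\<close> there, a quantifier over the single
  variable 1. In a compact fibre the minimum is attained and the minimizers form a closed
  subset.\<close>

lemma minimize_compact_family:
  assumes W: "finite W" "W \<subseteq> {2..}" "k \<in> W" and S: "compact_family W S"
  shows "compact_family W (minimize k S)"
    and "fibre W S t \<noteq> {} \<Longrightarrow> fibre W (minimize k S) t \<noteq> {}"
proof -
  have k1: "k \<noteq> 1" "k \<noteq> 0" using W by auto
  have dep: "x \<in> S \<longleftrightarrow> y \<in> S" if "\<And>i. i \<in> insert 0 W \<Longrightarrow> x i = y i" for x y
    using S that unfolding compact_family_def by blast
  have norm: "\<exists>z\<in>fibre W S (y 0). \<forall>i\<in>W. z i = y i" if "y \<in> S" for y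
  proof -
    define z where "z i = (if i \<in> insert 0 W then y i else 0)" for i
    have "z \<in> S \<longleftrightarrow> y \<in> S" by (rule dep) (simp add: z_def)
    then have "z \<in> fibre W S (y 0)" using that by (auto simp: fibre_def z_def)
    then show ?thesis by (rule bexI[rotated]) (simp add: z_def)
  qed
  have fibre_min: "fibre W (minimize k S) t = {x \<in> fibre W S t. \<forall>y\<in>fibre W S t. x k \<le> y k}" for t
  proof -
    have cond: "(\<forall>y\<in>S. y 0 = x 0 \<longrightarrow> x k \<le> y k) \<longleftrightarrow> (\<forall>y\<in>fibre W S t. x k \<le> y k)" if x: "x 0 = t" for x
    proof
      assume "\<forall>y\<in>S. y 0 = x 0 \<longrightarrow> x k \<le> y k"
      then show "\<forall>y\<in>fibre W S t. x k \<le> y k" using x by (simp add: fibre_def)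
    next
      assume *: "\<forall>y\<in>fibre W S t. x k \<le> y k"
      show "\<forall>y\<in>S. y 0 = x 0 \<longrightarrow> x k \<le> y k"
      proof (intro ballI impI)
        fix y assume y: "y \<in> S" "y 0 = x 0"
        obtain z where "z \<in> fibre W S (y 0)" "z k = y k" using norm[OF y(1)] W(3) by blast
        then show "x k \<le> y k" using * y(2) x by force
      qed
    qed
    have "x \<in> fibre W (minimize k S) t \<longleftrightarrow> x \<in> fibre W S t \<and> (\<forall>y\<in>fibre W S t. x k \<le> y k)" for x
    proof (cases "x 0 = t")
      case True
      have "x \<in> fibre W (minimize k S) t \<longleftrightarrow> x \<in> fibre W S t \<and> (\<forall>y\<in>S. y 0 = x 0 \<longrightarrow> x k \<le> y k)"
        unfolding fibre_def minimize_def mem_Collect_eq by argo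
      then show ?thesis unfolding cond[of x, OF True] .
    qed (simp add: fibre_def)
    then show ?thesis by blast
  qed
  define R where "R t s \<longleftrightarrow> (\<exists>y\<in>S. y 0 = t \<and> y k = s)" for t s
  have R: "definable (\<lambda>x. R (x 0) (x 1))"
    using definable_projection[OF W S] by (simp add: R_def)
  have "definable (\<lambda>x. x \<in> S \<and> (\<forall>s. R (x 0) s \<longrightarrow> x k \<le> s))"
  proof (rule definable_conj)
    show "definable (\<lambda>x. x \<in> S)" using S by (simp add: compact_family_def)
    show "definable (\<lambda>x. \<forall>s. R (x 0) s \<longrightarrow> x k \<le> s)"
    proof (rule definable_all[where k = 1])
      show "definable (\<lambda>x. R (x 0) (x 1) \<longrightarrow> x k \<le> x 1)"
        by (intro definable_imp R definable_le polyfun.var)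
    qed (use k1 in simp)
  qed
  moreover have "x \<in> minimize k S \<longleftrightarrow> x \<in> S \<and> (\<forall>s. R (x 0) s \<longrightarrow> x k \<le> s)" for x
    by (auto simp: minimize_def R_def)
  ultimately have "definable (\<lambda>x. x \<in> minimize k S)" by presburger
  moreover have "x \<in> minimize k S \<longleftrightarrow> y \<in> minimize k S"
    if "\<forall>i\<in>insert 0 W. x i = y i" for x y
    using dep[of x y] that W(3) by (simp add: minimize_def)
  moreover have "compact (fibre W (minimize k S) t)" for t
  proof -
    have "fibre W (minimize k S) t = fibre W S t \<inter> (\<Inter>y\<in>fibre W S t. {x. x k \<le> y k})"
      by (auto simp: fibre_min)
    moreover have "closed {x :: nat \<Rightarrow> real. x k \<le> c}" for c
      by (intro closed_Collect_le continuous_on_const continuous_on_product_coordinates)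
    moreover have "compact (fibre W S t)" using S by (simp add: compact_family_def)
    ultimately show ?thesis by (auto intro!: compact_Int_closed closed_INT)
  qed
  ultimately show "compact_family W (minimize k S)" unfolding compact_family_def by blast
  show "fibre W (minimize k S) t \<noteq> {}" if ne: "fibre W S t \<noteq> {}"
  proof -
    have "compact (fibre W S t)" using S by (simp add: compact_family_def)
    moreover have "continuous_on (fibre W S t) (\<lambda>x. x k)"
      by (rule continuous_on_subset[OF continuous_on_product_coordinates]) simp
    ultimately obtain x where "x \<in> fibre W S t" "\<And>y. y \<in> fibre W S t \<Longrightarrow> x k \<le> y k"
      using continuous_attains_inf[OF _ ne] by blast
    then show ?thesis by (auto simp: fibre_min)
  qed
qed

text \<open>Each minimization makes one more coordinate single-valued on every level; passing to a
  subset preserves this for the coordinates treated before.\<close>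

lemma uniformize:
  assumes W: "finite W" "W \<subseteq> {2..}" and S: "compact_family W S" and A: "finite A" "A \<subseteq> W"
  shows "\<exists>T\<subseteq>S. compact_family W T \<and> (\<forall>t. fibre W S t \<noteq> {} \<longrightarrow> fibre W T t \<noteq> {}) \<and>
    (\<forall>x\<in>T. \<forall>y\<in>T. x 0 = y 0 \<longrightarrow> (\<forall>k\<in>A. x k = y k))"
  using A
proof (induction A rule: finite_induct)
  case empty
  then show ?case using S by (intro exI[of _ S]) simp
next
  case (insert k A)
  then obtain T where T: "T \<subseteq> S" "compact_family W T" "\<forall>t. fibre W S t \<noteq> {} \<longrightarrow> fibre W T t \<noteq> {}"
    "\<forall>x\<in>T. \<forall>y\<in>T. x 0 = y 0 \<longrightarrow> (\<forall>k\<in>A. x k = y k)" by auto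
  have "k \<in> W" using insert.prems by simp
  note min = minimize_compact_family[OF W this T(2)]
  have sub: "minimize k T \<subseteq> T" by (auto simp: minimize_def)
  have "x k = y k" if "x \<in> minimize k T" "y \<in> minimize k T" "x 0 = y 0" for x y
    using that by (simp add: minimize_def order_antisym)
  moreover have "x j = y j" if "x \<in> minimize k T" "y \<in> minimize k T" "x 0 = y 0" "j \<in> A" for x y j
    using T(4)[rule_format, of x y j] sub that by blast
  ultimately have "\<forall>x\<in>minimize k T. \<forall>y\<in>minimize k T. x 0 = y 0 \<longrightarrow> (\<forall>k\<in>insert k A. x k = y k)"
    by simp
  moreover have "\<forall>t. fibre W S t \<noteq> {} \<longrightarrow> fibre W (minimize k T) t \<noteq> {}" using T(3) min(2) by blast
  moreover have "minimize k T \<subseteq> S" using sub T(1) by blast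
  ultimately show ?case using min(1) by (intro exI[of _ "minimize k T"] conjI)
qed

lemma monotone_curve_selection:
  assumes W: "finite W" "W \<subseteq> {2..}" and S: "compact_family W S"
    and ne: "\<exists>\<^sub>F t in at_right 0. fibre W S t \<noteq> {}"
  shows "\<exists>e>0. \<exists>c. (\<forall>t. 0 < t \<longrightarrow> t < e \<longrightarrow> c t \<in> S \<and> c t 0 = t) \<and>
    (\<forall>k\<in>W. (\<forall>x y. 0 < x \<longrightarrow> x \<le> y \<longrightarrow> y < e \<longrightarrow> c x k \<le> c y k) \<or>
      (\<forall>x y. 0 < x \<longrightarrow> x \<le> y \<longrightarrow> y < e \<longrightarrow> c y k \<le> c x k))"
proof -
  obtain T where T: "T \<subseteq> S" "compact_family W T" "\<And>t. fibre W S t \<noteq> {} \<Longrightarrow> fibre W T t \<noteq> {}"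
    "\<And>x y k. x \<in> T \<Longrightarrow> y \<in> T \<Longrightarrow> x 0 = y 0 \<Longrightarrow> k \<in> W \<Longrightarrow> x k = y k"
    using uniformize[OF W S W(1)] by blast
  have "(\<forall>\<^sub>F t in at_right 0. fibre W S t \<noteq> {}) \<or> (\<forall>\<^sub>F t in at_right 0. \<not> fibre W S t \<noteq> {})"
    by (rule definable_germ_unary[OF definable_fibre_nonempty[OF W S], where a = 0]) simp
  \<comment> \<open>The germ dichotomy turns nonempty fibres at arbitrarily small levels into
    nonempty fibres at all small levels.\<close>
  then have "\<forall>\<^sub>F t in at_right 0. fibre W S t \<noteq> {}"
    using ne by (auto simp: frequently_def)
  then obtain d where d: "d > 0" "\<And>t. 0 < t \<Longrightarrow> t < d \<Longrightarrow> fibre W S t \<noteq> {}"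
    by (auto simp: eventually_at_right_field)
  \<comment> \<open>The choice is harmless: points of \<open>T\<close> on the same level agree in
    all coordinates of \<open>W\<close>, so \<open>c t k\<close> has a definable graph for
    \<open>k \<in> W\<close>.\<close>
  define c where "c t = (SOME x. x \<in> fibre W T t)" for t
  have c: "c t \<in> T" "c t 0 = t" if "0 < t" "t < d" for t
  proof -
    have "c t \<in> fibre W T t" unfolding c_def using T(3)[OF d(2)[OF that]] by (simp add: some_in_eq)
    then show "c t \<in> T" "c t 0 = t" by (auto simp: fibre_def)
  qed
  have "\<exists>e. 0 < e \<and> e \<le> d \<and> ((\<forall>x y. 0 < x \<longrightarrow> x \<le> y \<longrightarrow> y < e \<longrightarrow> c x k \<le> c y k) \<or>
      (\<forall>x y. 0 < x \<longrightarrow> x \<le> y \<longrightarrow> y < e \<longrightarrow> c y k \<le> c x k))" if k: "k \<in> W" for k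
  proof (rule definable_mono_germ[OF _ _ d(1)])
    show "definable (\<lambda>x. \<exists>y\<in>T. y 0 = x 0 \<and> y k = x 1)" by (rule definable_projection[OF W k T(2)])
    show "(\<exists>y\<in>T. y 0 = t \<and> y k = s) \<longleftrightarrow> s = c t k" if "0 < t" "t < d" for t s
    proof
      assume "\<exists>y\<in>T. y 0 = t \<and> y k = s"
      then obtain y where "y \<in> T" "y 0 = t" "y k = s" by blast
      then show "s = c t k" using T(4)[of y "c t" k] c[OF that] k by simp
    next
      assume "s = c t k"
      then show "\<exists>y\<in>T. y 0 = t \<and> y k = s" using c[OF that] by blast
    qed
  qed
  then obtain e where e: "\<And>k. k \<in> W \<Longrightarrow> 0 < e k \<and> e k \<le> d \<and> ((\<forall>x y. 0 < x \<longrightarrow> x \<le> y \<longrightarrow> y < e k \<longrightarrow> c x k \<le> c y k) \<or>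
      (\<forall>x y. 0 < x \<longrightarrow> x \<le> y \<longrightarrow> y < e k \<longrightarrow> c y k \<le> c x k))" by metis
  define e0 where "e0 = Min (insert d (e ` W))"
  have e0: "e0 > 0" "e0 \<le> d" "\<And>k. k \<in> W \<Longrightarrow> e0 \<le> e k"
    using W(1) d(1) e by (auto simp: e0_def Min_gr_iff)
  show ?thesis
  proof (intro exI[of _ e0] exI[of _ c] conjI ballI allI impI)
    show "c t \<in> S" "c t 0 = t" if "0 < t" "t < e0" for t
      using c[of t] that e0 T(1) by auto
    show "(\<forall>x y. 0 < x \<longrightarrow> x \<le> y \<longrightarrow> y < e0 \<longrightarrow> c x k \<le> c y k) \<or>
      (\<forall>x y. 0 < x \<longrightarrow> x \<le> y \<longrightarrow> y < e0 \<longrightarrow> c y k \<le> c x k)" if "k \<in> W" for k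
      using e[OF that] e0(3)[OF that] by (meson order_less_le_trans)
  qed (rule e0(1))
qed

text \<open>A discrete substitute for integrating \<open>l' \<ge> 1 / r\<close>: the quadratic term is negligible on
  fine partitions, and a jump of \<open>l\<close> only helps, so that no regularity of \<open>l\<close> is needed.\<close>

lemma increment_bound:
  fixes l :: "real \<Rightarrow> real"
  assumes ab: "a \<le> b" and r: "r \<ge> 0" and K: "K \<ge> 0"
    and mono: "\<And>s t. a \<le> s \<Longrightarrow> s \<le> t \<Longrightarrow> t \<le> b \<Longrightarrow> l s \<le> l t"
    and step: "\<And>s t. a \<le> s \<Longrightarrow> s \<le> t \<Longrightarrow> t \<le> b \<Longrightarrow> t - s \<le> r * (l t - l s) + K * (l t - l s)\<^sup>2"
  shows "b - a \<le> r * (l b - l a)"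
proof -
  define D where "D = l b - l a"
  have D: "D \<ge> 0" using mono[of a b] ab by (simp add: D_def)
  have bound: "b - a \<le> r * D + (K + (b - a)) * D / real n" if n: "n > 0" for n :: nat
  proof -
    \<comment> \<open>There are \<open>n\<^sup>2\<close> parts, against a threshold
      \<open>1 / n\<close> for the jump \<open>\<delta>\<close> of \<open>l\<close>: a smaller jump
      makes \<open>K * \<delta>\<^sup>2\<close> at most \<open>K / n * \<delta>\<close>, and a
      larger one bounds the length \<open>(b - a) / n\<^sup>2\<close> of the part by
      \<open>(b - a) / n * \<delta>\<close>. Both extra terms telescope and vanish as
      \<open>n\<close> grows.\<close>
    define p where "p j = a + (b - a) * real j / (real n)\<^sup>2" for j
    have p0: "p 0 = a" and pn: "p (n\<^sup>2) = b" using n by (auto simp: p_def)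
    have pdiff: "p (Suc j) - p j = (b - a) / (real n)\<^sup>2" for j
      by (simp add: p_def diff_divide_distrib[symmetric] right_diff_distrib[symmetric])
    have pmono: "p i \<le> p j" if "i \<le> j" for i j
      using that ab by (auto simp: p_def intro!: divide_right_mono mult_left_mono)
    have one: "(b - a) / (real n)\<^sup>2 \<le> (r + K / real n + (b - a) / real n) * (l (p (Suc j)) - l (p j))"
      if j: "j < n\<^sup>2" for j
    proof -
      have range: "a \<le> p j" "p j \<le> p (Suc j)" "p (Suc j) \<le> b"
        using pmono[of 0 j] pmono[of j "Suc j"] pmono[of "Suc j" "n\<^sup>2"] j p0 pn by auto
      define \<delta> where "\<delta> = l (p (Suc j)) - l (p j)"
      have \<delta>: "\<delta> \<ge> 0" using mono[OF range] by (simp add: \<delta>_def)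
      have st: "(b - a) / (real n)\<^sup>2 \<le> r * \<delta> + K * \<delta>\<^sup>2"
        using step[OF range] pdiff[of j] by (simp add: \<delta>_def)
      have "(b - a) / (real n)\<^sup>2 \<le> r * \<delta> + K / real n * \<delta> + (b - a) / real n * \<delta>"
      proof (cases "\<delta> \<le> 1 / real n")
        case True
        have "K * (\<delta> * \<delta>) \<le> K * (1 / real n * \<delta>)"
          using True \<delta> K by (intro mult_left_mono mult_right_mono) auto
        then have "K * \<delta>\<^sup>2 \<le> K / real n * \<delta>" by (simp add: power2_eq_square)
        moreover have "0 \<le> (b - a) / real n * \<delta>" using ab \<delta> by simp
        ultimately show ?thesis using st by linarith
      next
        case False
        have "(b - a) / real n * (1 / real n) \<le> (b - a) / real n * \<delta>"
          using False ab by (intro mult_left_mono) auto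
        moreover have "0 \<le> r * \<delta>" "0 \<le> K / real n * \<delta>" using \<delta> r K by auto
        ultimately show ?thesis by (simp add: power2_eq_square)
      qed
      then show ?thesis by (simp add: \<delta>_def algebra_simps)
    qed
    have "b - a = (\<Sum>j<n\<^sup>2. (b - a) / (real n)\<^sup>2)" using n by simp
    also have "\<dots> \<le> (\<Sum>j<n\<^sup>2. (r + K / real n + (b - a) / real n) * (l (p (Suc j)) - l (p j)))"
      by (intro sum_mono one) simp
    also have "\<dots> = (r + K / real n + (b - a) / real n) * (l (p (n\<^sup>2)) - l (p 0))"
      by (simp add: sum_distrib_left[symmetric] sum_lessThan_telescope[of "\<lambda>j. l (p j)"])
    also have "\<dots> = r * D + (K + (b - a)) * D / real n"
      unfolding p0 pn D_def[symmetric]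
      by (simp add: add_divide_distrib diff_divide_distrib algebra_simps)
    finally show ?thesis .
  qed
  have "(\<lambda>n. r * D + (K + (b - a)) * D / real n) \<longlonglongrightarrow> r * D + 0"
    by (intro tendsto_intros lim_const_over_n)
  then have "b - a \<le> r * D + 0"
    by (rule LIMSEQ_le_const) (intro exI[of _ 1] allI impI bound, simp)
  then show ?thesis by (simp add: D_def)
qed

section \<open>The Kurdyka--Lojasiewicz inequality for polynomials\<close>

text \<open>Variable 2 carries the value of \<open>G\<close> (the squared slope), so that it can be minimized and
  compared along curves like a coordinate.\<close>

lemma level_compact_family:
  assumes V: "finite V" "V \<subseteq> {3..}"
    and pf: "E \<in> polyfun" "G \<in> polyfun" "m \<in> polyfun"
    and dep: "\<And>x y. (\<forall>i\<in>V. x i = y i) \<Longrightarrow> E x = E y \<and> G x = G y \<and> m x = m y"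
  shows "compact_family (insert 2 V)
    {x. E x = x 0 \<and> m x = 0 \<and> x 2 = G x \<and> (\<forall>i\<in>V. - B \<le> x i \<and> x i \<le> B)}"
    (is "compact_family ?W ?S")
proof -
  have "definable (\<lambda>x. x \<in> ?S)"
    unfolding mem_Collect_eq using pf V(1)
    by (intro definable_conj definable_eq definable_ball definable_le polyfun_intros)
  moreover have "x \<in> ?S \<longleftrightarrow> y \<in> ?S" if "\<forall>i\<in>insert 0 ?W. x i = y i" for x y
    using dep[of x y] that by simp
  moreover have "compact (fibre ?W ?S t)" for t
  proof -
    \<comment> \<open>The box bounds only the coordinates in \<open>V\<close>; variable 2 is bounded
      on the fibre through the values of the continuous \<open>G\<close> on this compact
      box.\<close>
    define b where "b i = (if i \<in> V then {- B..B} else {0})" for i :: nat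
    have "compact (G ` {x. \<forall>i. x i \<in> b i})"
      by (intro compact_continuous_image polyfun_continuous pf compact_box) (simp add: b_def)
    then have "bounded (G ` {x. \<forall>i. x i \<in> b i})" by (rule compact_imp_bounded)
    then obtain C where C: "\<And>x. \<forall>i. x i \<in> b i \<Longrightarrow> \<bar>G x\<bar> \<le> C"
      unfolding bounded_iff by auto
    define K where "K i = (if i \<in> V then {- B..B} else if i = 0 then {t} else if i = 2 then {- C..C} else {0})"
      for i :: nat
    have notV: "0 \<notin> V" "2 \<notin> V" using V(2) by auto
    have sub: "x i \<in> K i" if x: "x \<in> fibre ?W ?S t" for x i
    proof -
      define z where "z j = (if j \<in> V then x j else 0)" for j
      have "G x = G z" using dep[of x z] by (simp add: z_def)
      moreover have "\<bar>G z\<bar> \<le> C" using x by (intro C) (auto simp: z_def b_def fibre_def)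
      ultimately have "\<bar>x 2\<bar> \<le> C" using x by (simp add: fibre_def)
      moreover have "x 0 = t" "\<forall>i\<in>V. - B \<le> x i \<and> x i \<le> B" "\<forall>i. i \<notin> insert 0 ?W \<longrightarrow> x i = 0"
        using x by (simp_all add: fibre_def)
      ultimately show ?thesis using notV by (simp add: K_def abs_le_iff)
    qed
    have sup: "x i = 0" if "\<forall>i. x i \<in> K i" "i \<notin> insert 0 ?W" for x i
      using that(1)[rule_format, of i] that(2) by (simp add: K_def)
    have box: "- B \<le> x i \<and> x i \<le> B" if "\<forall>i. x i \<in> K i" "i \<in> V" for x i
      using that(1)[rule_format, of i] that(2) by (simp add: K_def)
    have zero: "x 0 = t" if "\<forall>i. x i \<in> K i" for x
      using that[rule_format, of 0] notV by (simp add: K_def)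
    have eq: "fibre ?W ?S t = {x. \<forall>i. x i \<in> K i} \<inter> ({x. E x = x 0} \<inter> {x. m x = 0} \<inter> {x. x 2 = G x})"
    proof (intro equalityI subsetI)
      fix x assume x: "x \<in> fibre ?W ?S t"
      have "\<forall>i. x i \<in> K i" using sub[OF x] by blast
      then show "x \<in> {x. \<forall>i. x i \<in> K i} \<inter> ({x. E x = x 0} \<inter> {x. m x = 0} \<inter> {x. x 2 = G x})"
        using x by (simp add: fibre_def)
    next
      fix x assume x: "x \<in> {x. \<forall>i. x i \<in> K i} \<inter> ({x. E x = x 0} \<inter> {x. m x = 0} \<inter> {x. x 2 = G x})"
      then have xK: "\<forall>i. x i \<in> K i" by simp
      have "\<forall>i\<in>V. - B \<le> x i \<and> x i \<le> B" "\<forall>i. i \<notin> insert 0 ?W \<longrightarrow> x i = 0"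
        using box[OF xK] sup[OF xK] by blast+
      then show "x \<in> fibre ?W ?S t" using x zero[OF xK] by (simp add: fibre_def)
    qed
    have "closed ({x. E x = x 0} \<inter> {x. m x = 0} \<inter> {x. x 2 = G x})"
      by (intro closed_Int closed_Collect_eq polyfun_continuous polyfun_intros pf)
    moreover have "compact {x. \<forall>i. x i \<in> K i}"
      by (intro compact_box) (simp add: K_def)
    ultimately show ?thesis unfolding eq by (rule compact_Int_closed[rotated])
  qed
  ultimately show ?thesis unfolding compact_family_def by blast
qed

text \<open>A form of the Kurdyka--Lojasiewicz inequality: \<open>l\<close> is the desingularizing function.  It is
  the length of a curve that meets every small level of \<open>E\<close> at a point of least slope.\<close>

theorem kurdyka_lojasiewicz:
  fixes E G m :: "(nat \<Rightarrow> real) \<Rightarrow> real" and V :: "nat set" and B :: real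
  defines "\<K> \<equiv> {x. m x = 0 \<and> (\<forall>i\<in>V. - B \<le> x i \<and> x i \<le> B)}"
  assumes V: "finite V" "V \<subseteq> {3..}"
    and pf: "E \<in> polyfun" "G \<in> polyfun" "m \<in> polyfun"
    and dep: "\<And>x y. (\<forall>i\<in>V. x i = y i) \<Longrightarrow> E x = E y \<and> G x = G y \<and> m x = m y"
    and G: "\<And>x. G x \<ge> 0" and CK: "C \<ge> 0" "K \<ge> 0"
    and slope: "\<And>x y. x \<in> \<K> \<Longrightarrow> y \<in> \<K> \<Longrightarrow>
      E x - E y \<le> C * sqrt (G x) * (\<Sum>i\<in>V. \<bar>x i - y i\<bar>) + K * (\<Sum>i\<in>V. \<bar>x i - y i\<bar>)\<^sup>2"
    and X: "\<And>n. X n \<in> \<K>" "\<And>n. E (X n) > 0" "(\<lambda>n. E (X n)) \<longlonglongrightarrow> 0" "(\<lambda>n. G (X n)) \<longlonglongrightarrow> 0"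
  shows "\<exists>e>0. \<exists>l L. (\<forall>t. 0 < t \<longrightarrow> t < e \<longrightarrow> \<bar>l t\<bar> \<le> L) \<and>
    (\<forall>a b. 0 < a \<longrightarrow> a \<le> b \<longrightarrow> b < e \<longrightarrow> l a \<le> l b) \<and>
    (\<forall>x\<in>\<K>. \<forall>a. 0 < a \<longrightarrow> a \<le> E x \<longrightarrow> E x < e \<longrightarrow> E x - a \<le> C * sqrt (G x) * (l (E x) - l a))"
proof -
  define W where "W = insert 2 V"
  define S where "S = {x. E x = x 0 \<and> m x = 0 \<and> x 2 = G x \<and> (\<forall>i\<in>V. - B \<le> x i \<and> x i \<le> B)}"
  have W: "finite W" "W \<subseteq> {2..}" "2 \<in> W" using V by (auto simp: W_def)
  have notV: "0 \<notin> V" "2 \<notin> V" using V(2) by auto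
  have S: "compact_family W S"
    unfolding W_def S_def by (rule level_compact_family[OF V pf dep])
  \<comment> \<open>Writes the energy and the squared slope of a point into variables 0 and 2, so
    that every point of \<open>\<K>\<close> occurs in \<open>S\<close> at its own level.\<close>
  define lift where "lift x = (\<lambda>i. if i \<in> V then x i else if i = 0 then E x else if i = 2 then G x else 0)" for x
  have lift: "lift x \<in> S" "lift x 0 = E x" "lift x 2 = G x" "lift x \<in> fibre W S (E x)" if "x \<in> \<K>" for x
  proof -
    have "E (lift x) = E x \<and> G (lift x) = G x \<and> m (lift x) = m x"
      by (rule dep) (simp add: lift_def)
    then show *: "lift x \<in> S" "lift x 0 = E x" "lift x 2 = G x"
      using that notV by (auto simp: S_def lift_def \<K>_def)
    then show "lift x \<in> fibre W S (E x)"
      by (auto simp: fibre_def W_def lift_def)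
  qed
  note min = minimize_compact_family[OF W S]
  have "\<exists>\<^sub>F t in at_right 0. fibre W (minimize 2 S) t \<noteq> {}"
    unfolding frequently_def
  proof
    assume "\<forall>\<^sub>F t in at_right 0. \<not> fibre W (minimize 2 S) t \<noteq> {}"
    then obtain d where d: "d > 0" "\<And>t. 0 < t \<Longrightarrow> t < d \<Longrightarrow> fibre W (minimize 2 S) t = {}"
      by (auto simp: eventually_at_right_field)
    obtain n where "E (X n) < d"
      using order_tendstoD(2)[OF X(3) d(1)] by (auto simp: eventually_sequentially)
    then have "fibre W (minimize 2 S) (E (X n)) = {}" using d(2) X(2) by blast
    moreover have "fibre W (minimize 2 S) (E (X n)) \<noteq> {}" by (rule min(2)) (use lift(4)[OF X(1)] in blast)
    ultimately show False by blast
  qed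
  from monotone_curve_selection[OF W(1,2) min(1) this]
  obtain e c where e: "e > 0" and c': "\<forall>t. 0 < t \<longrightarrow> t < e \<longrightarrow> c t \<in> minimize 2 S \<and> c t 0 = t"
    and mon': "\<forall>k\<in>W. (\<forall>x y. 0 < x \<longrightarrow> x \<le> y \<longrightarrow> y < e \<longrightarrow> c x k \<le> c y k) \<or>
      (\<forall>x y. 0 < x \<longrightarrow> x \<le> y \<longrightarrow> y < e \<longrightarrow> c y k \<le> c x k)"
    by (elim exE conjE)
  note c = c'[rule_format] and mon = mon'[THEN bspec]
  have cS: "c t \<in> S" if "0 < t" "t < e" for t
    using c[OF that] by (simp add: minimize_def)
  have cK: "c t \<in> \<K>" "E (c t) = t" "G (c t) = c t 2" if "0 < t" "t < e" for t
    using cS[OF that] c[OF that] by (auto simp: S_def \<K>_def)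
  have c_min: "c (E x) 2 \<le> G x" if "x \<in> \<K>" "0 < E x" "E x < e" for x
    using c[OF that(2,3)] lift[OF that(1)] by (force simp: minimize_def)
  \<comment> \<open>The sign that makes coordinate \<open>k\<close> of the curve nondecreasing. With
    it, increments of the signed sum \<open>l\<close> are sums of absolute coordinate increments:
    \<open>l\<close> measures the length of \<open>c\<close> in the 1-norm, and the box bounds
    it.\<close>
  define \<sigma> where "\<sigma> k = (if \<forall>x y. 0 < x \<longrightarrow> x \<le> y \<longrightarrow> y < e \<longrightarrow> c x k \<le> c y k then 1 else - 1 :: real)" for k
  have \<sigma>: "\<bar>c y k - c x k\<bar> = \<sigma> k * c y k - \<sigma> k * c x k" if "k \<in> V" "0 < x" "x \<le> y" "y < e" for k x y
    using mon[of k] that by (auto simp: \<sigma>_def W_def)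
  have \<sigma>1: "\<bar>\<sigma> k\<bar> = 1" for k by (simp add: \<sigma>_def)
  define l where "l t = (\<Sum>k\<in>V. \<sigma> k * c t k)" for t
  have len: "(\<Sum>k\<in>V. \<bar>c y k - c x k\<bar>) = l y - l x" if "0 < x" "x \<le> y" "y < e" for x y
    unfolding l_def sum_subtractf[symmetric] using \<sigma> that by (intro sum.cong) auto
  \<comment> \<open>If the least slope is nonincreasing in the level, its value at \<open>s\<close>
    is at most \<open>G (X n)\<close> as soon as \<open>E (X n)\<close> is below \<open>s\<close>,
    hence at most the limit 0, while \<open>c t 2\<close> is nonnegative.\<close>
  have slope_mono: "c s 2 \<le> c t 2" if st: "0 < s" "s \<le> t" "t < e" for s t
  proof (cases "\<forall>x y. 0 < x \<longrightarrow> x \<le> y \<longrightarrow> y < e \<longrightarrow> c x 2 \<le> c y 2")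
    case True
    then show ?thesis using st by blast
  next
    case False
    then have anti: "\<And>x y. 0 < x \<Longrightarrow> x \<le> y \<Longrightarrow> y < e \<Longrightarrow> c y 2 \<le> c x 2"
      using mon[OF W(3)] by blast
    have "\<forall>\<^sub>F n in sequentially. c s 2 \<le> G (X n)"
      using order_tendstoD(2)[OF X(3) st(1)]
    proof eventually_elim
      case (elim n)
      have "c s 2 \<le> c (E (X n)) 2" using elim X(2)[of n] st by (intro anti) auto
      also have "\<dots> \<le> G (X n)" using elim X st by (intro c_min) auto
      finally show ?case .
    qed
    then have "c s 2 \<le> 0" by (rule tendsto_lowerbound[OF X(4)]) simp
    moreover have "c t 2 \<ge> 0" using cK(3)[of t] G[of "c t"] st by simp
    ultimately show ?thesis by simp
  qed
  show ?thesis
  proof (rule exI[of _ e], rule conjI[OF e], rule exI[of _ l], rule exI[of _ "\<Sum>k\<in>V. B"],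
      intro conjI allI impI ballI)
    show "\<bar>l t\<bar> \<le> (\<Sum>k\<in>V. B)" if "0 < t" "t < e" for t
    proof -
      have "\<bar>l t\<bar> \<le> (\<Sum>k\<in>V. \<bar>\<sigma> k * c t k\<bar>)" unfolding l_def by (rule sum_abs)
      also have "\<dots> \<le> (\<Sum>k\<in>V. B)"
      proof (rule sum_mono)
        fix k assume "k \<in> V"
        then have "- B \<le> c t k" "c t k \<le> B" using cK(1)[OF that] by (simp_all add: \<K>_def)
        then show "\<bar>\<sigma> k * c t k\<bar> \<le> B" unfolding abs_mult \<sigma>1 by linarith
      qed
      finally show ?thesis .
    qed
    show lmono: "l a \<le> l b" if "0 < a" "a \<le> b" "b < e" for a b
      using len[OF that] sum_nonneg[of V "\<lambda>k. \<bar>c b k - c a k\<bar>"] by simp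
    show "E x - a \<le> C * sqrt (G x) * (l (E x) - l a)"
      if x: "x \<in> \<K>" and a: "0 < a" "a \<le> E x" "E x < e" for x a
    \<comment> \<open>Between the levels \<open>a\<close> and \<open>E x\<close> the squared slope
      on the curve is at most its value at \<open>c (E x)\<close>, which is least on the level of
      \<open>x\<close>. This gives the uniform factor \<open>C * sqrt (G x)\<close>.\<close>
    proof (rule increment_bound[OF a(2) _ CK(2)])
      show "C * sqrt (G x) \<ge> 0" using CK G by simp
      fix s t assume st: "a \<le> s" "s \<le> t" "t \<le> E x"
      then have st': "0 < s" "s \<le> t" "t < e" "0 < t" "s < e" using a by auto
      show "l s \<le> l t" using st' by (intro lmono)
      have "t - s = E (c t) - E (c s)" using cK st' by simp
      also have "\<dots> \<le> C * sqrt (G (c t)) * (l t - l s) + K * (l t - l s)\<^sup>2"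
        using slope[of "c t" "c s"] cK(1) st' len[of s t] by simp
      also have "G (c t) \<le> G x"
        using cK(3)[of t] st' slope_mono[of t "E x"] st a c_min[of x] x by simp
      then have "C * sqrt (G (c t)) * (l t - l s) \<le> C * sqrt (G x) * (l t - l s)"
        using CK lmono[of s t] st' by (intro mult_right_mono mult_left_mono) auto
      finally show "t - s \<le> C * sqrt (G x) * (l t - l s) + K * (l t - l s)\<^sup>2" by simp
    qed
  qed
qed

section \<open>Calculus of periodic grid functions\<close>

text \<open>In \<open>kl\<close> the slope at step \<open>n + 1\<close> is measured by the preceding
  increment \<open>D n\<close>. Together with the decrease of the energy it bounds the square of
  \<open>D (Suc n)\<close> by \<open>D n\<close> times an increment of \<open>l\<close>, up to
  constants. The inequality of the means gives half of \<open>D n\<close> plus half of that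
  increment; the former is absorbed in the sum, the latter telescopes.\<close>

lemma summable_of_kl_descent:
  fixes D e :: "nat \<Rightarrow> real"
  assumes c: "c > 0" and C: "C \<ge> 0" and D: "\<And>n. D n \<ge> 0"
    and drop: "\<And>n. c * (D n)\<^sup>2 \<le> e n - e (Suc n)"
    and e: "\<And>n. e n > 0" "e \<longlonglongrightarrow> 0"
    and e0: "e0 > 0"
    and l: "\<And>t. 0 < t \<Longrightarrow> t < e0 \<Longrightarrow> \<bar>l t\<bar> \<le> L"
    and mono: "\<And>a b. 0 < a \<Longrightarrow> a \<le> b \<Longrightarrow> b < e0 \<Longrightarrow> l a \<le> l b"
    and kl: "\<And>n a. e (Suc n) < e0 \<Longrightarrow> 0 < a \<Longrightarrow> a \<le> e (Suc n) \<Longrightarrow>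
      e (Suc n) - a \<le> C * D n * (l (e (Suc n)) - l a)"
  shows "summable D"
proof -
  have dec: "e (Suc n) \<le> e n" for n
  proof -
    have "0 \<le> c * (D n)\<^sup>2" using c by simp
    then show ?thesis using drop[of n] by linarith
  qed
  obtain n0 where n0: "\<And>n. n \<ge> n0 \<Longrightarrow> e n < e0"
    using order_tendstoD(2)[OF e(2) e0] by (auto simp: eventually_sequentially)
  have step: "D (Suc n) \<le> D n / 2 + C / (2 * c) * (l (e (Suc n)) - l (e (Suc (Suc n))))"
    if n: "n \<ge> n0" for n
  proof -
    define \<delta> where "\<delta> = C / c * (l (e (Suc n)) - l (e (Suc (Suc n))))"
    have "l (e (Suc (Suc n))) \<le> l (e (Suc n))"
      using e(1) dec n0[of "Suc n"] n by (intro mono) auto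
    then have \<delta>: "\<delta> \<ge> 0" using C c by (auto simp: \<delta>_def)
    have "c * (D (Suc n))\<^sup>2 \<le> C * D n * (l (e (Suc n)) - l (e (Suc (Suc n))))"
      using drop[of "Suc n"] kl[of n "e (Suc (Suc n))"] e(1) dec n0[of "Suc n"] n by fastforce
    then have "(D (Suc n))\<^sup>2 \<le> D n * \<delta>"
      using c by (simp add: \<delta>_def field_simps)
    also have "\<dots> \<le> ((D n + \<delta>) / 2)\<^sup>2"
      using zero_le_power2[of "D n - \<delta>"] by (simp add: power2_eq_square field_simps)
    finally have "D (Suc n) \<le> (D n + \<delta>) / 2"
      by (rule power2_le_imp_le) (use D \<delta> in \<open>auto intro: add_nonneg_nonneg\<close>)
    then show ?thesis by (simp add: \<delta>_def add_divide_distrib)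
  qed
  have bound: "(\<Sum>k<m. D (k + n0)) \<le> 2 * D n0 + 2 * C * L / c" for m
  proof (cases m)
    case 0
    have "L \<ge> 0" using l[of "e n0"] e(1)[of n0] n0[of n0] by simp
    then show ?thesis using 0 D[of n0] C c by simp
  next
    case (Suc p)
    have "(\<Sum>k<p. D (Suc k + n0)) \<le>
        (\<Sum>k<p. D (k + n0) / 2 + C / (2 * c) * (l (e (Suc (k + n0))) - l (e (Suc (Suc k + n0)))))"
      using step by (intro sum_mono) simp
    also have "\<dots> = (\<Sum>k<p. D (k + n0)) / 2 +
        C / (2 * c) * (\<Sum>k<p. l (e (Suc (k + n0))) - l (e (Suc (Suc k + n0))))"
      by (simp only: sum.distrib sum_divide_distrib sum_distrib_left)
    also have "(\<Sum>k<p. l (e (Suc (k + n0))) - l (e (Suc (Suc k + n0)))) =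
        l (e (Suc n0)) - l (e (Suc (p + n0)))"
      using sum_lessThan_telescope'[of "\<lambda>k. l (e (Suc (k + n0)))" p] by simp
    also have "C / (2 * c) * (l (e (Suc n0)) - l (e (Suc (p + n0)))) \<le> C / (2 * c) * (2 * L)"
    proof (rule mult_left_mono)
      show "l (e (Suc n0)) - l (e (Suc (p + n0))) \<le> 2 * L"
        using l[of "e (Suc n0)"] l[of "e (Suc (p + n0))"] e(1) n0[of "Suc n0"] n0[of "Suc (p + n0)"]
        by fastforce
    qed (use C c in simp)
    finally have "(\<Sum>k<p. D (Suc k + n0)) \<le> (\<Sum>k<p. D (k + n0)) / 2 + C * L / c" by simp
    moreover have "(\<Sum>k<Suc p. D (k + n0)) = D n0 + (\<Sum>k<p. D (Suc k + n0))"
      by (subst sum.lessThan_Suc_shift) simp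
    moreover have "(\<Sum>k<p. D (k + n0)) \<le> (\<Sum>k<Suc p. D (k + n0))" using D by simp
    ultimately show ?thesis unfolding Suc by linarith
  qed
  have "summable (\<lambda>k. D (k + n0))"
    by (rule summableI_nonneg_bounded[OF D bound])
  then show ?thesis by (simp only: summable_iff_shift)
qed

section \<open>Sums over one period\<close>

definition grid_sum :: "nat \<Rightarrow> grid_fun \<Rightarrow> real" where
  "grid_sum N \<phi> = (\<Sum>i = 1..int N. \<Sum>j = 1..int N. \<phi> i j)"

lemma periodic_gridD:
  assumes "\<phi> \<in> periodic_grid N"
  shows "\<phi> (i + int N) j = \<phi> i j" "\<phi> i (j + int N) = \<phi> i j"
  using assms by (auto simp: periodic_grid_def)

lemma sum_periodic_shift:
  fixes f :: "int \<Rightarrow> real"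
  assumes "\<And>i. f (i + int N) = f i"
  shows "(\<Sum>i = 1..int N. f (i + k)) = (\<Sum>i = 1..int N. f i)"
proof (cases "N = 0")
  case False
  have one: "(\<Sum>i = 1..int N. g (i + 1)) = (\<Sum>i = 1..int N. g i)"
    if g: "\<And>i. g (i + int N) = g i" for g :: "int \<Rightarrow> real"
  proof -
    have "(\<Sum>i = 1..int N. g (i + 1)) = (\<Sum>i = 2..int N + 1. g i)"
      by (rule sum.reindex_bij_witness[where i = "\<lambda>i. i - 1" and j = "\<lambda>i. i + 1"]) auto
    also have "{2..int N + 1} = insert (1 + int N) {2..int N}" using False by auto
    also have "sum g \<dots> = g 1 + (\<Sum>i = 2..int N. g i)" using g[of 1] by simp
    also have "\<dots> = sum g (insert 1 {2..int N})" by simp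
    also have "insert 1 {2..int N} = {1..int N}" using False by auto
    finally show ?thesis .
  qed
  have per: "f (i + int N + c) = f (i + c)" for i c
    using assms[of "i + c"] by (simp add: ac_simps)
  show ?thesis
  proof (induction k rule: int_induct[where k = 0])
    case (step1 k)
    have "(\<Sum>i = 1..int N. f (i + 1 + k)) = (\<Sum>i = 1..int N. f (i + k))"
      by (rule one[of "\<lambda>i. f (i + k)", OF per])
    then show ?case using step1 by (simp add: algebra_simps)
  next
    case (step2 k)
    have "(\<Sum>i = 1..int N. f (i + 1 + (k - 1))) = (\<Sum>i = 1..int N. f (i + (k - 1)))"
      by (rule one[of "\<lambda>i. f (i + (k - 1))", OF per])
    then show ?case using step2 by (simp add: algebra_simps)
  qed simp
qed simp

lemma sum_periodic_reflect:
  fixes f :: "int \<Rightarrow> real"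
  assumes "\<And>i. f (i + int N) = f i"
  shows "(\<Sum>i = 1..int N. f (k - i)) = (\<Sum>i = 1..int N. f i)"
proof -
  have "(\<Sum>i = 1..int N. f (k - i)) = (\<Sum>i = 1..int N. f (i + (k - int N - 1)))"
    by (rule sum.reindex_bij_witness[where i = "\<lambda>i. int N + 1 - i" and j = "\<lambda>i. int N + 1 - i"])
      (auto simp: algebra_simps)
  then show ?thesis using sum_periodic_shift[of f N, OF assms] by simp
qed

lemma grid_sum_shift:
  assumes "\<phi> \<in> periodic_grid N"
  shows "grid_sum N (\<lambda>i j. \<phi> (i + a) (j + b)) = grid_sum N \<phi>"
  using sum_periodic_shift[of "\<lambda>i. \<Sum>j = 1..int N. \<phi> i j" N a]
    sum_periodic_shift[of "\<phi> (_ + a)" N b] periodic_gridD[OF assms]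
  by (simp add: grid_sum_def)

lemma grid_sum_reflect:
  assumes "\<phi> \<in> periodic_grid N"
  shows "grid_sum N (\<lambda>i j. \<phi> (a - i) (b - j)) = grid_sum N \<phi>"
  using sum_periodic_reflect[of "\<lambda>i. \<Sum>j = 1..int N. \<phi> i j" N a]
    sum_periodic_reflect[of "\<phi> (a - _)" N b] periodic_gridD[OF assms]
  by (simp add: grid_sum_def)

lemma grid_sum_add: "grid_sum N (\<lambda>i j. \<phi> i j + \<psi> i j) = grid_sum N \<phi> + grid_sum N \<psi>"
  by (simp add: grid_sum_def sum.distrib)

lemma grid_sum_diff: "grid_sum N (\<lambda>i j. \<phi> i j - \<psi> i j) = grid_sum N \<phi> - grid_sum N \<psi>"
  by (simp add: grid_sum_def sum_subtractf)

lemma grid_sum_cmult: "grid_sum N (\<lambda>i j. c * \<phi> i j) = c * grid_sum N \<phi>"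
  by (simp add: grid_sum_def sum_distrib_left)

lemma grid_sum_divide: "grid_sum N (\<lambda>i j. \<phi> i j / c) = grid_sum N \<phi> / c"
  by (simp add: grid_sum_def sum_divide_distrib)

lemma grid_sum_minus: "grid_sum N (\<lambda>i j. - \<phi> i j) = - grid_sum N \<phi>"
  by (simp add: grid_sum_def sum_negf)

lemma grid_sum_const: "grid_sum N (\<lambda>i j. c) = (real N)\<^sup>2 * c"
  by (simp add: grid_sum_def power2_eq_square)

lemmas grid_sum_linear = grid_sum_add grid_sum_diff grid_sum_cmult grid_sum_divide grid_sum_minus

lemma grid_sum_mono:
  assumes "\<And>i j. i \<in> {1..int N} \<Longrightarrow> j \<in> {1..int N} \<Longrightarrow> \<phi> i j \<le> \<psi> i j"
  shows "grid_sum N \<phi> \<le> grid_sum N \<psi>"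
  unfolding grid_sum_def using assms by (intro sum_mono) auto

lemma grid_sum_nonneg:
  assumes "\<And>i j. \<phi> i j \<ge> 0" shows "grid_sum N \<phi> \<ge> 0"
  unfolding grid_sum_def using assms by (intro sum_nonneg) auto

lemma grid_sum_ge_term:
  assumes "\<And>i j. \<phi> i j \<ge> 0" "i \<in> {1..int N}" "j \<in> {1..int N}"
  shows "\<phi> i j \<le> grid_sum N \<phi>"
proof -
  have "\<phi> i j \<le> (\<Sum>j = 1..int N. \<phi> i j)" using assms by (intro member_le_sum) auto
  also have "\<dots> \<le> grid_sum N \<phi>" unfolding grid_sum_def
    using assms by (intro member_le_sum[where f = "\<lambda>i. \<Sum>j = 1..int N. \<phi> i j"] sum_nonneg) auto
  finally show ?thesis .
qed

lemma grid_sum_abs: "\<bar>grid_sum N \<phi>\<bar> \<le> grid_sum N (\<lambda>i j. \<bar>\<phi> i j\<bar>)"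
proof -
  have "\<bar>grid_sum N \<phi>\<bar> \<le> (\<Sum>i = 1..int N. \<bar>\<Sum>j = 1..int N. \<phi> i j\<bar>)"
    unfolding grid_sum_def by (rule sum_abs)
  also have "\<dots> \<le> grid_sum N (\<lambda>i j. \<bar>\<phi> i j\<bar>)"
    unfolding grid_sum_def by (intro sum_mono sum_abs)
  finally show ?thesis .
qed

lemma grid_sum_pairs:
  "grid_sum N \<phi> = (\<Sum>p\<in>{1..int N} \<times> {1..int N}. \<phi> (fst p) (snd p))"
  by (simp add: grid_sum_def sum.cartesian_product case_prod_unfold)

lemma grid_sum_swap:
  "grid_sum N (\<lambda>i j. grid_sum N (\<lambda>k l. f i j k l)) = grid_sum N (\<lambda>k l. grid_sum N (\<lambda>i j. f i j k l))"
  unfolding grid_sum_pairs by (rule sum.swap)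

lemma grid_sum_abs_square_le:
  "(grid_sum N (\<lambda>i j. \<bar>\<phi> i j\<bar>))\<^sup>2 \<le> (real N)\<^sup>2 * grid_sum N (\<lambda>i j. (\<phi> i j)\<^sup>2)"
proof -
  let ?A = "{1..int N} \<times> {1..int N}"
  have "(\<Sum>p\<in>?A. \<bar>\<phi> (fst p) (snd p)\<bar>)\<^sup>2 \<le> (\<Sum>p\<in>?A. \<bar>\<phi> (fst p) (snd p)\<bar>\<^sup>2) * (\<Sum>p\<in>?A. 1\<^sup>2)"
    using Cauchy_Schwarz_ineq_sum[of "\<lambda>p. \<bar>\<phi> (fst p) (snd p)\<bar>" "\<lambda>_. 1" ?A] by simp
  then show ?thesis
    by (simp add: grid_sum_def sum.cartesian_product case_prod_unfold power2_eq_square mult.commute)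
qed

lemma periodic_mod:
  assumes "\<phi> \<in> periodic_grid N"
  shows "\<phi> (i mod int N) (j mod int N) = \<phi> i j"
proof -
  have shift: "f (i + k * int N) = f i" if f: "\<And>i. f (i + int N) = f i" for f :: "int \<Rightarrow> real" and i k
  proof (induction k rule: int_induct[where k = 0])
    case (step1 k)
    then show ?case using f[of "i + k * int N"] by (simp add: algebra_simps)
  next
    case (step2 k)
    then show ?case using f[of "i + (k - 1) * int N"] by (simp add: algebra_simps)
  qed simp
  have "\<phi> (i mod int N) (j mod int N) = \<phi> (i mod int N + (i div int N) * int N) (j mod int N)"
    by (rule shift[of "\<lambda>i. \<phi> i (j mod int N)", OF periodic_gridD(1)[OF assms], symmetric])
  also have "\<dots> = \<phi> i (j mod int N)" by simp
  also have "\<dots> = \<phi> i (j mod int N + (j div int N) * int N)"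
    by (rule shift[of "\<phi> i", OF periodic_gridD(2)[OF assms], symmetric])
  also have "\<dots> = \<phi> i j" by simp
  finally show ?thesis .
qed

lemma grid_sum_ge_periodic:
  assumes "\<phi> \<in> periodic_grid N" "N > 0" "\<And>i j. \<phi> i j \<ge> 0"
  shows "\<phi> i j \<le> grid_sum N \<phi>"
proof -
  have "\<phi> i j = \<phi> ((i - 1) mod int N + 1) ((j - 1) mod int N + 1)"
  proof -
    have "(\<lambda>i j. \<phi> (i + 1) (j + 1)) \<in> periodic_grid N"
      using periodic_gridD(1)[OF assms(1), of "_ + 1"] periodic_gridD(2)[OF assms(1), of _ "_ + 1"]
      by (simp add: periodic_grid_def ac_simps)
    from periodic_mod[OF this, of "i - 1" "j - 1"] show ?thesis by simp
  qed
  also have "\<dots> \<le> grid_sum N \<phi>"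
    using assms(2) by (intro grid_sum_ge_term assms(3))
      (auto simp: pos_mod_sign intro: add_increasing zless_imp_add1_zle)
  finally show ?thesis .
qed

lemma periodic_grid_shift:
  assumes "\<phi> \<in> periodic_grid N"
  shows "(\<lambda>i j. \<phi> (i + a) (j + b)) \<in> periodic_grid N"
  using periodic_gridD(1)[OF assms, of "_ + a"] periodic_gridD(2)[OF assms, of _ "_ + b"]
  by (simp add: periodic_grid_def ac_simps)

lemma periodic_grid_map2:
  assumes "\<phi> \<in> periodic_grid N" "\<psi> \<in> periodic_grid N"
  shows "(\<lambda>i j. f (\<phi> i j) (\<psi> i j)) \<in> periodic_grid N"
  using assms by (simp add: periodic_grid_def)

section \<open>Discrete convolution and Dirichlet form\<close>

definition grid_conv :: "nat \<Rightarrow> grid_fun \<Rightarrow> grid_fun \<Rightarrow> grid_fun" where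
  "grid_conv N g \<phi> = (\<lambda>i j. grid_sum N (\<lambda>k l. g k l * \<phi> (i - k) (j - l)))"

lemma periodic_grid_conv:
  assumes "\<phi> \<in> periodic_grid N"
  shows "grid_conv N g \<phi> \<in> periodic_grid N"
proof -
  have "\<phi> (i + int N - k) j = \<phi> (i - k) j" "\<phi> i (j + int N - k) = \<phi> i (j - k)" for i j k
    using periodic_gridD(1)[OF assms, of "i - k" j] periodic_gridD(2)[OF assms, of i "j - k"]
    by (simp_all add: algebra_simps)
  then show ?thesis by (simp add: periodic_grid_def grid_conv_def)
qed

lemma grid_conv_diff: "grid_conv N g (\<lambda>i j. \<phi> i j - \<psi> i j) i j = grid_conv N g \<phi> i j - grid_conv N g \<psi> i j"
  by (simp add: grid_conv_def grid_sum_diff[symmetric] right_diff_distrib)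

definition dirichlet :: "nat \<Rightarrow> grid_fun \<Rightarrow> grid_fun \<Rightarrow> real" where
  "dirichlet N \<phi> \<psi> = grid_sum N (\<lambda>i j.
     (\<phi> (i + 1) j - \<phi> i j) * (\<psi> (i + 1) j - \<psi> i j) +
     (\<phi> i (j + 1) - \<phi> i j) * (\<psi> i (j + 1) - \<psi> i j))"

text \<open>Shift invariance of the sum over a period turns each product into one with an unshifted
  \<open>\<phi>\<close>; periodicity leaves no boundary terms.\<close>

lemma summation_by_parts:
  assumes \<phi>: "\<phi> \<in> periodic_grid N" and \<psi>: "\<psi> \<in> periodic_grid N"
  shows "grid_sum N (\<lambda>i j. \<phi> i j * discrete_laplacian h \<psi> i j) = - dirichlet N \<phi> \<psi> / h\<^sup>2"
proof -
  have shift: "grid_sum N (\<lambda>i j. \<phi> (i + a) (j + b) * \<psi> (i + a') (j + b')) =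
      grid_sum N (\<lambda>i j. \<phi> i j * \<psi> (i + (a' - a)) (j + (b' - b)))" for a b a' b'
    using grid_sum_shift[OF periodic_grid_map2[OF \<phi> periodic_grid_shift[OF \<psi>, of "a' - a" "b' - b"],
          of "\<lambda>x y. x * y"], of a b]
    by (simp add: algebra_simps)
  have "dirichlet N \<phi> \<psi> = grid_sum N (\<lambda>i j.
     \<phi> (i + 1) (j + 0) * \<psi> (i + 1) (j + 0) - \<phi> (i + 1) (j + 0) * \<psi> (i + 0) (j + 0)
     - \<phi> i j * \<psi> (i + 1) j + \<phi> i j * \<psi> i j +
     (\<phi> (i + 0) (j + 1) * \<psi> (i + 0) (j + 1) - \<phi> (i + 0) (j + 1) * \<psi> (i + 0) (j + 0)
     - \<phi> i j * \<psi> i (j + 1) + \<phi> i j * \<psi> i j))"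
    unfolding dirichlet_def by (simp add: algebra_simps)
  also have "\<dots> = - grid_sum N (\<lambda>i j. \<phi> i j * (\<psi> (i + 1) j + \<psi> (i - 1) j + \<psi> i (j + 1) + \<psi> i (j - 1) - 4 * \<psi> i j))"
    unfolding grid_sum_add grid_sum_diff shift
    by (simp add: grid_sum_minus[symmetric] grid_sum_add[symmetric] grid_sum_diff[symmetric] algebra_simps)
  finally show ?thesis
    by (simp add: discrete_laplacian_def grid_sum_divide)
qed

lemma grid_sum_laplacian:
  assumes "\<phi> \<in> periodic_grid N"
  shows "grid_sum N (discrete_laplacian h \<phi>) = 0"
  using summation_by_parts[of "\<lambda>i j. 1" N \<phi> h] assms
  by (simp add: periodic_grid_def dirichlet_def grid_sum_const)

lemma dirichlet_nonneg: "dirichlet N \<phi> \<phi> \<ge> 0"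
  unfolding dirichlet_def by (intro grid_sum_nonneg add_nonneg_nonneg) auto

text \<open>The weights come from the dissipation estimate, where half of the convolution form
  appears: the factor 2 then uses up exactly the dissipation of the scheme, and 1/8 makes the other
  term cost \<open>(c - 1) / 4\<close> out of the available \<open>(c - 1) / 2\<close>.\<close>

lemma dirichlet_young:
  "- dirichlet N \<phi> \<psi> \<le> dirichlet N \<phi> \<phi> / 8 + 2 * dirichlet N \<psi> \<psi>"
proof -
  have "- (x * y) \<le> x * x / 8 + 2 * (y * y)" for x y :: real
    using zero_le_power2[of "x / 2 + 2 * y"] by (simp add: power2_eq_square field_simps)
  then have "- (x * y + x' * y') \<le> (x * x + x' * x') / 8 + 2 * (y * y + y' * y')" for x y x' y' :: real
    by (smt (verit) add_divide_distrib)
  then show ?thesis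
    unfolding dirichlet_def grid_sum_minus[symmetric] grid_sum_divide[symmetric]
      grid_sum_cmult[symmetric] grid_sum_add[symmetric]
    by (intro grid_sum_mono)
qed

text \<open>Exchanging the sums and shifting moves the translation from \<open>v\<close> to
  \<open>w\<close> with the opposite sign, which evenness of \<open>g\<close> removes.\<close>

lemma grid_conv_symmetric:
  assumes g: "g \<in> periodic_grid N" "\<And>k l. g (- k) (- l) = g k l"
    and v: "v \<in> periodic_grid N" and w: "w \<in> periodic_grid N"
  shows "grid_sum N (\<lambda>i j. w i j * grid_conv N g v i j) = grid_sum N (\<lambda>i j. v i j * grid_conv N g w i j)"
proof -
  have "grid_sum N (\<lambda>i j. w i j * grid_conv N g v i j) =
      grid_sum N (\<lambda>k l. g k l * grid_sum N (\<lambda>i j. w i j * v (i - k) (j - l)))"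
    unfolding grid_conv_def grid_sum_cmult[symmetric]
    by (subst grid_sum_swap) (simp add: ac_simps)
  also have "\<dots> = grid_sum N (\<lambda>k l. g k l * grid_sum N (\<lambda>i j. w (i + k) (j + l) * v i j))"
  proof -
    have "grid_sum N (\<lambda>i j. w (i + k) (j + l) * v i j) = grid_sum N (\<lambda>i j. w i j * v (i - k) (j - l))" for k l
      using grid_sum_shift[OF periodic_grid_map2[OF w periodic_grid_shift[OF v, of "- k" "- l"],
          of "\<lambda>x y. x * y"], of k l] by simp
    then show ?thesis by simp
  qed
  also have "\<dots> = grid_sum N (\<lambda>i j. v i j * grid_sum N (\<lambda>k l. g k l * w (i + k) (j + l)))"
    unfolding grid_sum_cmult[symmetric] by (subst grid_sum_swap) (simp add: ac_simps)
  also have "\<dots> = grid_sum N (\<lambda>i j. v i j * grid_conv N g w i j)"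
  proof -
    have "grid_sum N (\<lambda>k l. g k l * w (i + k) (j + l)) = grid_conv N g w i j" for i j
    proof -
      have "(\<lambda>k l. g k l * w (k + i) (l + j)) \<in> periodic_grid N"
        by (rule periodic_grid_map2[OF g(1) periodic_grid_shift[OF w], of "\<lambda>x y. x * y"])
      from grid_sum_reflect[OF this, of 0 0] show ?thesis
        by (simp add: g(2) grid_conv_def add.commute)
    qed
    then show ?thesis by simp
  qed
  finally show ?thesis .
qed

lemma grid_conv_le:
  assumes v: "v \<in> periodic_grid N"
  shows "\<bar>grid_conv N g v i j\<bar> \<le> grid_sum N (\<lambda>k l. \<bar>g k l\<bar>) * grid_sum N (\<lambda>k l. \<bar>v k l\<bar>)"
proof -
  have "\<bar>grid_conv N g v i j\<bar> \<le> grid_sum N (\<lambda>k l. \<bar>g k l * v (i - k) (j - l)\<bar>)"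
    unfolding grid_conv_def by (rule grid_sum_abs)
  also have "\<dots> \<le> grid_sum N (\<lambda>k l. grid_sum N (\<lambda>k l. \<bar>g k l\<bar>) * \<bar>v (i - k) (j - l)\<bar>)"
    by (intro grid_sum_mono) (auto simp: abs_mult intro!: mult_right_mono grid_sum_ge_term[where \<phi> = "\<lambda>k l. \<bar>g k l\<bar>"])
  also have "\<dots> = grid_sum N (\<lambda>k l. \<bar>g k l\<bar>) * grid_sum N (\<lambda>k l. \<bar>v k l\<bar>)"
    unfolding grid_sum_cmult
    using grid_sum_reflect[OF periodic_grid_map2[OF v v, of "\<lambda>x y. \<bar>x\<bar>"], of i j] by simp
  finally show ?thesis .
qed

lemma grid_conv_form_le:
  assumes v: "v \<in> periodic_grid N"
  shows "\<bar>grid_sum N (\<lambda>i j. v i j * grid_conv N g v i j)\<bar> \<le>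
    grid_sum N (\<lambda>k l. \<bar>g k l\<bar>) * (grid_sum N (\<lambda>i j. \<bar>v i j\<bar>))\<^sup>2"
proof -
  have "\<bar>grid_sum N (\<lambda>i j. v i j * grid_conv N g v i j)\<bar> \<le>
      grid_sum N (\<lambda>i j. \<bar>v i j * grid_conv N g v i j\<bar>)" by (rule grid_sum_abs)
  also have "\<dots> \<le> grid_sum N (\<lambda>i j. (grid_sum N (\<lambda>k l. \<bar>g k l\<bar>) * grid_sum N (\<lambda>k l. \<bar>v k l\<bar>)) * \<bar>v i j\<bar>)"
    by (intro grid_sum_mono) (auto simp: abs_mult mult.commute intro!: mult_left_mono grid_conv_le[OF v])
  finally show ?thesis unfolding grid_sum_cmult by (simp add: power2_eq_square ac_simps)
qed

text \<open>The increments of the convolution are convolutions with the increments of the kernel.\<close>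

lemma dirichlet_grid_conv:
  assumes g: "g \<in> periodic_grid N" and v: "v \<in> periodic_grid N"
    and lip: "\<And>k l. k \<in> {1..int N} \<Longrightarrow> l \<in> {1..int N} \<Longrightarrow>
      \<bar>g (k + 1) l - g k l\<bar> \<le> M \<and> \<bar>g k (l + 1) - g k l\<bar> \<le> M"
  shows "dirichlet N (grid_conv N g v) (grid_conv N g v) \<le>
    2 * M\<^sup>2 * real N ^ 4 * grid_sum N (\<lambda>i j. (v i j)\<^sup>2)"
proof (cases "N = 0")
  case True
  then show ?thesis by (simp add: dirichlet_def grid_sum_def)
next
  case False
  then have M: "M \<ge> 0" using lip[of 1 1] by fastforce
  \<comment> \<open>The shift is transferred to \<open>g\<close>, so a difference is at most
    \<open>M\<close> times the 1-norm of \<open>v\<close>. Cauchy-Schwarz produces one factor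
    \<open>(real N)\<^sup>2\<close>; the sum over the grid below produces the other.\<close>
  have *: "(grid_conv N g v (i + a) (j + b) - grid_conv N g v i j)\<^sup>2 \<le>
      M\<^sup>2 * ((real N)\<^sup>2 * grid_sum N (\<lambda>i j. (v i j)\<^sup>2))"
    if lip: "\<And>k l. k \<in> {1..int N} \<Longrightarrow> l \<in> {1..int N} \<Longrightarrow> \<bar>g (k + a) (l + b) - g k l\<bar> \<le> M" for a b i j
  proof -
    have per: "(\<lambda>k l. g k l * v (i + a - k) (j + b - l)) \<in> periodic_grid N"
    proof -
      have "v (i + a - (k + int N)) m = v (i + a - k) m" "v m (j + b - (k + int N)) = v m (j + b - k)" for k m
        using periodic_gridD(1)[OF v, of "i + a - (k + int N)" m]
          periodic_gridD(2)[OF v, of m "j + b - (k + int N)"] by (simp_all add: algebra_simps)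
      then show ?thesis using g by (simp add: periodic_grid_def)
    qed
    have "grid_conv N g v (i + a) (j + b) = grid_sum N (\<lambda>k l. g (k + a) (l + b) * v (i - k) (j - l))"
      using grid_sum_shift[OF per, of a b] by (simp add: grid_conv_def algebra_simps)
    then have eq: "grid_conv N g v (i + a) (j + b) - grid_conv N g v i j =
        grid_sum N (\<lambda>k l. (g (k + a) (l + b) - g k l) * v (i - k) (j - l))"
      by (simp add: grid_conv_def grid_sum_diff[symmetric] left_diff_distrib)
    have "\<bar>grid_conv N g v (i + a) (j + b) - grid_conv N g v i j\<bar> \<le>
        grid_sum N (\<lambda>k l. \<bar>(g (k + a) (l + b) - g k l) * v (i - k) (j - l)\<bar>)"
      unfolding eq by (rule grid_sum_abs)
    also have "\<dots> \<le> grid_sum N (\<lambda>k l. M * \<bar>v (i - k) (j - l)\<bar>)"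
      by (intro grid_sum_mono) (auto simp: abs_mult intro!: mult_right_mono lip)
    also have "\<dots> = M * grid_sum N (\<lambda>k l. \<bar>v k l\<bar>)"
      unfolding grid_sum_cmult
      using grid_sum_reflect[OF periodic_grid_map2[OF v v, of "\<lambda>x y. \<bar>x\<bar>"], of i j] by simp
    finally have "\<bar>grid_conv N g v (i + a) (j + b) - grid_conv N g v i j\<bar>\<^sup>2 \<le> (M * grid_sum N (\<lambda>k l. \<bar>v k l\<bar>))\<^sup>2"
      by (rule power_mono) simp
    then have "(grid_conv N g v (i + a) (j + b) - grid_conv N g v i j)\<^sup>2 \<le> (M * grid_sum N (\<lambda>k l. \<bar>v k l\<bar>))\<^sup>2"
      by (simp only: power2_abs)
    also have "\<dots> \<le> M\<^sup>2 * ((real N)\<^sup>2 * grid_sum N (\<lambda>i j. (v i j)\<^sup>2))"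
      unfolding power_mult_distrib by (intro mult_left_mono grid_sum_abs_square_le) simp
    finally show ?thesis .
  qed
  let ?b = "M\<^sup>2 * ((real N)\<^sup>2 * grid_sum N (\<lambda>i j. (v i j)\<^sup>2))"
  have "dirichlet N (grid_conv N g v) (grid_conv N g v) \<le> grid_sum N (\<lambda>i j. ?b + ?b)"
    unfolding dirichlet_def power2_eq_square[symmetric]
  proof (intro grid_sum_mono add_mono)
    fix i j
    show "(grid_conv N g v (i + 1) j - grid_conv N g v i j)\<^sup>2 \<le> ?b"
      using *[of 1 0 i j] lip by simp
    show "(grid_conv N g v i (j + 1) - grid_conv N g v i j)\<^sup>2 \<le> ?b"
      using *[of 0 1 i j] lip by simp
  qed
  also have "\<dots> = 2 * M\<^sup>2 * real N ^ 4 * grid_sum N (\<lambda>i j. (v i j)\<^sup>2)"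
    by (simp add: grid_sum_const power4_eq_xxxx power2_eq_square)
  finally show ?thesis .
qed

section \<open>Energy and chemical potential\<close>

definition grid_energy :: "nat \<Rightarrow> grid_fun \<Rightarrow> real \<Rightarrow> grid_fun \<Rightarrow> real" where
  "grid_energy N g c u = grid_sum N (\<lambda>i j.
     double_well (u i j) + c / 2 * (u i j)\<^sup>2 - u i j * grid_conv N g u i j / 2)"

text \<open>The gradient of \<open>grid_energy\<close> for even periodic \<open>g\<close>. With
  \<open>g\<close> the sampled kernel times \<open>\<epsilon>\<^sup>2 * h\<^sup>2\<close> and
  \<open>c\<close> its sum over a period, it is the chemical potential of the scheme.\<close>

definition grid_potential :: "nat \<Rightarrow> grid_fun \<Rightarrow> real \<Rightarrow> grid_fun \<Rightarrow> grid_fun" where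
  "grid_potential N g c u = (\<lambda>i j. u i j ^ 3 - u i j + c * u i j - grid_conv N g u i j)"

lemma periodic_grid_potential:
  "u \<in> periodic_grid N \<Longrightarrow> grid_potential N g c u \<in> periodic_grid N"
  using periodic_grid_conv[of u N g] by (simp add: periodic_grid_def grid_potential_def)

text \<open>Expansion at \<open>u\<close>, the new point of a step. The quartic part leaves
  \<open>(a - b)\<^sup>2 * ((a + b)\<^sup>2 + 2 * a\<^sup>2) / 4\<close>, dropped by its sign. The
  quadratic part, of total weight \<open>c - 1\<close>, expands exactly, and so does the convolution
  form, whose mixed terms cancel by symmetry.\<close>

lemma grid_energy_diff_le:
  assumes g: "g \<in> periodic_grid N" "\<And>k l. g (- k) (- l) = g k l"
    and u: "u \<in> periodic_grid N" and w: "w \<in> periodic_grid N"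
  defines "v \<equiv> \<lambda>i j. u i j - w i j"
  shows "grid_energy N g c u - grid_energy N g c w \<le>
    grid_sum N (\<lambda>i j. grid_potential N g c u i j * v i j)
    - (c - 1) / 2 * grid_sum N (\<lambda>i j. (v i j)\<^sup>2)
    + grid_sum N (\<lambda>i j. v i j * grid_conv N g v i j) / 2"
proof -
  have scalar: "double_well a - double_well b + c / 2 * (a\<^sup>2 - b\<^sup>2) \<le>
      (a ^ 3 - a + c * a) * (a - b) - (c - 1) / 2 * (a - b)\<^sup>2" for a b
  proof -
    have "(a ^ 3 - a + c * a) * (a - b) - (c - 1) / 2 * (a - b)\<^sup>2
        - (double_well a - double_well b + c / 2 * (a\<^sup>2 - b\<^sup>2)) = (a - b)\<^sup>2 * ((a + b)\<^sup>2 + 2 * a\<^sup>2) / 4"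
      by (simp add: double_well_def power2_eq_square power3_eq_cube field_simps)
    moreover have "(a - b)\<^sup>2 * ((a + b)\<^sup>2 + 2 * a\<^sup>2) / 4 \<ge> 0" by simp
    ultimately show ?thesis by linarith
  qed
  have point: "(double_well a + c / 2 * a\<^sup>2 - a * A / 2) - (double_well b + c / 2 * b\<^sup>2 - b * B / 2) \<le>
      (a ^ 3 - a + c * a - A) * (a - b) - (c - 1) / 2 * (a - b)\<^sup>2 + (a - b) * (A - B) / 2
      + (a * B - b * A) / 2" for a b A B
    using scalar[of a b] by (simp add: algebra_simps diff_divide_distrib add_divide_distrib)
  have "grid_energy N g c u - grid_energy N g c w \<le> grid_sum N (\<lambda>i j.
      grid_potential N g c u i j * v i j - (c - 1) / 2 * (v i j)\<^sup>2 + v i j * grid_conv N g v i j / 2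
      + (u i j * grid_conv N g w i j - w i j * grid_conv N g u i j) / 2)"
    unfolding grid_energy_def grid_sum_diff[symmetric] v_def grid_potential_def grid_conv_diff
    by (intro grid_sum_mono point)
  then show ?thesis
    unfolding grid_sum_linear using grid_conv_symmetric[OF g u w] by simp
qed

text \<open>Half of the convolution form is at most \<open>\<kappa>\<close> times the sum of
  squares, which the quartic well dominates: in the completed square the number
  \<open>\<kappa> + 3 / 2\<close> collects \<open>\<kappa>\<close>, 1/2 from the well and 1 from the
  left-hand side.\<close>

lemma grid_energy_coercive:
  assumes u: "u \<in> periodic_grid N" and c: "c \<ge> 0"
  shows "grid_sum N (\<lambda>i j. (u i j)\<^sup>2) \<le> grid_energy N g c u +
    (real N)\<^sup>2 * (grid_sum N (\<lambda>k l. \<bar>g k l\<bar>) * (real N)\<^sup>2 / 2 + 3 / 2)\<^sup>2"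
proof -
  define \<Gamma> where "\<Gamma> = grid_sum N (\<lambda>k l. \<bar>g k l\<bar>)"
  define \<kappa> where "\<kappa> = \<Gamma> * (real N)\<^sup>2 / 2"
  have \<Gamma>: "\<Gamma> \<ge> 0" unfolding \<Gamma>_def by (intro grid_sum_nonneg) simp
  have "grid_sum N (\<lambda>i j. u i j * grid_conv N g u i j) \<le> \<Gamma> * (grid_sum N (\<lambda>i j. \<bar>u i j\<bar>))\<^sup>2"
    using grid_conv_form_le[OF u, of g] by (simp add: \<Gamma>_def)
  also have "\<dots> \<le> \<Gamma> * ((real N)\<^sup>2 * grid_sum N (\<lambda>i j. (u i j)\<^sup>2))"
    by (intro mult_left_mono grid_sum_abs_square_le \<Gamma>)
  finally have quad: "grid_sum N (\<lambda>i j. u i j * grid_conv N g u i j / 2) \<le> grid_sum N (\<lambda>i j. \<kappa> * (u i j)\<^sup>2)"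
    by (simp add: grid_sum_linear \<kappa>_def)
  have scalar: "x\<^sup>2 \<le> double_well x + c / 2 * x\<^sup>2 - \<kappa> * x\<^sup>2 + (\<kappa> + 3 / 2)\<^sup>2" for x
  proof -
    have "double_well x - \<kappa> * x\<^sup>2 + (\<kappa> + 3 / 2)\<^sup>2 - x\<^sup>2 = (x\<^sup>2 / 2 - (\<kappa> + 3 / 2))\<^sup>2 + 1 / 4"
      by (simp add: double_well_def power2_eq_square field_simps)
    moreover have "(x\<^sup>2 / 2 - (\<kappa> + 3 / 2))\<^sup>2 \<ge> 0" "c / 2 * x\<^sup>2 \<ge> 0" using c by simp_all
    ultimately show ?thesis by linarith
  qed
  have "grid_sum N (\<lambda>i j. (u i j)\<^sup>2) \<le>
      grid_sum N (\<lambda>i j. double_well (u i j) + c / 2 * (u i j)\<^sup>2 - \<kappa> * (u i j)\<^sup>2 + (\<kappa> + 3 / 2)\<^sup>2)"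
    by (intro grid_sum_mono scalar)
  also have "\<dots> = grid_sum N (\<lambda>i j. double_well (u i j) + c / 2 * (u i j)\<^sup>2)
      - grid_sum N (\<lambda>i j. \<kappa> * (u i j)\<^sup>2) + (real N)\<^sup>2 * (\<kappa> + 3 / 2)\<^sup>2"
    by (simp only: grid_sum_add grid_sum_diff grid_sum_const)
  also have "\<dots> \<le> grid_energy N g c u + (real N)\<^sup>2 * (\<kappa> + 3 / 2)\<^sup>2"
    using quad unfolding grid_energy_def by (simp only: grid_sum_diff)
  finally show ?thesis by (simp add: \<kappa>_def \<Gamma>_def)
qed

text \<open>A discrete elliptic estimate. Each neighbour difference is at most \<open>A\<close>, so
  a path with one leg in each direction gives an oscillation of at most \<open>2 * N * A\<close>.
  Testing the Laplacian, which has zero sum, with \<open>\<omega> - \<omega> 1 1\<close> bounds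
  \<open>A\<^sup>2\<close> by \<open>h\<^sup>2\<close> times this oscillation times the 1-norm of
  the Laplacian; one factor \<open>A\<close> cancels.\<close>

lemma oscillation_le_laplacian:
  assumes \<omega>: "\<omega> \<in> periodic_grid N" and h: "h > 0" and ij: "i \<in> {1..int N}" "j \<in> {1..int N}"
  shows "\<bar>\<omega> i j - \<omega> 1 1\<bar> \<le> 4 * (real N)\<^sup>2 * h\<^sup>2 * grid_sum N (\<lambda>i j. \<bar>discrete_laplacian h \<omega> i j\<bar>)"
proof -
  define A where "A = sqrt (dirichlet N \<omega> \<omega>)"
  have A: "A \<ge> 0" "A\<^sup>2 = dirichlet N \<omega> \<omega>" using dirichlet_nonneg[of N \<omega>] by (auto simp: A_def)
  have step: "\<bar>\<omega> (i + 1) j - \<omega> i j\<bar> \<le> A" "\<bar>\<omega> i (j + 1) - \<omega> i j\<bar> \<le> A"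
    if "i \<in> {1..int N}" "j \<in> {1..int N}" for i j
  proof -
    have "(\<omega> (i + 1) j - \<omega> i j) * (\<omega> (i + 1) j - \<omega> i j) +
        (\<omega> i (j + 1) - \<omega> i j) * (\<omega> i (j + 1) - \<omega> i j) \<le> A\<^sup>2"
      unfolding A(2) dirichlet_def
      by (rule grid_sum_ge_term[where \<phi> = "\<lambda>i j. (\<omega> (i + 1) j - \<omega> i j) * (\<omega> (i + 1) j - \<omega> i j) +
        (\<omega> i (j + 1) - \<omega> i j) * (\<omega> i (j + 1) - \<omega> i j)"]) (use that in auto)
    then have "(\<omega> (i + 1) j - \<omega> i j)\<^sup>2 \<le> A\<^sup>2" "(\<omega> i (j + 1) - \<omega> i j)\<^sup>2 \<le> A\<^sup>2"
      unfolding power2_eq_square using zero_le_square[of "\<omega> (i + 1) j - \<omega> i j"]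
        zero_le_square[of "\<omega> i (j + 1) - \<omega> i j"] by linarith+
    then show "\<bar>\<omega> (i + 1) j - \<omega> i j\<bar> \<le> A" "\<bar>\<omega> i (j + 1) - \<omega> i j\<bar> \<le> A"
      using A(1) by (auto intro: power2_le_imp_le[of "\<bar>_\<bar>"])
  qed
  have row: "\<bar>\<omega> (1 + int k) j - \<omega> 1 j\<bar> \<le> real k * A" if "k < N" "j \<in> {1..int N}" for k j
    using that(1)
  proof (induction k)
    case (Suc k)
    then have "\<bar>\<omega> (1 + int k) j - \<omega> 1 j\<bar> \<le> real k * A" by simp
    moreover have "\<bar>\<omega> (1 + int k + 1) j - \<omega> (1 + int k) j\<bar> \<le> A" using Suc.prems that(2) by (intro step) auto
    ultimately show ?case by (simp add: algebra_simps)
  qed simp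
  have col: "\<bar>\<omega> 1 (1 + int k) - \<omega> 1 1\<bar> \<le> real k * A" if "k < N" for k
    using that
  proof (induction k)
    case (Suc k)
    then have "\<bar>\<omega> 1 (1 + int k) - \<omega> 1 1\<bar> \<le> real k * A" by simp
    moreover have "\<bar>\<omega> 1 (1 + int k + 1) - \<omega> 1 (1 + int k)\<bar> \<le> A" using Suc.prems by (intro step) auto
    ultimately show ?case by (simp add: algebra_simps)
  qed simp
  have osc: "\<bar>\<omega> i j - \<omega> 1 1\<bar> \<le> 2 * real N * A" if ij: "i \<in> {1..int N}" "j \<in> {1..int N}" for i j
  proof -
    have lt: "nat (i - 1) < N" "nat (j - 1) < N" using ij by auto
    have "\<bar>\<omega> i j - \<omega> 1 j\<bar> \<le> real (nat (i - 1)) * A" using row[OF lt(1) ij(2)] ij by simp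
    also have "\<dots> \<le> real N * A" using ij A(1) by (intro mult_right_mono) auto
    finally have 1: "\<bar>\<omega> i j - \<omega> 1 j\<bar> \<le> real N * A" .
    have "\<bar>\<omega> 1 j - \<omega> 1 1\<bar> \<le> real (nat (j - 1)) * A" using col[OF lt(2)] ij by simp
    also have "\<dots> \<le> real N * A" using ij A(1) by (intro mult_right_mono) auto
    finally show ?thesis using 1 by (simp add: algebra_simps)
  qed
  let ?S = "grid_sum N (\<lambda>i j. \<bar>discrete_laplacian h \<omega> i j\<bar>)"
  have S: "?S \<ge> 0" by (intro grid_sum_nonneg) simp
  have "A\<^sup>2 = - h\<^sup>2 * grid_sum N (\<lambda>i j. \<omega> i j * discrete_laplacian h \<omega> i j)"
    unfolding summation_by_parts[OF \<omega> \<omega>] A(2) using h by simp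
  also have "grid_sum N (\<lambda>i j. \<omega> i j * discrete_laplacian h \<omega> i j) =
      grid_sum N (\<lambda>i j. (\<omega> i j - \<omega> 1 1) * discrete_laplacian h \<omega> i j)"
    using grid_sum_laplacian[OF \<omega>, of h] by (simp add: left_diff_distrib grid_sum_linear)
  also have "- h\<^sup>2 * \<dots> \<le> h\<^sup>2 * grid_sum N (\<lambda>i j. \<bar>(\<omega> i j - \<omega> 1 1) * discrete_laplacian h \<omega> i j\<bar>)"
  proof -
    have "- X \<le> Y \<Longrightarrow> - h\<^sup>2 * X \<le> h\<^sup>2 * Y" for X Y
      using mult_left_mono[of "- X" Y "h\<^sup>2"] by simp
    then show ?thesis
      using grid_sum_abs[of N "\<lambda>i j. (\<omega> i j - \<omega> 1 1) * discrete_laplacian h \<omega> i j"] by simp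
  qed
  also have "\<dots> \<le> h\<^sup>2 * grid_sum N (\<lambda>i j. 2 * real N * A * \<bar>discrete_laplacian h \<omega> i j\<bar>)"
    by (intro mult_left_mono grid_sum_mono) (auto simp: abs_mult intro!: mult_right_mono osc)
  also have "\<dots> = (2 * real N * h\<^sup>2 * ?S) * A" by (simp add: grid_sum_linear)
  finally have "A \<le> 2 * real N * h\<^sup>2 * ?S"
    using A(1) S by (cases "A = 0") (auto simp: power2_eq_square)
  then have "2 * real N * A \<le> 2 * real N * (2 * real N * h\<^sup>2 * ?S)" by (intro mult_left_mono) auto
  then show ?thesis using osc[OF ij] by (simp add: power2_eq_square algebra_simps)
qed

section \<open>Convergence of the scheme\<close>

lemma tendsto_coordinatewise:
  fixes f :: "'a \<Rightarrow> 'b \<Rightarrow> 'c::topological_space"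
  assumes "\<And>i. ((\<lambda>x. f x i) \<longlongrightarrow> l i) F"
  shows "(f \<longlongrightarrow> l) F"
proof -
  have "limitin (product_topology (\<lambda>_. euclidean) UNIV) f l F"
    using assms by (simp add: limitin_componentwise)
  then show ?thesis by (simp add: euclidean_product_topology)
qed

text \<open>Residues make every environment decode to a periodic grid function. The offset 3 keeps
  clear of variables 0, 1 and 2 (level, quantified formulas, squared slope).\<close>

definition grid_index :: "nat \<Rightarrow> int \<Rightarrow> int \<Rightarrow> nat" where
  "grid_index N i j = prod_encode (nat (i mod int N), nat (j mod int N)) + 3"

definition grid_of_env :: "nat \<Rightarrow> (nat \<Rightarrow> real) \<Rightarrow> grid_fun" where
  "grid_of_env N x = (\<lambda>i j. x (grid_index N i j))"

definition env_of_grid :: "grid_fun \<Rightarrow> nat \<Rightarrow> real" where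
  "env_of_grid \<phi> n = (case prod_decode (n - 3) of (a, b) \<Rightarrow> \<phi> (int a) (int b))"

definition grid_vars :: "nat \<Rightarrow> nat set" where
  "grid_vars N = (\<lambda>(i, j). grid_index N i j) ` ({1..int N} \<times> {1..int N})"

lemma periodic_grid_of_env: "grid_of_env N x \<in> periodic_grid N"
  by (simp add: periodic_grid_def grid_of_env_def grid_index_def)

lemma grid_of_env_of_grid:
  assumes "\<phi> \<in> periodic_grid N" "N > 0"
  shows "grid_of_env N (env_of_grid \<phi>) = \<phi>"
proof (intro ext)
  fix i j
  have "0 \<le> i mod int N" "0 \<le> j mod int N" using assms(2) by simp_all
  then have "grid_of_env N (env_of_grid \<phi>) i j = \<phi> (i mod int N) (j mod int N)"
    by (simp add: grid_of_env_def env_of_grid_def grid_index_def)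
  also have "\<dots> = \<phi> i j" by (rule periodic_mod[OF assms(1)])
  finally show "grid_of_env N (env_of_grid \<phi>) i j = \<phi> i j" .
qed

lemma grid_vars: "finite (grid_vars N)" "grid_vars N \<subseteq> {3..}"
  by (auto simp: grid_vars_def grid_index_def)

lemma sum_grid_vars: "(\<Sum>k\<in>grid_vars N. f k) = grid_sum N (\<lambda>i j. f (grid_index N i j))"
proof -
  have inj: "i = i'" if "i \<in> {1..int N}" "i' \<in> {1..int N}" "nat (i mod int N) = nat (i' mod int N)" for i i'
  proof -
    have "int N > 0" using that(1) by auto
    then have "i mod int N \<ge> 0" "i' mod int N \<ge> 0" by simp_all
    then have "i mod int N = i' mod int N" using that(3) by simp
    then have "int N dvd i - i'" by (simp add: mod_eq_dvd_iff)
    moreover have "\<bar>i - i'\<bar> < int N" using that by auto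
    ultimately show ?thesis using dvd_imp_le_int[of "i - i'" "int N"] by fastforce
  qed
  have "inj_on (\<lambda>(i, j). grid_index N i j) ({1..int N} \<times> {1..int N})"
    by (rule inj_onI) (auto simp: grid_index_def dest: inj)
  then show ?thesis
    unfolding grid_vars_def grid_sum_pairs by (subst sum.reindex) (auto simp: case_prod_unfold)
qed

lemma grid_index_vars: "N > 0 \<Longrightarrow> grid_index N i j \<in> grid_vars N"
proof -
  assume N: "N > 0"
  define r where "r i = (i - 1) mod int N + 1" for i
  have r: "r i \<in> {1..int N}" "r i mod int N = i mod int N" for i
  proof -
    have "0 \<le> (i - 1) mod int N" "(i - 1) mod int N < int N" using N by simp_all
    then show "r i \<in> {1..int N}" unfolding r_def atLeastAtMost_iff by linarith
    show "r i mod int N = i mod int N" by (simp add: r_def mod_add_left_eq)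
  qed
  then have "grid_index N i j = grid_index N (r i) (r j)" by (simp add: grid_index_def)
  then show ?thesis using r by (auto simp: grid_vars_def)
qed

lemma grid_of_env_cong:
  assumes "N > 0" "\<forall>k\<in>grid_vars N. x k = y k"
  shows "grid_of_env N x = grid_of_env N y"
  using assms grid_index_vars by (auto simp: grid_of_env_def)

lemma polyfun_grid_of_env: "(\<lambda>x. grid_of_env N x i j) \<in> polyfun"
  unfolding grid_of_env_def by (rule polyfun.var)

lemma polyfun_grid_sum: "(\<And>i j. (\<lambda>x. f x i j) \<in> polyfun) \<Longrightarrow> (\<lambda>x. grid_sum N (f x)) \<in> polyfun"
  unfolding grid_sum_def by (intro polyfun_sum)

lemma polyfun_grid_conv:
  "(\<And>i j. (\<lambda>x. f x i j) \<in> polyfun) \<Longrightarrow> (\<lambda>x. grid_conv N g (f x) i j) \<in> polyfun"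
  unfolding grid_conv_def by (intro polyfun_grid_sum polyfun_intros)

lemma polyfun_grid_energy:
  "(\<And>i j. (\<lambda>x. f x i j) \<in> polyfun) \<Longrightarrow> (\<lambda>x. grid_energy N g c (f x)) \<in> polyfun"
  unfolding grid_energy_def double_well_def
  by (intro polyfun_grid_sum polyfun_intros polyfun_grid_conv)

lemma polyfun_grid_potential:
  "(\<And>i j. (\<lambda>x. f x i j) \<in> polyfun) \<Longrightarrow> (\<lambda>x. grid_potential N g c (f x) i j) \<in> polyfun"
  unfolding grid_potential_def by (intro polyfun_intros polyfun_grid_conv)

lemma polyfun_laplacian:
  "(\<And>i j. (\<lambda>x. f x i j) \<in> polyfun) \<Longrightarrow> (\<lambda>x. discrete_laplacian h (f x) i j) \<in> polyfun"
  unfolding discrete_laplacian_def by (intro polyfun_intros)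

text \<open>Equal masses allow a constant to be subtracted from the potential, so only its
  oscillation meets \<open>u - w\<close>. The third power of \<open>N\<close> is the square from the
  oscillation bound times a factor from Cauchy-Schwarz. The squared 2-norm of the Laplacian of the
  potential thus acts as the squared slope.\<close>

lemma grid_energy_slope:
  assumes g: "g \<in> periodic_grid N" "\<And>k l. g (- k) (- l) = g k l"
    and h: "h > 0" and c: "c \<ge> 1"
    and u: "u \<in> periodic_grid N" and w: "w \<in> periodic_grid N"
    and mass: "grid_sum N u = grid_sum N w"
  shows "grid_energy N g c u - grid_energy N g c w \<le>
    4 * real N ^ 3 * h\<^sup>2 * sqrt (grid_sum N (\<lambda>i j. (discrete_laplacian h (grid_potential N g c u) i j)\<^sup>2))
      * grid_sum N (\<lambda>i j. \<bar>u i j - w i j\<bar>)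
    + grid_sum N (\<lambda>k l. \<bar>g k l\<bar>) / 2 * (grid_sum N (\<lambda>i j. \<bar>u i j - w i j\<bar>))\<^sup>2"
proof -
  define v where "v i j = u i j - w i j" for i j
  define \<omega> where "\<omega> = grid_potential N g c u"
  let ?G = "grid_sum N (\<lambda>i j. (discrete_laplacian h \<omega> i j)\<^sup>2)"
  have v: "v \<in> periodic_grid N"
    unfolding v_def[abs_def] by (rule periodic_grid_map2[OF u w])
  have \<omega>: "\<omega> \<in> periodic_grid N" unfolding \<omega>_def by (rule periodic_grid_potential[OF u])
  have v0: "grid_sum N v = 0" using mass by (simp add: v_def[abs_def] grid_sum_diff)
  have "(grid_sum N (\<lambda>i j. \<bar>discrete_laplacian h \<omega> i j\<bar>))\<^sup>2 \<le> (real N)\<^sup>2 * ?G"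
    by (rule grid_sum_abs_square_le)
  then have lap: "grid_sum N (\<lambda>i j. \<bar>discrete_laplacian h \<omega> i j\<bar>) \<le> real N * sqrt ?G"
    using real_le_rsqrt by (fastforce simp: real_sqrt_mult)
  have osc: "\<bar>\<omega> i j - \<omega> 1 1\<bar> \<le> 4 * real N ^ 3 * h\<^sup>2 * sqrt ?G"
    if "i \<in> {1..int N}" "j \<in> {1..int N}" for i j
  proof -
    have "4 * (real N)\<^sup>2 * h\<^sup>2 * grid_sum N (\<lambda>i j. \<bar>discrete_laplacian h \<omega> i j\<bar>) \<le>
        4 * (real N)\<^sup>2 * h\<^sup>2 * (real N * sqrt ?G)"
      by (intro mult_left_mono lap) simp
    also have "\<dots> = 4 * real N ^ 3 * h\<^sup>2 * sqrt ?G"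
      by (simp add: power2_eq_square power3_eq_cube)
    finally show ?thesis using oscillation_le_laplacian[OF \<omega> h that] by linarith
  qed
  have "grid_sum N (\<lambda>i j. \<omega> i j * v i j) = grid_sum N (\<lambda>i j. (\<omega> i j - \<omega> 1 1) * v i j)"
    using v0 by (simp add: left_diff_distrib grid_sum_linear)
  also have "\<dots> \<le> grid_sum N (\<lambda>i j. \<bar>(\<omega> i j - \<omega> 1 1) * v i j\<bar>)"
    by (intro grid_sum_mono) simp
  also have "\<dots> \<le> grid_sum N (\<lambda>i j. 4 * real N ^ 3 * h\<^sup>2 * sqrt ?G * \<bar>v i j\<bar>)"
    unfolding abs_mult by (intro grid_sum_mono mult_right_mono osc) simp_all
  finally have 1: "grid_sum N (\<lambda>i j. \<omega> i j * v i j) \<le> 4 * real N ^ 3 * h\<^sup>2 * sqrt ?G * grid_sum N (\<lambda>i j. \<bar>v i j\<bar>)"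
    by (simp only: grid_sum_cmult)
  have 2: "grid_sum N (\<lambda>i j. v i j * grid_conv N g v i j) / 2 \<le>
      grid_sum N (\<lambda>k l. \<bar>g k l\<bar>) / 2 * (grid_sum N (\<lambda>i j. \<bar>v i j\<bar>))\<^sup>2"
    using grid_conv_form_le[OF v, of g] by simp
  have 3: "(c - 1) / 2 * grid_sum N (\<lambda>i j. (v i j)\<^sup>2) \<ge> 0"
    using c by (intro mult_nonneg_nonneg grid_sum_nonneg) auto
  have "grid_energy N g c u - grid_energy N g c w \<le>
    grid_sum N (\<lambda>i j. \<omega> i j * v i j) - (c - 1) / 2 * grid_sum N (\<lambda>i j. (v i j)\<^sup>2)
    + grid_sum N (\<lambda>i j. v i j * grid_conv N g v i j) / 2"
    using grid_energy_diff_le[OF g u w, of c] by (simp only: v_def[abs_def] \<omega>_def)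
  then have "grid_energy N g c u - grid_energy N g c w \<le>
      4 * real N ^ 3 * h\<^sup>2 * sqrt ?G * grid_sum N (\<lambda>i j. \<bar>v i j\<bar>)
      + grid_sum N (\<lambda>k l. \<bar>g k l\<bar>) / 2 * (grid_sum N (\<lambda>i j. \<bar>v i j\<bar>))\<^sup>2"
    using 1 2 3 by linarith
  then show ?thesis by (simp only: v_def[abs_def] \<omega>_def)
qed

text \<open>The time step restriction enters here only: the implicit scheme dissipates
  \<open>\<tau> / h\<^sup>2\<close> times the Dirichlet form of the potential, which absorbs the concave part of
  the energy.\<close>

lemma backward_euler_dissipation:
  assumes g: "g \<in> periodic_grid N" "\<And>k l. g (- k) (- l) = g k l"
    and lip: "\<And>k l. k \<in> {1..int N} \<Longrightarrow> l \<in> {1..int N} \<Longrightarrow>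
      \<bar>g (k + 1) l - g k l\<bar> \<le> M \<and> \<bar>g k (l + 1) - g k l\<bar> \<le> M"
    and h: "h > 0" and \<tau>: "\<tau> > 0" and small: "\<tau> * M\<^sup>2 * real N ^ 4 \<le> 2 * h\<^sup>2 * (c - 1)"
    and u: "u \<in> periodic_grid N" and w: "w \<in> periodic_grid N"
    and scheme: "\<And>i j. (u i j - w i j) / \<tau> = discrete_laplacian h (grid_potential N g c u) i j"
  shows "(c - 1) / 4 * grid_sum N (\<lambda>i j. (u i j - w i j)\<^sup>2) \<le> grid_energy N g c w - grid_energy N g c u"
proof -
  define v where "v i j = u i j - w i j" for i j
  define \<omega> where "\<omega> = grid_potential N g c u"
  define T where "T = \<tau> / h\<^sup>2"
  have T: "T \<ge> 0" using \<tau> by (simp add: T_def)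
  let ?Q = "grid_sum N (\<lambda>i j. (v i j)\<^sup>2)"
  have Q: "?Q \<ge> 0" by (intro grid_sum_nonneg) simp
  have v: "v \<in> periodic_grid N"
    unfolding v_def[abs_def] by (rule periodic_grid_map2[OF u w])
  have \<omega>: "\<omega> \<in> periodic_grid N" unfolding \<omega>_def by (rule periodic_grid_potential[OF u])
  have v_eq: "v i j = \<tau> * discrete_laplacian h \<omega> i j" for i j
    using scheme[of i j] \<tau> by (simp add: v_def \<omega>_def field_simps)
  \<comment> \<open>The increment is \<open>\<tau>\<close> times a Laplacian, so pairing it with a
    periodic function gives a Dirichlet form: the dissipation for \<open>\<phi> = \<omega>\<close>,
    the term to be absorbed for \<open>\<phi> = grid_conv N g v\<close>.\<close>
  have test: "grid_sum N (\<lambda>i j. \<phi> i j * v i j) = - T * dirichlet N \<phi> \<omega>" if "\<phi> \<in> periodic_grid N" for \<phi>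
  proof -
    have "grid_sum N (\<lambda>i j. \<phi> i j * v i j) = \<tau> * grid_sum N (\<lambda>i j. \<phi> i j * discrete_laplacian h \<omega> i j)"
      unfolding grid_sum_cmult[symmetric] v_eq by (simp add: ac_simps)
    then show ?thesis by (simp add: summation_by_parts[OF that \<omega>] T_def)
  qed
  have "grid_sum N (\<lambda>i j. v i j * grid_conv N g v i j) = T * - dirichlet N (grid_conv N g v) \<omega>"
    using test[OF periodic_grid_conv[OF v]] by (simp add: mult.commute)
  also have "\<dots> \<le> T * (dirichlet N (grid_conv N g v) (grid_conv N g v) / 8 + 2 * dirichlet N \<omega> \<omega>)"
    by (intro mult_left_mono dirichlet_young T)
  also have "\<dots> \<le> T * (2 * M\<^sup>2 * real N ^ 4 * ?Q / 8 + 2 * dirichlet N \<omega> \<omega>)"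
    using dirichlet_grid_conv[OF g(1) v lip] by (intro mult_left_mono T) simp
  also have "\<dots> = T * M\<^sup>2 * real N ^ 4 * ?Q / 4 + 2 * T * dirichlet N \<omega> \<omega>"
    by (simp add: algebra_simps)
  also have "T * M\<^sup>2 * real N ^ 4 * ?Q / 4 \<le> 2 * (c - 1) * ?Q / 4"
  proof -
    have "T * M\<^sup>2 * real N ^ 4 \<le> 2 * (c - 1)"
      using small h by (simp add: T_def field_simps)
    then have "T * M\<^sup>2 * real N ^ 4 * ?Q \<le> 2 * (c - 1) * ?Q" using Q by (rule mult_right_mono)
    then show ?thesis by simp
  qed
  finally have conv: "grid_sum N (\<lambda>i j. v i j * grid_conv N g v i j) \<le>
      2 * (c - 1) * ?Q / 4 + 2 * T * dirichlet N \<omega> \<omega>" by simp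
  have "grid_energy N g c u - grid_energy N g c w \<le>
      grid_sum N (\<lambda>i j. \<omega> i j * v i j) - (c - 1) / 2 * ?Q
      + grid_sum N (\<lambda>i j. v i j * grid_conv N g v i j) / 2"
    using grid_energy_diff_le[OF g u w, of c] by (simp only: v_def[abs_def] \<omega>_def)
  also have "\<dots> \<le> - T * dirichlet N \<omega> \<omega> - (c - 1) / 2 * ?Q
      + (2 * (c - 1) * ?Q / 4 + 2 * T * dirichlet N \<omega> \<omega>) / 2"
    using conv unfolding test[OF \<omega>] by simp
  also have "\<dots> = - ((c - 1) / 4 * ?Q)" by (simp add: field_simps)
  finally show ?thesis by (simp add: v_def)
qed

section \<open>Passage to the limit\<close>

lemma grid_conv_tendsto:
  assumes "\<And>i j. (\<lambda>n. u n i j) \<longlonglongrightarrow> U i j"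
  shows "(\<lambda>n. grid_conv N g (u n) i j) \<longlonglongrightarrow> grid_conv N g U i j"
  unfolding grid_conv_def grid_sum_def by (intro tendsto_intros assms)

lemma grid_potential_tendsto:
  assumes "\<And>i j. (\<lambda>n. u n i j) \<longlonglongrightarrow> U i j"
  shows "(\<lambda>n. grid_potential N g c (u n) i j) \<longlonglongrightarrow> grid_potential N g c U i j"
  unfolding grid_potential_def by (intro tendsto_intros assms grid_conv_tendsto)

lemma discrete_laplacian_tendsto:
  assumes "\<And>i j. (\<lambda>n. u n i j) \<longlonglongrightarrow> U i j" "h \<noteq> 0"
  shows "(\<lambda>n. discrete_laplacian h (u n) i j) \<longlonglongrightarrow> discrete_laplacian h U i j"
  unfolding discrete_laplacian_def using assms(2) by (intro tendsto_intros assms(1)) auto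

theorem backward_euler_converges:
  assumes N: "N > 0"
    and g: "g \<in> periodic_grid N" "\<And>k l. g (- k) (- l) = g k l"
    and lip: "\<And>k l. k \<in> {1..int N} \<Longrightarrow> l \<in> {1..int N} \<Longrightarrow>
      \<bar>g (k + 1) l - g k l\<bar> \<le> M \<and> \<bar>g k (l + 1) - g k l\<bar> \<le> M"
    and c: "c > 1" and h: "h > 0" and \<tau>: "\<tau> > 0"
    and small: "\<tau> * M\<^sup>2 * real N ^ 4 \<le> 2 * h\<^sup>2 * (c - 1)"
    and u: "\<And>n. u n \<in> periodic_grid N"
    and scheme: "\<And>n i j. (u (Suc n) i j - u n i j) / \<tau> =
      discrete_laplacian h (grid_potential N g c (u (Suc n))) i j"
  shows "\<exists>U. U \<in> periodic_grid N \<and> grid_sum N U = grid_sum N (u 0) \<and>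
    (\<forall>i j. discrete_laplacian h (grid_potential N g c U) i j = 0) \<and>
    (\<forall>i j. (\<lambda>n. u n i j) \<longlonglongrightarrow> U i j)"
proof -
  define E where "E n = grid_energy N g c (u n)" for n
  define Q where "Q n = grid_sum N (\<lambda>i j. (u (Suc n) i j - u n i j)\<^sup>2)" for n
  define D where "D n = sqrt (Q n)" for n
  have Q: "Q n \<ge> 0" for n unfolding Q_def by (intro grid_sum_nonneg) simp
  have D: "D n \<ge> 0" "(D n)\<^sup>2 = Q n" for n using Q[of n] by (auto simp: D_def)
  have drop: "(c - 1) / 4 * (D n)\<^sup>2 \<le> E n - E (Suc n)" for n
    unfolding D(2) Q_def E_def
    by (rule backward_euler_dissipation[OF g lip h \<tau> small u u scheme])
  have mass_step: "grid_sum N (u (Suc n)) = grid_sum N (u n)" for n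
  proof -
    have "grid_sum N (\<lambda>i j. (u (Suc n) i j - u n i j) / \<tau>) = 0"
      unfolding scheme using grid_sum_laplacian[OF periodic_grid_potential[OF u]] by simp
    then show ?thesis using \<tau> by (simp add: grid_sum_linear)
  qed
  have mass: "grid_sum N (u n) = grid_sum N (u 0)" for n
    by (induction n) (simp_all add: mass_step)
  have dec: "E (Suc n) \<le> E n" for n
  proof -
    have "0 \<le> (c - 1) / 4 * (D n)\<^sup>2" using c by simp
    then show ?thesis using drop[of n] by linarith
  qed
  then have decseq: "decseq E" by (simp add: decseq_Suc_iff)
  define R where "R = (real N)\<^sup>2 * (grid_sum N (\<lambda>k l. \<bar>g k l\<bar>) * (real N)\<^sup>2 / 2 + 3 / 2)\<^sup>2"
  have coercive: "grid_sum N (\<lambda>i j. (u n i j)\<^sup>2) \<le> E n + R" for n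
    unfolding E_def R_def using c by (intro grid_energy_coercive u) simp
  have "- R \<le> E n" for n
    using coercive[of n] grid_sum_nonneg[of "\<lambda>i j. (u n i j)\<^sup>2" N] by simp
  then obtain Einf where Einf: "E \<longlonglongrightarrow> Einf" "\<And>n. Einf \<le> E n"
    using decseq_convergent[OF decseq, of "- R"] by metis
  \<comment> \<open>\<open>\<bar>x\<bar> \<le> x\<^sup>2 + 1\<close> turns the bound on squares into
    a bound on values without taking roots.\<close>
  define B where "B = E 0 + R + 1"
  have bounded: "\<bar>u n i j\<bar> \<le> B" for n i j
  proof -
    have "(u n i j)\<^sup>2 \<le> grid_sum N (\<lambda>i j. (u n i j)\<^sup>2)"
      by (rule grid_sum_ge_periodic[OF periodic_grid_map2[OF u u, of "\<lambda>x y. x\<^sup>2"] N]) simp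
    also have "\<dots> \<le> E 0 + R" using coercive[of n] decseqD[OF decseq, of 0 n] by simp
    finally have "\<bar>u n i j\<bar>\<^sup>2 \<le> E 0 + R" by simp
    moreover have "\<bar>u n i j\<bar> \<le> \<bar>u n i j\<bar>\<^sup>2 + 1"
      using zero_le_power2[of "\<bar>u n i j\<bar> - 1 / 2"] by (simp add: power2_eq_square algebra_simps)
    ultimately show ?thesis by (simp add: B_def)
  qed
  have "(\<lambda>n. E n - E (Suc n)) \<longlonglongrightarrow> Einf - Einf"
    by (intro tendsto_diff Einf(1) LIMSEQ_Suc)
  then have "(\<lambda>n. 4 / (c - 1) * (E n - E (Suc n))) \<longlonglongrightarrow> 0"
    by (intro tendsto_mult_right_zero) simp
  then have Q0: "Q \<longlonglongrightarrow> 0"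
  proof (rule tendsto_sandwich[OF _ _ tendsto_const, rotated 2])
    show "\<forall>\<^sub>F n in sequentially. Q n \<le> 4 / (c - 1) * (E n - E (Suc n))"
      using drop c unfolding D(2) by (auto simp: field_simps)
  qed (simp add: Q)
  have "summable D"
  \<comment> \<open>If the limit energy is attained, dissipation makes all later increments vanish.
    Otherwise all energies exceed it strictly, as the Kurdyka-Lojasiewicz inequality for
    \<open>E - Einf\<close> requires.\<close>
  proof (cases "\<exists>n. E n = Einf")
    case True
    then obtain n where n: "E n = Einf" by blast
    have "D m = 0" if "m \<ge> n" for m
    proof -
      have "E m \<le> Einf" using decseqD[OF decseq that] n by simp
      then have "(c - 1) / 4 * (D m)\<^sup>2 \<le> 0" using drop[of m] Einf(2)[of "Suc m"] by linarith
      then show ?thesis using c by (simp add: mult_le_0_iff)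
    qed
    then show ?thesis by (intro summable_finite[of "{..<n}"]) (auto simp: not_less)
  next
    case False
    then have pos: "E n - Einf > 0" for n using Einf(2)[of n] by (metis diff_gt_0_iff_gt order_le_less)
    \<comment> \<open>The index is shifted because the scheme is implicit: the Laplacian of the
      potential at \<open>u (Suc n)\<close> is increment \<open>n\<close> divided by
      \<open>\<tau>\<close>, so \<open>G (X n) = Q n / \<tau>\<^sup>2\<close>.\<close>
    define X where "X n = env_of_grid (u (Suc n))" for n
    have X: "grid_of_env N (X n) = u (Suc n)" for n
      unfolding X_def by (rule grid_of_env_of_grid[OF u N])
    define F where "F x = grid_energy N g c (grid_of_env N x) - Einf" for x
    define G where "G x = grid_sum N (\<lambda>i j. (discrete_laplacian h (grid_potential N g c (grid_of_env N x)) i j)\<^sup>2)" for x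
    define m where "m x = grid_sum N (grid_of_env N x) - grid_sum N (u 0)" for x
    define C where "C = 4 * real N ^ 3 * h\<^sup>2"
    define K where "K = grid_sum N (\<lambda>k l. \<bar>g k l\<bar>) / 2"
    have XK: "X n \<in> {x. m x = 0 \<and> (\<forall>i\<in>grid_vars N. - B \<le> x i \<and> x i \<le> B)}" for n
    proof -
      have "X n (grid_index N i j) = u (Suc n) i j" for i j
        using fun_cong[OF fun_cong[OF X[of n], of i], of j] by (simp add: grid_of_env_def)
      then have "\<bar>X n k\<bar> \<le> B" if "k \<in> grid_vars N" for k
        using that bounded by (auto simp: grid_vars_def)
      then show ?thesis using mass[of "Suc n"] by (auto simp: m_def X abs_le_iff minus_le_iff)
    qed
    have GX: "G (X n) = Q n / \<tau>\<^sup>2" for n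
      by (simp add: G_def X scheme[symmetric] power_divide grid_sum_divide Q_def)
    have "\<exists>e>0. \<exists>l L. (\<forall>t. 0 < t \<longrightarrow> t < e \<longrightarrow> \<bar>l t\<bar> \<le> L) \<and>
      (\<forall>a b. 0 < a \<longrightarrow> a \<le> b \<longrightarrow> b < e \<longrightarrow> l a \<le> l b) \<and>
      (\<forall>x\<in>{x. m x = 0 \<and> (\<forall>i\<in>grid_vars N. - B \<le> x i \<and> x i \<le> B)}. \<forall>a. 0 < a \<longrightarrow> a \<le> F x \<longrightarrow> F x < e \<longrightarrow>
        F x - a \<le> C * sqrt (G x) * (l (F x) - l a))"
    proof (rule kurdyka_lojasiewicz[where X = X and K = K])
      show "F \<in> polyfun" unfolding F_def[abs_def]
        by (intro polyfun_intros polyfun_grid_energy polyfun_grid_of_env)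
      show "G \<in> polyfun" unfolding G_def[abs_def]
        by (intro polyfun_grid_sum polyfun_power polyfun_laplacian polyfun_grid_potential polyfun_grid_of_env)
      show "m \<in> polyfun" unfolding m_def[abs_def]
        by (intro polyfun_intros polyfun_grid_sum polyfun_grid_of_env)
      show "F x = F y \<and> G x = G y \<and> m x = m y" if "\<forall>i\<in>grid_vars N. x i = y i" for x y
        using grid_of_env_cong[OF N that] by (simp add: F_def G_def m_def)
      show "G x \<ge> 0" for x unfolding G_def by (intro grid_sum_nonneg) simp
      show "C \<ge> 0" by (simp add: C_def)
      show "K \<ge> 0" unfolding K_def by (intro divide_nonneg_nonneg grid_sum_nonneg) simp_all
      show "F x - F y \<le> C * sqrt (G x) * (\<Sum>i\<in>grid_vars N. \<bar>x i - y i\<bar>) + K * (\<Sum>i\<in>grid_vars N. \<bar>x i - y i\<bar>)\<^sup>2"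
        if "x \<in> {x. m x = 0 \<and> (\<forall>i\<in>grid_vars N. - B \<le> x i \<and> x i \<le> B)}"
          "y \<in> {x. m x = 0 \<and> (\<forall>i\<in>grid_vars N. - B \<le> x i \<and> x i \<le> B)}" for x y
      proof -
        have "grid_sum N (grid_of_env N x) = grid_sum N (grid_of_env N y)"
          using that by (simp add: m_def)
        from grid_energy_slope[OF g h _ periodic_grid_of_env periodic_grid_of_env this, of c] c
        show ?thesis unfolding sum_grid_vars F_def G_def C_def K_def by (simp add: grid_of_env_def)
      qed
      show "X n \<in> {x. m x = 0 \<and> (\<forall>i\<in>grid_vars N. - B \<le> x i \<and> x i \<le> B)}" for n by (rule XK)
      show "F (X n) > 0" for n using pos by (simp add: F_def X E_def)
      have "(\<lambda>n. E (Suc n) - Einf) \<longlonglongrightarrow> Einf - Einf"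
        by (rule tendsto_diff[OF LIMSEQ_Suc[OF Einf(1)] tendsto_const])
      then show "(\<lambda>n. F (X n)) \<longlonglongrightarrow> 0" by (simp add: F_def X E_def)
      show "(\<lambda>n. G (X n)) \<longlonglongrightarrow> 0" unfolding GX using tendsto_divide_zero[OF Q0] .
    qed (use grid_vars in auto)
    then obtain e l L where e: "e > 0" and l: "\<forall>t. 0 < t \<longrightarrow> t < e \<longrightarrow> \<bar>l t\<bar> \<le> L"
      "\<forall>a b. 0 < a \<longrightarrow> a \<le> b \<longrightarrow> b < e \<longrightarrow> l a \<le> l b"
      and kl: "\<forall>x\<in>{x. m x = 0 \<and> (\<forall>i\<in>grid_vars N. - B \<le> x i \<and> x i \<le> B)}. \<forall>a. 0 < a \<longrightarrow> a \<le> F x \<longrightarrow> F x < e \<longrightarrow>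
        F x - a \<le> C * sqrt (G x) * (l (F x) - l a)"
      by (elim exE conjE)
    show ?thesis
    proof (rule summable_of_kl_descent[where c = "(c - 1) / 4" and C = "C / \<tau>"
          and e = "\<lambda>n. E n - Einf" and ?e0.0 = e and l = l and L = L])
      show "C / \<tau> \<ge> 0" using \<tau> by (simp add: C_def)
      show "(c - 1) / 4 * (D n)\<^sup>2 \<le> E n - Einf - (E (Suc n) - Einf)" for n using drop[of n] by simp
      have "(\<lambda>n. E n - Einf) \<longlonglongrightarrow> Einf - Einf" by (intro tendsto_diff Einf(1) tendsto_const)
      then show "(\<lambda>n. E n - Einf) \<longlonglongrightarrow> 0" by simp
      show "E (Suc n) - Einf - a \<le> C / \<tau> * D n * (l (E (Suc n) - Einf) - l a)"
        if "E (Suc n) - Einf < e" "0 < a" "a \<le> E (Suc n) - Einf" for n a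
      proof -
        have FX: "F (X n) = E (Suc n) - Einf" by (simp add: F_def X E_def)
        have "sqrt (G (X n)) = D n / \<tau>"
          using \<tau> by (simp add: GX D_def real_sqrt_divide)
        then show ?thesis using kl[rule_format, OF XK[of n], of a] that unfolding FX by simp
      qed
      show "\<bar>l t\<bar> \<le> L" if "0 < t" "t < e" for t using l(1) that by blast
      show "l a \<le> l b" if "0 < a" "a \<le> b" "b < e" for a b using l(2) that by blast
    qed (use c D pos e in simp_all)
  qed
  then have diff: "summable (\<lambda>n. u (Suc n) i j - u n i j)" for i j
  proof (rule summable_comparison_test'[where N = 0])
    fix n
    have "(u (Suc n) i j - u n i j)\<^sup>2 \<le> Q n" unfolding Q_def
      by (rule grid_sum_ge_periodic[OF periodic_grid_map2[OF u u, of "\<lambda>x y. (x - y)\<^sup>2"] N]) simp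
    then have "\<bar>u (Suc n) i j - u n i j\<bar>\<^sup>2 \<le> (D n)\<^sup>2" by (simp add: D(2))
    then show "norm (u (Suc n) i j - u n i j) \<le> D n"
      unfolding real_norm_def by (rule power2_le_imp_le) (rule D(1))
  qed
  define U where "U i j = u 0 i j + (\<Sum>n. u (Suc n) i j - u n i j)" for i j
  have lim: "(\<lambda>n. u n i j) \<longlonglongrightarrow> U i j" for i j
  proof -
    have "(\<lambda>n. u 0 i j + (\<Sum>k<n. u (Suc k) i j - u k i j)) \<longlonglongrightarrow> U i j"
      unfolding U_def by (intro tendsto_intros summable_LIMSEQ diff)
    then show ?thesis by (simp add: sum_lessThan_telescope[of "\<lambda>k. u k i j"])
  qed
  have "U \<in> periodic_grid N"
  proof -
    have "U (i + int N) j = U i j" "U i (j + int N) = U i j" for i j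
      using LIMSEQ_unique[OF lim[of "i + int N" j], of "U i j"] LIMSEQ_unique[OF lim[of i "j + int N"], of "U i j"]
        lim[of i j] by (simp_all add: periodic_gridD[OF u])
    then show ?thesis by (simp add: periodic_grid_def)
  qed
  moreover have "grid_sum N U = grid_sum N (u 0)"
  proof -
    have "(\<lambda>n. grid_sum N (u n)) \<longlonglongrightarrow> grid_sum N U"
      unfolding grid_sum_def by (intro tendsto_intros lim)
    moreover have "(\<lambda>n. grid_sum N (u n)) = (\<lambda>_. grid_sum N (u 0))"
      by (rule ext) (rule mass)
    ultimately show ?thesis by (metis LIMSEQ_const_iff)
  qed
  moreover have "discrete_laplacian h (grid_potential N g c U) i j = 0" for i j
  proof -
    have "(\<lambda>n. (u (Suc n) i j - u n i j) / \<tau>) \<longlonglongrightarrow> (U i j - U i j) / \<tau>"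
      using \<tau> by (intro tendsto_intros LIMSEQ_Suc lim) simp
    moreover have "(\<lambda>n. (u (Suc n) i j - u n i j) / \<tau>) \<longlonglongrightarrow> discrete_laplacian h (grid_potential N g c U) i j"
      unfolding scheme using h
      by (intro discrete_laplacian_tendsto grid_potential_tendsto LIMSEQ_Suc lim) simp
    ultimately show ?thesis using LIMSEQ_unique by fastforce
  qed
  ultimately show ?thesis using lim by blast
qed

text \<open>The square has side \<open>2 * L\<close> because forward differences of the sampled
  kernel reach up to \<open>L + h\<close>, and \<open>h \<le> L\<close>. On this compact convex set
  the continuous derivative is bounded.\<close>

lemma admissible_kernel_lipschitz:
  assumes "admissible_kernel L J"
  shows "\<exists>C\<ge>0. \<forall>p\<in>{0..2 * L} \<times> {0..2 * L}. \<forall>q\<in>{0..2 * L} \<times> {0..2 * L}. \<bar>J p - J q\<bar> \<le> C * norm (p - q)"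
proof -
  obtain J' :: "real \<times> real \<Rightarrow> (real \<times> real) \<Rightarrow>\<^sub>L real" where
    J': "\<And>x. (J has_derivative blinfun_apply (J' x)) (at x)" "continuous_on UNIV J'"
    using assms unfolding admissible_kernel_def by blast
  let ?S = "{0..2 * L} \<times> {0..2 * L}"
  have "compact (J' ` ?S)"
    by (intro compact_continuous_image continuous_on_subset[OF J'(2)] compact_Times) auto
  then have "bounded (J' ` ?S)" by (rule compact_imp_bounded)
  then obtain C where C: "\<And>x. x \<in> ?S \<Longrightarrow> norm (J' x) \<le> C" unfolding bounded_iff by auto
  have "norm (J p - J q) \<le> max C 0 * norm (p - q)" if "p \<in> ?S" "q \<in> ?S" for p q
  proof (rule differentiable_bound[of ?S])
    show "convex ?S" by (intro convex_Times) auto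
    show "(J has_derivative blinfun_apply (J' x)) (at x within ?S)" for x
      using J'(1) by (rule has_derivative_at_withinI)
    show "onorm (blinfun_apply (J' x)) \<le> max C 0" if "x \<in> ?S" for x
      using C[OF that] by (simp add: norm_blinfun.rep_eq)
  qed (use that in auto)
  then show ?thesis by (intro exI[of _ "max C 0"]) auto
qed

theorem theorem3p4:
  fixes L :: real and J :: "real \<times> real \<Rightarrow> real"
  assumes "L > 0" and "admissible_kernel L J"
  shows "\<exists>C\<^sub>J > 0.
    \<forall>(N :: nat) (h :: real) (\<epsilon> :: real) (\<tau> :: real)
       (u :: nat \<Rightarrow> grid_fun) (\<omega> :: nat \<Rightarrow> grid_fun).
      N > 0 \<longrightarrow> h = L / real N \<longrightarrow> \<epsilon> > 0 \<longrightarrow>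
      gamma_cont \<epsilon> J L > 0 \<longrightarrow> gamma_disc \<epsilon> J N h > 0 \<longrightarrow>
      \<tau> > 0 \<longrightarrow> \<tau> \<le> 2 * gamma_disc \<epsilon> J N h / (C\<^sub>J * \<epsilon> ^ 4) \<longrightarrow>
      backward_euler_solution \<epsilon> J N h \<tau> u \<omega> \<longrightarrow>
      (\<exists>u_inf \<omega>_inf. steady_state \<epsilon> J N h (u 0) u_inf \<omega>_inf \<and>
         u \<longlonglongrightarrow> u_inf \<and> \<omega> \<longlonglongrightarrow> \<omega>_inf)"
proof -
  obtain C where C: "C \<ge> 0"
    "\<And>p q. p \<in> {0..2 * L} \<times> {0..2 * L} \<Longrightarrow> q \<in> {0..2 * L} \<times> {0..2 * L} \<Longrightarrow> \<bar>J p - J q\<bar> \<le> C * norm (p - q)"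
    using admissible_kernel_lipschitz[OF assms(2)] by blast
  have J_per: "J (x + L, y) = J (x, y)" "J (x, y + L) = J (x, y)" for x y
    using assms(2) by (auto simp: admissible_kernel_def)
  have J_even: "J (- x, - y) = J (x, y)" for x y
    using assms(2) by (auto simp: admissible_kernel_def uminus_prod_def dest: spec[of _ "(x, y)"])
  have main: "\<exists>u_inf \<omega>_inf. steady_state \<epsilon> J N h (u 0) u_inf \<omega>_inf \<and>
         u \<longlonglongrightarrow> u_inf \<and> \<omega> \<longlonglongrightarrow> \<omega>_inf"
    if N: "N > 0" and h_eq: "h = L / real N" and \<epsilon>: "\<epsilon> > 0"
      and \<gamma>: "gamma_disc \<epsilon> J N h > 0" and \<tau>: "\<tau> > 0"
      and \<tau>_le: "\<tau> \<le> 2 * gamma_disc \<epsilon> J N h / ((C\<^sup>2 * L ^ 4 + 1) * \<epsilon> ^ 4)"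
      and sol: "backward_euler_solution \<epsilon> J N h \<tau> u \<omega>"
    for N :: nat and h \<epsilon> \<tau> :: real and u \<omega> :: "nat \<Rightarrow> grid_fun"
  proof -
    have h: "h > 0" "real N * h = L" using assms(1) N by (simp_all add: h_eq)
    \<comment> \<open>All weights of the scheme go into \<open>g\<close>, so
      \<open>grid_conv\<close> carries neither \<open>\<epsilon>\<close> nor
      \<open>h\<close>.\<close>
    define g :: grid_fun where "g k l = \<epsilon>\<^sup>2 * h\<^sup>2 * J (of_int k * h, of_int l * h)" for k l
    define c where "c = \<epsilon>\<^sup>2 * discrete_conv_one J N h"
    define M where "M = \<epsilon>\<^sup>2 * h\<^sup>2 * (C * h)"
    have c: "c - 1 = gamma_disc \<epsilon> J N h" by (simp add: c_def gamma_disc_def)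
    have conv: "\<epsilon>\<^sup>2 * discrete_conv J N h w i j = grid_conv N g w i j" for w i j
      by (simp add: discrete_conv_def grid_conv_def grid_sum_def g_def sum_distrib_left ac_simps)
    have chem: "chemical_potential \<epsilon> J N h w = grid_potential N g c w" for w
      by (simp add: chemical_potential_def grid_potential_def deriv_double_well conv c_def)
    have shift: "(of_int k + real N) * h = of_int k * h + L" for k :: int
      using h(2) by (simp add: distrib_right)
    have g_per: "g \<in> periodic_grid N"
      by (simp add: periodic_grid_def g_def shift J_per)
    have g_even: "g (- k) (- l) = g k l" for k l
      by (simp add: g_def J_even)
    have lip: "\<bar>g (k + 1) l - g k l\<bar> \<le> M \<and> \<bar>g k (l + 1) - g k l\<bar> \<le> M"
      if kl: "k \<in> {1..int N}" "l \<in> {1..int N}" for k l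
    proof -
      have range: "0 \<le> of_int k * h \<and> of_int k * h + h \<le> 2 * L" if "k \<in> {1..int N}" for k :: int
      proof -
        have "of_int k \<le> real N" "real N \<ge> 1" using that N by auto
        then have "of_int k * h \<le> L" "h \<le> L"
          using h mult_right_mono[of "of_int k" "real N" h] mult_right_mono[of 1 "real N" h] by auto
        then show ?thesis using that h(1) by auto
      qed
      have "\<bar>J (of_int k * h + h, of_int l * h) - J (of_int k * h, of_int l * h)\<bar> \<le> C * h"
        using C(2)[of "(of_int k * h + h, of_int l * h)" "(of_int k * h, of_int l * h)"]
          range[OF kl(1)] range[OF kl(2)] h(1) by (simp add: norm_Pair)
      moreover have "\<bar>J (of_int k * h, of_int l * h + h) - J (of_int k * h, of_int l * h)\<bar> \<le> C * h"
        using C(2)[of "(of_int k * h, of_int l * h + h)" "(of_int k * h, of_int l * h)"]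
          range[OF kl(1)] range[OF kl(2)] h(1) by (simp add: norm_Pair)
      moreover have "\<bar>\<epsilon>\<^sup>2 * h\<^sup>2 * x - \<epsilon>\<^sup>2 * h\<^sup>2 * y\<bar> \<le> M" if "\<bar>x - y\<bar> \<le> C * h" for x y
      proof -
        have "\<bar>\<epsilon>\<^sup>2 * h\<^sup>2 * x - \<epsilon>\<^sup>2 * h\<^sup>2 * y\<bar> = \<epsilon>\<^sup>2 * h\<^sup>2 * \<bar>x - y\<bar>"
          by (simp add: right_diff_distrib[symmetric] abs_mult)
        then show ?thesis unfolding M_def using that by (simp add: mult_left_mono)
      qed
      ultimately show ?thesis by (simp add: g_def distrib_right)
    qed
    \<comment> \<open>\<open>M\<^sup>2 * N ^ 4\<close> is
      \<open>C\<^sup>2 * (N * h) ^ 4 * \<epsilon> ^ 4 * h\<^sup>2\<close>, and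
      \<open>N * h = L\<close>: here the constant becomes independent of \<open>h\<close>.\<close>
    have small: "\<tau> * M\<^sup>2 * real N ^ 4 \<le> 2 * h\<^sup>2 * (c - 1)"
    proof -
      have pos: "(C\<^sup>2 * L ^ 4 + 1) * \<epsilon> ^ 4 > 0"
        using \<epsilon> by (intro mult_pos_pos add_nonneg_pos) auto
      have "\<tau> * ((C\<^sup>2 * L ^ 4 + 1) * \<epsilon> ^ 4) \<le> 2 * (c - 1)"
        using \<tau>_le pos unfolding c[symmetric] by (simp add: pos_le_divide_eq)
      moreover have "\<tau> * (C\<^sup>2 * L ^ 4 * \<epsilon> ^ 4) \<le> \<tau> * ((C\<^sup>2 * L ^ 4 + 1) * \<epsilon> ^ 4)"
        using \<tau> by (intro mult_left_mono mult_right_mono) auto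
      ultimately have "\<tau> * (C\<^sup>2 * L ^ 4 * \<epsilon> ^ 4) * h\<^sup>2 \<le> 2 * (c - 1) * h\<^sup>2"
        by (intro mult_right_mono) auto
      moreover have "\<tau> * M\<^sup>2 * real N ^ 4 = \<tau> * (C\<^sup>2 * (real N * h) ^ 4 * \<epsilon> ^ 4) * h\<^sup>2"
        by (simp add: M_def power2_eq_square power4_eq_xxxx)
      moreover have "2 * (c - 1) * h\<^sup>2 = 2 * h\<^sup>2 * (c - 1)" by simp
      ultimately show ?thesis unfolding h(2) by argo
    qed
    have u: "u n \<in> periodic_grid N"
      and scheme: "(u (Suc n) i j - u n i j) / \<tau> = discrete_laplacian h (grid_potential N g c (u (Suc n))) i j"
      and \<omega>: "\<omega> (Suc n) = grid_potential N g c (u (Suc n))" for n i j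
      using sol unfolding backward_euler_solution_def chem by auto
    obtain U where U: "U \<in> periodic_grid N" "grid_sum N U = grid_sum N (u 0)"
      "\<And>i j. discrete_laplacian h (grid_potential N g c U) i j = 0" "\<And>i j. (\<lambda>n. u n i j) \<longlonglongrightarrow> U i j"
      using backward_euler_converges[where N = N and g = g and M = M and c = c and h = h and \<tau> = \<tau> and u = u, OF N g_per g_even lip _ h(1) \<tau> small u scheme] c \<gamma> by auto
    have "u \<longlonglongrightarrow> U" by (intro tendsto_coordinatewise U(4))
    \<comment> \<open>The scheme determines \<open>\<omega>\<close> from index 1 on, so the limit is
      first taken along \<open>Suc n\<close>.\<close>
    moreover have "(\<lambda>n. \<omega> (Suc n)) \<longlonglongrightarrow> grid_potential N g c U"
      unfolding \<omega> by (intro tendsto_coordinatewise grid_potential_tendsto LIMSEQ_Suc U(4))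
    then have "\<omega> \<longlonglongrightarrow> grid_potential N g c U" by (rule LIMSEQ_imp_Suc)
    moreover have "steady_state \<epsilon> J N h (u 0) U (grid_potential N g c U)"
      using U periodic_grid_potential[OF U(1)]
      by (simp add: steady_state_def chem grid_inner_def grid_one_def grid_sum_def)
    ultimately show ?thesis by blast
  qed
  have "C\<^sup>2 * L ^ 4 + 1 > 0" by (intro add_nonneg_pos) auto
  then show ?thesis
    by (intro exI[of _ "C\<^sup>2 * L ^ 4 + 1"] conjI allI impI main)
qed

end
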